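(* Let $\beta>0$ and $\mu,\nu\in(-1,1]$. Assume that $\alpha\in(0,2)$ and $|\mu-\nu|>\alpha/2$. Then the dispersive estimate $$\|v(t,\cdot)\|_{L^{q}(\mathbb{R}^{d})}\lesssim t^{-\frac{\alpha}{\beta}d\left(\frac1p-\frac1q\right)}\|f\|_{L^{p}(\mathbb{R}^{d})}$$ holds true for all $1\leq p<q\leq\infty$ such that $\frac1p-\frac1q<\frac{\beta}{d}$.
   Context: Here $d\geq 1$ is the dimension, $t>0$, $1/\infty=0$, and $A\lesssim B$ means $A\leq CB$ with a constant $C>0$ independent of $t$ and $f$. The function $v$ is $v(t,x)=V_{\alpha,\mu,\nu}(t,\cdot)\ast f(x)$, where $\ast$ is convolution in $x\in\mathbb{R}^d$ and the kernel is the inverse Fourier transform $$V_{\alpha,\mu,\nu}(t,x)=\int_{\mathbb{R}^{d}}e^{2\pi i x\cdot\xi}E_{\alpha}\big(e^{(\nu-\mu)\pi i}t^{\alpha}|\xi|^{\beta}\big)\,d\xi .$$ $E_{\alpha}(z)=E_{\alpha,1}(z)=\sum_{k=0}^{\infty}\frac{z^{k}}{\Gamma(\alpha k+1)}$ is the Mittag-Leffler function. For regular enough $f$, this $v$ is the explicit solution of the homogeneous Cauchy problem $e^{\mu\pi i}\partial_t^{\alpha}v(t,x)=e^{\nu\pi i}(-\Delta)^{\beta/2}v(t,x)$ for $(t,x)\in(0,\infty)\times\mathbb{R}^d$, $v(0,x)=f(x)$ for $x\in\mathbb{R}^d$. Here $\partial_t^{\alpha}$ is the Caputo derivative of order $\alpha$,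 defined by $\partial_t^{\alpha}U(t)=\frac{1}{\Gamma(1-\alpha)}\int_0^t\frac{U'(\tau)}{(t-\tau)^{\alpha}}\,d\tau$, and $(-\Delta)^{\beta/2}$ is the Fourier multiplier with symbol $|\xi|^{\beta}$.
   Formalization: The hypothesis |μ−ν| < 2−α/2 is added; without it the claim fails (α=1, β=2, d=1, ν=−μ=3/4 gives the Schrödinger group, not bounded from L^1 to L^2) or the kernel is undefined because the symbol grows exponentially. *)

theory Defs
  imports "HOL-Probability.Essential_Supremum" "HOL-Analysis.Analysis"
begin

text \<open>Lebesgue spaces on a Euclidean space, with exponent in \<open>[1, \<infinity>]\<close>.  The exponent is an
  extended real, so that \<open>1 / \<infinity> = 0\<close> is the library's convention.\<close>

definition in_Lp :: "ereal \<Rightarrow> ('a::euclidean_space \<Rightarrow> complex) \<Rightarrow> bool" where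
  "in_Lp p f \<longleftrightarrow> f \<in> borel_measurable lborel \<and>
     (if p = \<infinity> then esssup lborel (\<lambda>x. ennreal (norm (f x))) < \<infinity>
      else integrable lborel (\<lambda>x. norm (f x) powr real_of_ereal p))"

text \<open>Only meaningful for functions satisfying \<^const>\<open>in_Lp\<close>.\<close>

definition Lp_norm :: "ereal \<Rightarrow> ('a::euclidean_space \<Rightarrow> complex) \<Rightarrow> real" where
  "Lp_norm p f =
     (if p = \<infinity> then enn2real (esssup lborel (\<lambda>x. ennreal (norm (f x))))
      else (LINT x|lborel. norm (f x) powr real_of_ereal p) powr (1 / real_of_ereal p))"

primrec iterated_derivative ::
    "'a list \<Rightarrow> ('a::euclidean_space \<Rightarrow> complex) \<Rightarrow> 'a \<Rightarrow> complex" where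
  "iterated_derivative [] f = f"
| "iterated_derivative (h # hs) f =
     (\<lambda>x. frechet_derivative (iterated_derivative hs f) (at x) h)"

definition schwartz :: "('a::euclidean_space \<Rightarrow> complex) \<Rightarrow> bool" where
  "schwartz \<phi> \<longleftrightarrow>
     (\<forall>hs. set hs \<subseteq> Basis \<longrightarrow>
        (\<forall>x. iterated_derivative hs \<phi> differentiable (at x)) \<and>
        (\<forall>k::nat. bounded (range (\<lambda>x. norm x ^ k *\<^sub>R iterated_derivative hs \<phi> x))))"

definition inverse_fourier_integral ::
    "('a::euclidean_space \<Rightarrow> complex) \<Rightarrow> 'a \<Rightarrow> complex" where
  "inverse_fourier_integral \<phi> x = (LINT \<xi>|lborel. cis (2 * pi * (x \<bullet> \<xi>)) * \<phi> \<xi>)"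

text \<open>A bounded symbol \<open>m\<close> need not be integrable, so \<open>\<integral> e\<^bsup>2\<pi>ix\<xi>\<^esup> m(\<xi>) d\<xi>\<close> is read in the sense of
  tempered distributions: \<open>V\<close> is a function (unique up to null sets) whose pairing with every
  Schwartz function \<open>\<phi>\<close> is the pairing of \<open>m\<close> with the inverse Fourier transform of \<open>\<phi>\<close>.
  The integrability clauses prevent the integrals from taking the default value 0.\<close>

definition is_inverse_fourier ::
    "('a::euclidean_space \<Rightarrow> complex) \<Rightarrow> ('a \<Rightarrow> complex) \<Rightarrow> bool" where
  "is_inverse_fourier m V \<longleftrightarrow>
     m \<in> borel_measurable lborel \<and> V \<in> borel_measurable lborel \<and>
     (\<forall>\<phi>. schwartz \<phi> \<longrightarrow>
        integrable lborel (\<lambda>x. V x * \<phi> x) \<and>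
        integrable lborel (\<lambda>\<xi>. m \<xi> * inverse_fourier_integral \<phi> \<xi>) \<and>
        (LINT x|lborel. V x * \<phi> x) = (LINT \<xi>|lborel. m \<xi> * inverse_fourier_integral \<phi> \<xi>))"

definition inverse_fourier ::
    "('a::euclidean_space \<Rightarrow> complex) \<Rightarrow> 'a \<Rightarrow> complex" where
  "inverse_fourier m = (SOME V. is_inverse_fourier m V)"

definition convolve ::
    "('a::euclidean_space \<Rightarrow> complex) \<Rightarrow> ('a \<Rightarrow> complex) \<Rightarrow> 'a \<Rightarrow> complex" where
  "convolve g f x = (LINT y|lborel. g (x - y) * f y)"

definition mittag_leffler :: "real \<Rightarrow> complex \<Rightarrow> complex" where
  "mittag_leffler \<alpha> z = (\<Sum>k. z ^ k / complex_of_real (Gamma (\<alpha> * real k + 1)))"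

definition evolution_symbol ::
    "real \<Rightarrow> real \<Rightarrow> real \<Rightarrow> real \<Rightarrow> real \<Rightarrow> 'a::euclidean_space \<Rightarrow> complex" where
  "evolution_symbol \<alpha> \<beta> \<mu> \<nu> t \<xi> =
     mittag_leffler \<alpha> (cis ((\<nu> - \<mu>) * pi) * complex_of_real (t powr \<alpha> * norm \<xi> powr \<beta>))"

definition evolution_kernel ::
    "real \<Rightarrow> real \<Rightarrow> real \<Rightarrow> real \<Rightarrow> real \<Rightarrow> 'a::euclidean_space \<Rightarrow> complex" where
  "evolution_kernel \<alpha> \<beta> \<mu> \<nu> t = inverse_fourier (evolution_symbol \<alpha> \<beta> \<mu> \<nu> t)"

definition evolution_solution ::
    "real \<Rightarrow> real \<Rightarrow> real \<Rightarrow> real \<Rightarrow> ('a::euclidean_space \<Rightarrow> complex) \<Rightarrow> real \<Rightarrow> 'a \<Rightarrow> complex" where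
  "evolution_solution \<alpha> \<beta> \<mu> \<nu> f t = convolve (evolution_kernel \<alpha> \<beta> \<mu> \<nu> t) f"

end

(* By a contour shift, E_alpha(-e^(i theta) u) is a superposition over Re z = sigma of the powers
   u^(-z), 0 < sigma < 1, with exponentially decaying density exactly when
   |theta| < pi - pi alpha / 2, which is the hypothesis on |mu - nu|.  With
   u = t^alpha |xi|^beta the symbol is a superposition of Riesz symbols |xi|^(-beta z), and the
   inverse Fourier transform of |xi|^(-s) is a multiple of |x|^(s-d), growing only polynomially in Im s.
   Hence |V(t,x)| <= C t^(-alpha sigma) |x|^(beta sigma - d) whenever beta sigma < d.  Taking one
   small and one large sigma puts V(t,.) in L^r for 1 - 1/r = 1/p - 1/q with the right power of t,
   and Young's inequality concludes.  If r = infinity, then beta > d and the symbol is integrable. *)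
theory Submission
  imports Defs "HOL-Complex_Analysis.Complex_Analysis" "HOL-Probability.Probability"
begin

section \<open>Vertical growth of the Gamma function\<close>

text \<open>The kernel is a \<open>SOME\<close>-chosen representative of a tempered distribution, so
  bounds are proved for an explicit function and carried over by almost-everywhere uniqueness. That
  uniqueness and the Riesz formula both rest on Gaussians: powers of |x| are superpositions of
  centred Gaussians, and translated Gaussians already separate the functions in question.

  Polynomial growth of the Riesz constant comes from comparing two Gamma values at equal height,
  where their exponential decay cancels. Vertical growth itself follows from monotonicity of
  |Gamma(a + iy)| / Gamma(a) in a and from the reflection formula on the line Re = 1.

  The limit \<sigma> < 1 is the pole of pi / sin(pi z) at z = 1, which in general corresponds to a
  1/u tail of the Mittag-Leffler function. It is the origin of the restriction on p and q:
  |x|^(\<beta> \<sigma> - d) lies in L^r near 0 only if \<beta> \<sigma> > d (1 - 1/r) = d (1/p -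
  1/q). As \<beta> \<sigma> < d, these bounds blow up at 0, which is why a supremum bound takes
  another route.\<close>

lemma norm_Gamma_series_ratio:
  fixes a y :: real
  assumes "0 < a"
  shows "norm (Gamma_series (Complex a y) n) / Gamma_series a n = (\<Prod>k\<le>n. (a + real k) / norm (Complex (a + real k) y))"
proof -
  have 1: "norm (pochhammer (Complex a y) (Suc n)) = (\<Prod>k\<le>n. norm (Complex (a + real k) y))"
    by (simp add: pochhammer_Suc_prod prod_norm [symmetric] atLeast0AtMost) (simp add: Complex_eq algebra_simps)
  have 2: "pochhammer a (Suc n) = (\<Prod>k\<le>n. a + real k)"
    by (simp add: pochhammer_Suc_prod atLeast0AtMost)
  have 3: "norm (exp (Complex a y * of_real (ln (real n)))) = exp (a * ln (real n))"
    by simp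
  have "norm (Gamma_series (Complex a y) n) = fact n * exp (a * ln (real n)) / (\<Prod>k\<le>n. norm (Complex (a + real k) y))"
    unfolding Gamma_series_def using 1 3 by (simp add: norm_mult norm_divide)
  moreover have "Gamma_series a n = fact n * exp (a * ln (real n)) / (\<Prod>k\<le>n. a + real k)"
    unfolding Gamma_series_def using 2 by simp
  moreover have "(\<Prod>k\<le>n. a + real k) > 0" using assms by (intro prod_pos) auto
  ultimately show ?thesis by (simp add: prod_dividef)
qed

text \<open>Every factor u / |u + iy| of the Euler product increases with u, and the inequality
  survives the limit. This takes the place of Stirling's formula: a bound on one vertical line
  spreads to all lines further right.\<close>

lemma norm_Gamma_ratio_mono:
  fixes a b y :: real
  assumes "0 < a" "a \<le> b"
  shows "norm (Gamma (Complex a y)) / Gamma a \<le> norm (Gamma (Complex b y)) / Gamma b"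
proof (rule LIMSEQ_le)
  show "(\<lambda>n. norm (Gamma_series (Complex a y) n) / Gamma_series a n) \<longlonglongrightarrow> norm (Gamma (Complex a y)) / Gamma a"
    using assms by (intro tendsto_intros) (auto simp: Gamma_eq_zero_iff elim!: nonpos_Ints_cases')
  show "(\<lambda>n. norm (Gamma_series (Complex b y) n) / Gamma_series b n) \<longlonglongrightarrow> norm (Gamma (Complex b y)) / Gamma b"
    using assms by (intro tendsto_intros) (auto simp: Gamma_eq_zero_iff elim!: nonpos_Ints_cases')
  have *: "(a + real k) / norm (Complex (a + real k) y) \<le> (b + real k) / norm (Complex (b + real k) y)" for k
  proof -
    have le: "u / norm (Complex u y) \<le> v / norm (Complex v y)" if "0 < u" "u \<le> v" for u v
    proof -
      have "u * norm (Complex v y) \<le> v * norm (Complex u y)"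
      proof (rule power2_le_imp_le)
        have "u\<^sup>2 * y\<^sup>2 \<le> v\<^sup>2 * y\<^sup>2" using that by (intro mult_right_mono power_mono) auto
        then show "(u * norm (Complex v y))\<^sup>2 \<le> (v * norm (Complex u y))\<^sup>2"
          by (simp add: power_mult_distrib cmod_power2 algebra_simps)
      qed (use that in auto)
      moreover have "norm (Complex u y) > 0" "norm (Complex v y) > 0" using that by (auto simp: complex_eq_iff)
      ultimately show ?thesis by (simp add: field_simps)
    qed
    show ?thesis using assms by (intro le) auto
  qed
  show "\<exists>N. \<forall>n\<ge>N. norm (Gamma_series (Complex a y) n) / Gamma_series a n \<le> norm (Gamma_series (Complex b y) n) / Gamma_series b n"
    using assms * by (intro exI[of _ 0] allI impI, subst (1 2) norm_Gamma_series_ratio) (auto intro!: prod_mono)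
qed

text \<open>The reflection formula makes the modulus explicit, 1 / |Gamma(1 + iy)|^2 = sinh(pi y) /
  (pi y), and sinh u \<le> u e^u for u \<ge> 0. The line Re = 1 is the anchor from which
  monotonicity in the real part starts.\<close>

lemma norm_rGamma_one_plus_imaginary: "norm (rGamma (Complex 1 y)) \<le> exp (pi * \<bar>y\<bar> / 2)"
proof (cases "y = 0")
  case True
  then show ?thesis by (simp flip: complex_of_real_def one_complex.code)
next
  case False
  have sub: "\<i> * of_real y * rGamma (Complex 1 y) = rGamma (\<i> * of_real y)"
    using rGamma_plus1[of "\<i> * of_real y"] by (simp add: Complex_eq add.commute)
  have "rGamma (- (\<i> * of_real y)) = cnj (rGamma (\<i> * of_real y))"
    by (simp add: cnj_rGamma)
  then have "(norm (rGamma (\<i> * of_real y)))\<^sup>2 = norm (rGamma (\<i> * of_real y) * rGamma (- (\<i> * of_real y)))"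
    by (simp add: norm_mult power2_eq_square)
  also have "\<dots> = \<bar>y\<bar> * norm (sin (of_real pi * (\<i> * of_real y))) / pi"
    by (subst rGamma_reflection_complex') (simp add: norm_mult norm_divide)
  also have "norm (sin (of_real pi * (\<i> * of_real y))) = \<bar>sinh (pi * y)\<bar>"
  proof -
    have "sin (of_real pi * (\<i> * of_real y)) = \<i> * of_real (sinh (pi * y))"
      unfolding sin_exp_eq sinh_def by (simp add: field_simps exp_of_real flip: of_real_mult of_real_minus)
    then show ?thesis by (simp add: norm_mult)
  qed
  finally have eq: "(norm (rGamma (\<i> * of_real y)))\<^sup>2 = \<bar>y\<bar> * \<bar>sinh (pi * y)\<bar> / pi" .
  have sinh_le: "sinh u \<le> u * exp u" if "u \<ge> 0" for u :: real
  proof -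
    have "1 - 2*u \<le> exp (- (2*u))" using exp_ge_add_one_self[of "- (2*u)"] by simp
    then have "exp u * (1 - 2*u) \<le> exp u * exp (- (2*u))" by (intro mult_left_mono) auto
    also have "\<dots> = exp (-u)" by (simp add: mult_exp_exp)
    finally have "exp u * (1 - 2*u) \<le> exp (-u)" .
    then show ?thesis by (simp add: sinh_def algebra_simps)
  qed
  have "\<bar>sinh (pi * y)\<bar> = sinh (pi * \<bar>y\<bar>)" by (cases "y \<ge> 0") (auto simp: abs_if mult_less_0_iff not_le)
  also have "\<dots> \<le> pi * \<bar>y\<bar> * exp (pi * \<bar>y\<bar>)" by (rule sinh_le) auto
  finally have "\<bar>y\<bar> * \<bar>sinh (pi * y)\<bar> / pi \<le> \<bar>y\<bar> * (pi * \<bar>y\<bar> * exp (pi * \<bar>y\<bar>)) / pi"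
    by (intro divide_right_mono mult_left_mono) auto
  also have "\<dots> = y\<^sup>2 * exp (pi * \<bar>y\<bar>)" by (simp add: power2_eq_square field_simps)
  finally have "(norm (\<i> * of_real y * rGamma (Complex 1 y)))\<^sup>2 \<le> y\<^sup>2 * exp (pi * \<bar>y\<bar>)" using eq sub by simp
  then have "(norm (rGamma (Complex 1 y)))\<^sup>2 \<le> exp (pi * \<bar>y\<bar>)" using False
    by (simp add: norm_mult power_mult_distrib)
  also have "\<dots> = (exp (pi * \<bar>y\<bar> / 2))\<^sup>2" by (simp add: power2_eq_square mult_exp_exp)
  finally show ?thesis by (rule power2_le_imp_le) auto
qed

text \<open>Monotonicity started at Re = 1, where Gamma 1 = 1, carries the explicit bound to the
  half-plane on the right. The real factor \<open>rGamma (Re w)\<close> is retained because its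
  smallness later kills the contour far to the left.\<close>

lemma norm_rGamma_le:
  fixes w :: complex
  assumes "1 \<le> Re w"
  shows "norm (rGamma w) \<le> exp (pi * \<bar>Im w\<bar> / 2) * rGamma (Re w)"
proof -
  have nz: "Gamma (Complex 1 (Im w)) \<noteq> 0" "Gamma (Complex (Re w) (Im w)) \<noteq> 0"
    using assms unfolding Gamma_eq_zero_iff by (auto elim!: nonpos_Ints_cases' simp: complex_eq_iff)
  have g: "Gamma (Re w) > 0" using assms by auto
  have "norm (Gamma (Complex 1 (Im w))) / Gamma 1 \<le> norm (Gamma (Complex (Re w) (Im w))) / Gamma (Re w)"
    by (rule norm_Gamma_ratio_mono) (use assms in auto)
  then have "Gamma (Re w) * norm (Gamma (Complex 1 (Im w))) \<le> norm (Gamma w)" using g by (simp add: field_simps)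
  moreover have "norm (Gamma (Complex 1 (Im w))) > 0" "norm (Gamma w) > 0" using nz by auto
  ultimately have "1 / norm (Gamma w) \<le> (1 / norm (Gamma (Complex 1 (Im w)))) * (1 / Gamma (Re w))"
    using g by (simp add: field_simps)
  then have "norm (rGamma w) \<le> norm (rGamma (Complex 1 (Im w))) * rGamma (Re w)"
    by (simp add: rGamma_inverse_Gamma norm_inverse norm_divide inverse_eq_divide)
  also have "\<dots> \<le> exp (pi * \<bar>Im w\<bar> / 2) * rGamma (Re w)"
    by (intro mult_right_mono norm_rGamma_one_plus_imaginary) (use g in \<open>auto simp: rGamma_inverse_Gamma\<close>)
  finally show ?thesis .
qed

lemma norm_Gamma_shift_le:
  fixes b y :: real
  assumes "0 < b"
  shows "norm (Gamma (Complex (b + real n) y)) \<le> (b + real n + \<bar>y\<bar>) ^ n * norm (Gamma (Complex b y))"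
proof (induction n)
  case (Suc n)
  have eq: "Complex (b + real (Suc n)) y = Complex (b + real n) y + 1" by (simp add: complex_eq_iff)
  have "norm (Gamma (Complex (b + real (Suc n)) y)) = norm (Complex (b + real n) y) * norm (Gamma (Complex (b + real n) y))"
    unfolding eq using assms by (subst Gamma_plus1) (auto simp: norm_mult elim!: nonpos_Ints_cases' simp: complex_eq_iff)
  also have "\<dots> \<le> (b + real (Suc n) + \<bar>y\<bar>) * ((b + real (Suc n) + \<bar>y\<bar>) ^ n * norm (Gamma (Complex b y)))"
  proof (intro mult_mono)
    show "norm (Complex (b + real n) y) \<le> b + real (Suc n) + \<bar>y\<bar>"
      using cmod_le[of "Complex (b + real n) y"] assms by simp
    have "(b + real n + \<bar>y\<bar>) ^ n \<le> (b + real (Suc n) + \<bar>y\<bar>) ^ n" using assms by (intro power_mono) auto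
    then show "norm (Gamma (Complex (b + real n) y)) \<le> (b + real (Suc n) + \<bar>y\<bar>) ^ n * norm (Gamma (Complex b y))"
      using Suc by (smt (verit) mult_right_mono norm_ge_zero)
  qed (use assms in auto)
  finally show ?case by (simp add: mult_ac)
qed auto

text \<open>Both Gamma values share the height y, so their exponential decay cancels and only a
  power of y is lost. Monotonicity moves \<open>a\<close> right to \<open>b + n\<close>, and the
  functional equation comes back to \<open>b\<close>.\<close>

lemma norm_Gamma_le_power_mult:
  fixes a b :: real
  assumes "0 < a" "0 < b"
  obtains C n where "C > 0" "\<And>y. norm (Gamma (Complex a y)) \<le> C * (1 + \<bar>y\<bar>) ^ n * norm (Gamma (Complex b y))"
proof -
  obtain n where n: "real n \<ge> a" using real_arch_simple by blast
  define C where "C = Gamma a / Gamma (b + real n) * (b + real n + 1) ^ n"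
  have g: "Gamma a > 0" "Gamma (b + real n) > 0" using assms by auto
  have C: "C > 0" using g assms unfolding C_def by (auto intro!: mult_pos_pos divide_pos_pos)
  have "norm (Gamma (Complex a y)) \<le> C * (1 + \<bar>y\<bar>) ^ n * norm (Gamma (Complex b y))" for y
  proof -
    have "norm (Gamma (Complex a y)) / Gamma a \<le> norm (Gamma (Complex (b + real n) y)) / Gamma (b + real n)"
      by (rule norm_Gamma_ratio_mono) (use assms n in auto)
    then have "norm (Gamma (Complex a y)) \<le> Gamma a / Gamma (b + real n) * norm (Gamma (Complex (b + real n) y))"
      using g by (simp add: field_simps)
    also have "\<dots> \<le> Gamma a / Gamma (b + real n) * (((b + real n + 1) * (1 + \<bar>y\<bar>)) ^ n * norm (Gamma (Complex b y)))"
    proof (intro mult_left_mono order_trans[OF norm_Gamma_shift_le] mult_right_mono power_mono)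
      have "0 \<le> (b + real n) * \<bar>y\<bar>" using assms by auto
      then show "b + real n + \<bar>y\<bar> \<le> (b + real n + 1) * (1 + \<bar>y\<bar>)" by (simp add: algebra_simps)
    qed (use g assms in auto)
    also have "\<dots> = C * (1 + \<bar>y\<bar>) ^ n * norm (Gamma (Complex b y))"
      unfolding C_def by (simp add: power_mult_distrib)
    finally show ?thesis .
  qed
  then show ?thesis using C that by blast
qed

text \<open>Keep only the part t \<ge> K of the Gamma integral and bound the power below by its
  value at K. As K is free, 1 / Gamma decays faster than any prescribed exponential.\<close>

lemma powr_mult_exp_le_Gamma:
  fixes K y :: real
  assumes "K > 0" "y \<ge> 1"
  shows "K powr (y - 1) * exp (- K) \<le> Gamma y"
proof -
  have 1: "((\<lambda>t. t powr (y - 1) / exp t) has_integral Gamma y) {0..}"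
    by (rule Gamma_integral_real) (use assms in auto)
  have "((\<lambda>t. exp (- 1 * t)) has_integral exp (- 1 * K) / 1) {K..}"
    by (rule has_integral_exp_minus_to_infinity) auto
  then have 2: "((\<lambda>t. K powr (y - 1) * exp (- t)) has_integral K powr (y - 1) * exp (- K)) {K..}"
    by (intro has_integral_mult_right) simp
  then have "((\<lambda>t. if t \<in> {K..} then K powr (y - 1) * exp (- t) else 0) has_integral K powr (y - 1) * exp (- K)) {0..}"
    by (subst has_integral_restrict) (use assms in auto)
  then show ?thesis using 1
  proof (rule has_integral_le)
    fix t assume "t \<in> {0::real..}"
    have "K powr (y - 1) * exp (- t) \<le> t powr (y - 1) / exp t" if "t \<ge> K"
      unfolding exp_minus divide_inverse using that assms by (intro mult_right_mono powr_mono2) auto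
    then show "(if t \<in> {K..} then K powr (y - 1) * exp (- t) else 0) \<le> t powr (y - 1) / exp t" by auto
  qed
qed

section \<open>Mellin--Barnes representation of the Mittag-Leffler function\<close>

lemma power_le_fact_mult_exp:
  fixes u :: real
  assumes "u \<ge> 0"
  shows "u ^ n \<le> fact n * exp u"
proof -
  have "(\<lambda>k. u ^ k /\<^sub>R fact k) sums exp u" by (rule exp_converges)
  then have "(\<Sum>k\<in>{n}. u ^ k /\<^sub>R fact k) \<le> exp u"
    using assms by (intro sum_le_suminf[THEN order_trans, of _ "{n}"]) (auto simp: sums_iff intro!: mult_nonneg_nonneg)
  then show ?thesis by (simp add: field_simps)
qed

lemma integrable_exp_minus_abs:
  fixes c :: real
  assumes "c > 0"
  shows "integrable lborel (\<lambda>y::real. exp (- c * \<bar>y\<bar>))"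
proof -
  have "(\<lambda>y. exp (- c * y)) absolutely_integrable_on {0..}"
    using assms by (intro nonnegative_absolutely_integrable_1 integrable_on_exp_minus_to_infinity) auto
  then have 1: "integrable lborel (\<lambda>y::real. indicator {0..} y * exp (- c * y))"
    unfolding set_integrable_def by (subst (asm) integrable_completion) auto
  from lborel_integrable_real_affine[OF this, of "-1" 0]
  have 2: "integrable lborel (\<lambda>y::real. indicator {0..} (- y) * exp (- c * (- y)))" by simp
  show ?thesis
    by (rule Bochner_Integration.integrable_bound[OF Bochner_Integration.integrable_add[OF 1 2]])
       (auto simp: indicator_def abs_if)
qed

lemma integrable_power_mult_exp_minus_abs:
  fixes c :: real
  assumes "c > 0"
  shows "integrable lborel (\<lambda>y::real. (1 + \<bar>y\<bar>) ^ n * exp (- c * \<bar>y\<bar>))"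
proof (rule Bochner_Integration.integrable_bound)
  \<comment> \<open>Half of the exponential absorbs the polynomial: the constants come from u^n
    \<le> n! e^u at u = (c / 2) (1 + |y|).\<close>
  show "integrable lborel (\<lambda>y::real. fact n * (2 / c) ^ n * exp (c / 2) * exp (- (c / 2) * \<bar>y\<bar>))"
    using assms by (intro integrable_mult_right integrable_exp_minus_abs) auto
  have "(1 + \<bar>y\<bar>) ^ n * exp (- c * \<bar>y\<bar>) \<le> fact n * (2 / c) ^ n * exp (c / 2) * exp (- (c / 2) * \<bar>y\<bar>)" for y
  proof -
    have "(c / 2 * (1 + \<bar>y\<bar>)) ^ n \<le> fact n * exp (c / 2 * (1 + \<bar>y\<bar>))"
      using assms by (intro power_le_fact_mult_exp) auto
    then have "(2 / c) ^ n * (c / 2 * (1 + \<bar>y\<bar>)) ^ n \<le> (2 / c) ^ n * (fact n * exp (c / 2 * (1 + \<bar>y\<bar>)))"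
      using assms by (intro mult_left_mono) auto
    moreover have "(2 / c) ^ n * (c / 2 * (1 + \<bar>y\<bar>)) ^ n = (1 + \<bar>y\<bar>) ^ n"
    proof -
      have "(2 / c) ^ n * (c / 2 * (1 + \<bar>y\<bar>)) ^ n = (2 / c * (c / 2 * (1 + \<bar>y\<bar>))) ^ n"
        by (simp only: power_mult_distrib)
      also have "2 / c * (c / 2 * (1 + \<bar>y\<bar>)) = 1 + \<bar>y\<bar>" using assms by simp
      finally show ?thesis .
    qed
    ultimately have "(1 + \<bar>y\<bar>) ^ n \<le> fact n * (2 / c) ^ n * exp (c / 2 * (1 + \<bar>y\<bar>))"
      by (simp add: mult_ac)
    then have "(1 + \<bar>y\<bar>) ^ n * exp (- c * \<bar>y\<bar>) \<le> fact n * (2 / c) ^ n * exp (c / 2 * (1 + \<bar>y\<bar>)) * exp (- c * \<bar>y\<bar>)"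
      by (intro mult_right_mono) auto
    also have "\<dots> = fact n * (2 / c) ^ n * exp (c / 2) * exp (- (c / 2) * \<bar>y\<bar>)"
      by (simp add: mult_exp_exp mult.assoc) (simp add: field_simps)
    finally show ?thesis .
  qed
  then show "AE y in lborel. norm ((1 + \<bar>y\<bar>) ^ n * exp (- c * \<bar>y\<bar>)) \<le> norm (fact n * (2 / c) ^ n * exp (c / 2) * exp (- (c / 2) * \<bar>y\<bar>))"
    using assms by (auto simp: abs_mult)
qed auto

text \<open>The bound for vertical lines that avoid the integers: there the first factor is a
  positive constant.\<close>

lemma cosh_times_sin_le_norm_sin: "\<bar>sin (pi * x)\<bar> * cosh (pi * y) \<le> norm (sin (of_real pi * Complex x y))"
proof -
  have "\<bar>Re (sin (of_real pi * Complex x y))\<bar> = \<bar>sin (pi * x)\<bar> * cosh (pi * y)"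
    by (simp add: Re_sin abs_mult cosh_def exp_minus add_pos_pos)
  then show ?thesis using abs_Re_le_cmod by metis
qed

text \<open>The bound for horizontal segments, uniform in x and hence indifferent to integers passed
  above or below. It rests on |sin(pi z)|^2 = sin(pi x)^2 + sinh(pi y)^2.\<close>

lemma sinh_le_norm_sin: "\<bar>sinh (pi * y)\<bar> \<le> norm (sin (of_real pi * Complex x y))"
proof (rule power2_le_imp_le)
  have "(norm (sin (of_real pi * Complex x y)))\<^sup>2 = (sin (pi*x))\<^sup>2 * (cosh (pi*y))\<^sup>2 + (cos (pi*x))\<^sup>2 * (sinh (pi*y))\<^sup>2"
    by (simp add: cmod_power2 Re_sin Im_sin cosh_def sinh_def power_mult_distrib power_divide)
  also have "\<dots> = (sin (pi*x))\<^sup>2 + (sinh (pi*y))\<^sup>2"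
    by (simp add: cosh_square_eq cos_squared_eq algebra_simps)
  finally show "\<bar>sinh (pi * y)\<bar>\<^sup>2 \<le> (norm (sin (of_real pi * Complex x y)))\<^sup>2" by simp
qed auto

text \<open>By reflection this is Gamma(z) Gamma(1 - z) / Gamma(1 - \<alpha> z), the Mellin
  transform of E_\<alpha>(-u) in the strip 0 < Re z < 1. Since \<open>rGamma\<close> is entire,
  singularities can come only from zeros of the sine.\<close>

definition mellin_kernel :: "real \<Rightarrow> complex \<Rightarrow> complex" where
  "mellin_kernel \<alpha> z = of_real pi / sin (of_real pi * z) * rGamma (1 - of_real \<alpha> * z)"

text \<open>As \<open>\<alpha> < 2\<close>, two steps of the functional equation move the argument to real part at least 1.\<close>

lemma norm_rGamma_mellin_le:
  assumes "0 < \<alpha>" "\<alpha> < 2" "Re z \<le> 1"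
  shows "norm (rGamma (1 - of_real \<alpha> * z))
      \<le> 4 * (1 + norm z)\<^sup>2 * (exp (pi * \<alpha> * \<bar>Im z\<bar> / 2) * rGamma (3 - \<alpha> * Re z))"
proof -
  define w where "w = 1 - of_real \<alpha> * z"
  have "\<alpha> * Re z \<le> \<alpha>" using mult_left_mono[of "Re z" 1 \<alpha>] assms by simp
  moreover have "Re (w + 1 + 1) = 3 - \<alpha> * Re z" by (simp add: w_def)
  ultimately have re: "1 \<le> Re (w + 1 + 1)" using assms by linarith
  have b: "norm (rGamma (w + 1 + 1)) \<le> exp (pi * \<alpha> * \<bar>Im z\<bar> / 2) * rGamma (3 - \<alpha> * Re z)"
    using norm_rGamma_le[OF re] assms by (simp add: w_def abs_mult mult_ac algebra_simps)
  have "rGamma w = w * (w + 1) * rGamma (w + 1 + 1)"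
    by (simp only: rGamma_plus1 mult.assoc)
  then have "norm (rGamma w) = norm w * norm (w + 1) * norm (rGamma (w + 1 + 1))"
    by (simp add: norm_mult)
  also have "\<dots> \<le> (2 * (1 + norm z)) * (2 * (1 + norm z)) * (exp (pi * \<alpha> * \<bar>Im z\<bar> / 2) * rGamma (3 - \<alpha> * Re z))"
  proof (intro mult_mono b)
    have az: "norm (of_real \<alpha> * z) \<le> 2 * norm z" using assms by (simp add: norm_mult mult_right_mono)
    show "norm w \<le> 2 * (1 + norm z)" unfolding w_def
      using norm_triangle_ineq4[of 1 "of_real \<alpha> * z"] az by simp
    have "w + 1 = 2 - of_real \<alpha> * z" by (simp add: w_def)
    then show "norm (w + 1) \<le> 2 * (1 + norm z)"
      using norm_triangle_ineq4[of 2 "of_real \<alpha> * z"] az by simp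
  qed auto
  also have "\<dots> = 4 * (1 + norm z)\<^sup>2 * (exp (pi * \<alpha> * \<bar>Im z\<bar> / 2) * rGamma (3 - \<alpha> * Re z))"
    by (simp only: power2_eq_square)
  finally show ?thesis unfolding w_def .
qed

text \<open>The exponential is u^(-z) for u = exp w. The logarithm \<open>w\<close> is taken as the
  variable so that the power is single valued and \<open>Im w\<close> is the argument of u, not
  reduced modulo 2 pi.\<close>

definition mellin_integrand :: "real \<Rightarrow> complex \<Rightarrow> complex \<Rightarrow> complex" where
  "mellin_integrand \<alpha> w z = mellin_kernel \<alpha> z * exp (- z * w)"

text \<open>The rates in |y| are - pi from the sine, + pi \<alpha> / 2 from \<open>rGamma\<close>,
  and at most + |Im w| from the power; their sum is negative precisely under the sector condition.
  The lower bound on the sine is left as a parameter \<open>S\<close>, since vertical lines and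
  horizontal segments supply different ones.\<close>

lemma norm_mellin_integrand_le:
  assumes "0 < \<alpha>" "\<alpha> < 2" "x \<le> 1" "S > 0"
    and S: "S * exp (pi * \<bar>y\<bar>) \<le> norm (sin (of_real pi * Complex x y))"
  shows "norm (mellin_integrand \<alpha> w (Complex x y)) \<le>
     4 * pi / S * (1 + \<bar>x\<bar>)\<^sup>2 * rGamma (3 - \<alpha> * x) * exp (- x * Re w)
       * ((1 + \<bar>y\<bar>)\<^sup>2 * exp (- (pi - pi * \<alpha> / 2 - \<bar>Im w\<bar>) * \<bar>y\<bar>))"
proof -
  let ?z = "Complex x y"
  let ?E = "exp (pi * \<alpha> * \<bar>y\<bar> / 2)"
  have "\<alpha> * x \<le> \<alpha>" using mult_left_mono[of x 1 \<alpha>] assms by simp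
  then have "0 < Gamma (3 - \<alpha> * x)" using assms by (intro Gamma_real_pos) linarith
  then have rG: "0 \<le> rGamma (3 - \<alpha> * x)" by (simp add: rGamma_inverse_Gamma)
  have "norm ?z \<le> \<bar>x\<bar> + \<bar>y\<bar>" using cmod_le[of ?z] by simp
  then have "1 + norm ?z \<le> (1 + \<bar>x\<bar>) * (1 + \<bar>y\<bar>)" by (simp add: algebra_simps) (smt (verit) mult_nonneg_nonneg abs_ge_zero)
  then have "(1 + norm ?z)\<^sup>2 \<le> ((1 + \<bar>x\<bar>) * (1 + \<bar>y\<bar>))\<^sup>2" by (intro power_mono) auto
  then have nz: "(1 + norm ?z)\<^sup>2 \<le> (1 + \<bar>x\<bar>)\<^sup>2 * (1 + \<bar>y\<bar>)\<^sup>2" by (simp add: power_mult_distrib)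
  have 1: "norm (rGamma (1 - of_real \<alpha> * ?z)) \<le> 4 * ((1 + \<bar>x\<bar>)\<^sup>2 * (1 + \<bar>y\<bar>)\<^sup>2) * (?E * rGamma (3 - \<alpha> * x))"
  proof -
    have "norm (rGamma (1 - of_real \<alpha> * ?z)) \<le> 4 * (1 + norm ?z)\<^sup>2 * (?E * rGamma (3 - \<alpha> * x))"
      using norm_rGamma_mellin_le[OF assms(1,2), of ?z] assms(3) by simp
    also have "\<dots> \<le> 4 * ((1 + \<bar>x\<bar>)\<^sup>2 * (1 + \<bar>y\<bar>)\<^sup>2) * (?E * rGamma (3 - \<alpha> * x))"
      by (intro mult_right_mono mult_left_mono nz) (use rG in auto)
    finally show ?thesis .
  qed
  have 2: "norm (of_real pi / sin (of_real pi * ?z)) \<le> pi / S * exp (- pi * \<bar>y\<bar>)"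
  proof -
    have "norm (of_real pi / sin (of_real pi * ?z)) \<le> pi / (S * exp (pi * \<bar>y\<bar>))"
      unfolding norm_divide using S \<open>S > 0\<close> by (intro frac_le) auto
    then show ?thesis by (simp add: exp_minus field_simps)
  qed
  have 3: "norm (exp (- ?z * w)) \<le> exp (- x * Re w) * exp (\<bar>Im w\<bar> * \<bar>y\<bar>)"
  proof -
    have "y * Im w \<le> \<bar>Im w\<bar> * \<bar>y\<bar>" by (simp add: abs_mult[symmetric] mult.commute)
    then show ?thesis by (simp add: mult_exp_exp)
  qed
  have "norm (mellin_integrand \<alpha> w ?z) = norm (of_real pi / sin (of_real pi * ?z)) * norm (rGamma (1 - of_real \<alpha> * ?z)) * norm (exp (- ?z * w))"
    unfolding mellin_integrand_def mellin_kernel_def norm_mult by simp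
  also have "\<dots> \<le> (pi / S * exp (- pi * \<bar>y\<bar>)) * (4 * ((1 + \<bar>x\<bar>)\<^sup>2 * (1 + \<bar>y\<bar>)\<^sup>2) * (?E * rGamma (3 - \<alpha> * x))) * (exp (- x * Re w) * exp (\<bar>Im w\<bar> * \<bar>y\<bar>))"
    using rG assms by (intro mult_mono 1 2 3) auto
  also have "\<dots> = 4 * pi / S * (1 + \<bar>x\<bar>)\<^sup>2 * rGamma (3 - \<alpha> * x) * exp (- x * Re w) * ((1 + \<bar>y\<bar>)\<^sup>2 * (exp (- pi * \<bar>y\<bar>) * ?E * exp (\<bar>Im w\<bar> * \<bar>y\<bar>)))"
    by (simp add: mult_ac)
  also have "exp (- pi * \<bar>y\<bar>) * ?E * exp (\<bar>Im w\<bar> * \<bar>y\<bar>) = exp (- (pi - pi * \<alpha> / 2 - \<bar>Im w\<bar>) * \<bar>y\<bar>)"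
    by (simp add: mult_exp_exp algebra_simps)
  finally show ?thesis .
qed

lemma norm_mellin_integrand_vertical:
  assumes "0 < \<alpha>" "\<alpha> < 2" "x \<le> 1" "sin (pi * x) \<noteq> 0"
  shows "norm (mellin_integrand \<alpha> w (Complex x y)) \<le>
     8 * pi / \<bar>sin (pi * x)\<bar> * (1 + \<bar>x\<bar>)\<^sup>2 * rGamma (3 - \<alpha> * x) * exp (- x * Re w)
       * ((1 + \<bar>y\<bar>)\<^sup>2 * exp (- (pi - pi * \<alpha> / 2 - \<bar>Im w\<bar>) * \<bar>y\<bar>))"
proof -
  have "exp (pi * \<bar>y\<bar>) / 2 \<le> cosh (pi * \<bar>y\<bar>)" by (simp add: cosh_def)
  also have "\<dots> = cosh (pi * y)" by (cases "y \<ge> 0") (auto simp: abs_if)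
  finally have "\<bar>sin (pi * x)\<bar> * (exp (pi * \<bar>y\<bar>) / 2) \<le> \<bar>sin (pi * x)\<bar> * cosh (pi * y)"
    by (intro mult_left_mono) auto
  with cosh_times_sin_le_norm_sin[of x y]
  have "\<bar>sin (pi * x)\<bar> / 2 * exp (pi * \<bar>y\<bar>) \<le> norm (sin (of_real pi * Complex x y))" by simp
  from norm_mellin_integrand_le[OF assms(1-3) _ this, of w] assms(4) show ?thesis by simp
qed

lemma norm_mellin_integrand_horizontal:
  assumes "0 < \<alpha>" "\<alpha> < 2" "x \<le> 1" "1 \<le> \<bar>y\<bar>"
  shows "norm (mellin_integrand \<alpha> w (Complex x y)) \<le>
     16 * pi * (1 + \<bar>x\<bar>)\<^sup>2 * rGamma (3 - \<alpha> * x) * exp (- x * Re w)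
       * ((1 + \<bar>y\<bar>)\<^sup>2 * exp (- (pi - pi * \<alpha> / 2 - \<bar>Im w\<bar>) * \<bar>y\<bar>))"
proof -
  have "1 * 1 \<le> pi * \<bar>y\<bar>" using assms(4) pi_ge_two by (intro mult_mono) auto
  then have "exp (- (pi * \<bar>y\<bar>)) \<le> exp (pi * \<bar>y\<bar>) / 2"
  proof -
    have "2 \<le> exp (1::real)" using exp_ge_add_one_self[of 1] by simp
    also have "\<dots> \<le> exp (2 * (pi * \<bar>y\<bar>))" using \<open>1 * 1 \<le> pi * \<bar>y\<bar>\<close> by auto
    finally have "2 * exp (- (pi * \<bar>y\<bar>)) \<le> exp (2 * (pi * \<bar>y\<bar>)) * exp (- (pi * \<bar>y\<bar>))" by (intro mult_right_mono) auto
    also have "\<dots> = exp (pi * \<bar>y\<bar>)" by (simp add: mult_exp_exp)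
    finally show ?thesis by simp
  qed
  then have "1 / 4 * exp (pi * \<bar>y\<bar>) \<le> sinh (pi * \<bar>y\<bar>)" by (simp add: sinh_def)
  also have "\<dots> \<le> \<bar>sinh (pi * y)\<bar>" by (cases "y \<ge> 0") (auto simp: abs_if)
  finally have "1 / 4 * exp (pi * \<bar>y\<bar>) \<le> norm (sin (of_real pi * Complex x y))"
    using sinh_le_norm_sin[of y x] by simp
  from norm_mellin_integrand_le[OF assms(1-3) _ this, of w] show ?thesis by simp
qed

lemma sin_pi_times_eq_0_imp_int:
  assumes "sin (of_real pi * z :: complex) = 0"
  shows "\<exists>n::int. z = of_int n"
proof -
  obtain n :: int where "of_real pi * z = of_real (real_of_int n * pi)" using assms sin_eq_0 by blast
  then show ?thesis by (intro exI[of _ n]) (simp add: mult.commute)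
qed

lemma holomorphic_mellin_integrand:
  assumes "\<And>z. z \<in> S \<Longrightarrow> sin (of_real pi * z) \<noteq> 0"
  shows "mellin_integrand \<alpha> w holomorphic_on S"
  unfolding mellin_integrand_def[abs_def] mellin_kernel_def
  using assms by (intro holomorphic_intros) auto

lemma sin_pi_Complex_nonzero:
  assumes "sin (pi * x) \<noteq> 0"
  shows "sin (of_real pi * Complex x y) \<noteq> 0"
proof
  assume "sin (of_real pi * Complex x y) = 0"
  then have "\<bar>sin (pi * x)\<bar> * cosh (pi * y) \<le> 0" using cosh_times_sin_le_norm_sin[of x y] by simp
  moreover have "\<bar>sin (pi * x)\<bar> * cosh (pi * y) > 0" using assms by (intro mult_pos_pos) auto
  ultimately show False by linarith
qed

lemma continuous_mellin_integrand_vertical: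
  assumes "sin (pi * x) \<noteq> 0"
  shows "continuous_on UNIV (\<lambda>y. mellin_integrand \<alpha> w (Complex x y))"
proof -
  have "continuous_on {z. Re z = x} (mellin_integrand \<alpha> w)"
  proof (intro holomorphic_on_imp_continuous_on holomorphic_mellin_integrand)
    fix z assume "z \<in> {z. Re z = x}"
    then show "sin (of_real pi * z) \<noteq> 0" using sin_pi_Complex_nonzero[OF assms, of "Im z"] by auto
  qed
  moreover have "continuous_on UNIV (\<lambda>y. Complex x y)" unfolding Complex_eq by (intro continuous_intros)
  ultimately show ?thesis by (rule continuous_on_compose2) auto
qed

lemma integrable_mellin_integrand:
  assumes "0 < \<alpha>" "\<alpha> < 2" "\<bar>Im w\<bar> < pi - pi * \<alpha> / 2" "x \<le> 1" "sin (pi * x) \<noteq> 0"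
  shows "integrable lborel (\<lambda>y. mellin_integrand \<alpha> w (Complex x y))"
proof (rule Bochner_Integration.integrable_bound)
  show "integrable lborel (\<lambda>y. 8 * pi / \<bar>sin (pi * x)\<bar> * (1 + \<bar>x\<bar>)\<^sup>2 * rGamma (3 - \<alpha> * x) * exp (- x * Re w)
       * ((1 + \<bar>y\<bar>)\<^sup>2 * exp (- (pi - pi * \<alpha> / 2 - \<bar>Im w\<bar>) * \<bar>y\<bar>)))"
    using assms by (intro integrable_mult_right integrable_power_mult_exp_minus_abs) auto
  show "(\<lambda>y. mellin_integrand \<alpha> w (Complex x y)) \<in> borel_measurable lborel"
    using borel_measurable_continuous_onI[OF continuous_mellin_integrand_vertical[OF assms(5)]] by simp
  show "AE y in lborel. norm (mellin_integrand \<alpha> w (Complex x y)) \<le>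
     norm (8 * pi / \<bar>sin (pi * x)\<bar> * (1 + \<bar>x\<bar>)\<^sup>2 * rGamma (3 - \<alpha> * x) * exp (- x * Re w)
       * ((1 + \<bar>y\<bar>)\<^sup>2 * exp (- (pi - pi * \<alpha> / 2 - \<bar>Im w\<bar>) * \<bar>y\<bar>)))"
    using norm_mellin_integrand_vertical[OF assms(1,2,4,5), of w] 
    by (intro always_eventually allI order_trans[OF _ abs_ge_self[THEN order_trans, OF eq_refl[OF real_norm_def[symmetric]]]]) blast
qed

lemma tendsto_integral_symmetric_intervals:
  fixes f :: "real \<Rightarrow> complex"
  assumes "integrable lborel f"
  shows "(\<lambda>n. integral {- real n..real n} f) \<longlonglongrightarrow> (LINT y|lborel. f y)"
proof -
  have "(\<lambda>n. LINT y|lborel. indicator {- real n..real n} y *\<^sub>R f y) \<longlonglongrightarrow> (LINT y|lborel. f y)"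
  proof (rule integral_dominated_convergence[where w = "\<lambda>y. norm (f y)"])
    show "AE y in lborel. (\<lambda>n. indicator {- real n..real n} y *\<^sub>R f y) \<longlonglongrightarrow> f y"
    proof (rule AE_I2, rule tendsto_eventually)
      fix y :: real
      obtain N where "real N \<ge> \<bar>y\<bar>" using real_arch_simple by blast
      then have "y \<in> {- real n..real n}" if "n \<ge> N" for n using that by (auto simp: abs_le_iff)
      then show "\<forall>\<^sub>F n in sequentially. indicator {- real n..real n} y *\<^sub>R f y = f y"
        unfolding eventually_sequentially by (intro exI[of _ N]) auto
    qed
    show "AE y in lborel. norm (indicator {- real n..real n} y *\<^sub>R f y) \<le> norm (f y)" for n
      by (rule AE_I2) (auto simp: indicator_def)
    have [measurable]: "f \<in> borel_measurable lborel" using assms by (rule borel_measurable_integrable)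
    show "f \<in> borel_measurable lborel" by simp
    show "(\<lambda>y. indicator {- real n..real n} y *\<^sub>R f y) \<in> borel_measurable lborel" for n by measurable
    show "integrable lborel (\<lambda>y. norm (f y))" using assms by (rule integrable_norm)
  qed
  moreover have "(LINT y|lborel. indicator {- real n..real n} y *\<^sub>R f y) = integral {- real n..real n} f" for n
  proof -
    have "set_integrable lborel {- real n..real n} f"
      unfolding set_integrable_def using assms by (intro integrable_mult_indicator) auto
    from set_borel_integral_eq_integral(2)[OF this] show ?thesis by (simp add: set_lebesgue_integral_def)
  qed
  ultimately show ?thesis by simp
qed

text \<open>All sides are oriented by increasing coordinate. This flips the sign of the top and left
  sides and makes opposite sides directly comparable.\<close>

lemma contour_integral_rectpath:
  assumes "continuous_on (path_image (rectpath a1 a3)) f"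
  shows "contour_integral (rectpath a1 a3) f =
     contour_integral (linepath a1 (Complex (Re a3) (Im a1))) f
   + contour_integral (linepath (Complex (Re a3) (Im a1)) a3) f
   - contour_integral (linepath (Complex (Re a1) (Im a3)) a3) f
   - contour_integral (linepath a1 (Complex (Re a1) (Im a3))) f"
proof -
  let ?a2 = "Complex (Re a3) (Im a1)" and ?a4 = "Complex (Re a1) (Im a3)"
  have "path_image (rectpath a1 a3) = closed_segment a1 ?a2 \<union> closed_segment ?a2 a3 \<union> closed_segment a3 ?a4 \<union> closed_segment ?a4 a1"
    by (simp add: rectpath_def Let_def path_image_join Un_assoc)
  then have c: "continuous_on (closed_segment a1 ?a2) f" "continuous_on (closed_segment ?a2 a3) f"
     "continuous_on (closed_segment a3 ?a4) f" "continuous_on (closed_segment ?a4 a1) f"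
    using assms by (auto intro: continuous_on_subset)
  then have "contour_integral (rectpath a1 a3) f =
      contour_integral (linepath a1 ?a2) f + (contour_integral (linepath ?a2 a3) f
    + (contour_integral (linepath a3 ?a4) f + contour_integral (linepath ?a4 a1) f))"
    unfolding rectpath_def Let_def
    by (subst contour_integral_join contour_integrable_join; (intro contour_integrable_continuous_linepath valid_path_join)?; simp add: contour_integrable_continuous_linepath contour_integrable_join)+
  then show ?thesis using contour_integral_reverse_linepath[OF c(3)] contour_integral_reverse_linepath[OF c(4)] by simp
qed

text \<open>The only pole between the two lines is z = - N, and its residue is the N-th term of the
  series of E_\<alpha>(- exp w). The residue theorem is applied to rectangles of growing height; the
  horizontal sides vanish in the limit, and dz = i dy on the vertical sides turns 2 pi i into 2
  pi.\<close>

lemma mellin_integrand_shift: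
  fixes N :: nat
  assumes "0 < \<alpha>" "\<alpha> < 2" "\<bar>Im w\<bar> < pi - pi * \<alpha> / 2"
    and a: "- real N - 1 < a" "a < - real N" and b: "- real N < b" "b < 1 - real N"
  shows "(LINT y|lborel. mellin_integrand \<alpha> w (Complex b y))
      = (LINT y|lborel. mellin_integrand \<alpha> w (Complex a y))
        + 2 * of_real pi * ((- exp w) ^ N * rGamma (of_real (\<alpha> * real N + 1)))"
proof -
  let ?f = "mellin_integrand \<alpha> w"
  define p :: complex where "p = - of_nat N"
  \<comment> \<open>An open strip that contains all the rectangles and no integer other than -
    N.\<close>
  define S where "S = {z. - real N - 1 < Re z} \<inter> {z. Re z < 1 - real N}"
  define R where "R = (- exp w) ^ N * rGamma (of_real (\<alpha> * real N + 1))"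
  have S: "open S" "convex S" "p \<in> S"
    unfolding S_def p_def by (auto intro!: open_Int convex_Int open_halfspace_Re_gt open_halfspace_Re_lt convex_halfspace_Re_gt convex_halfspace_Re_lt)
  have nz: "sin (of_real pi * z) \<noteq> 0" if "z \<in> S" "z \<noteq> p" for z
  proof
    assume "sin (of_real pi * z) = 0"
    then obtain n :: int where n: "z = of_int n" using sin_pi_times_eq_0_imp_int by blast
    then have "real_of_int n < real_of_int (1 - int N)" "real_of_int (- int N - 1) < real_of_int n" using that(1) unfolding S_def by auto
    then have "n = - int N" by (simp only: of_int_less_iff)
    then show False using n that(2) unfolding p_def by simp
  qed
  have holo: "?f holomorphic_on S - {p}"
    by (rule holomorphic_mellin_integrand) (use nz in auto)
  have snab: "sin (pi * a) \<noteq> 0" "sin (pi * b) \<noteq> 0"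
  proof -
    have "sin (pi * x) \<noteq> 0" if "x \<in> {a, b}" for x
    proof -
      have "sin (of_real pi * complex_of_real x) \<noteq> 0"
        by (rule nz) (use that a b in \<open>auto simp: S_def p_def complex_eq_iff\<close>)
      moreover have "sin (of_real pi * complex_of_real x) = of_real (sin (pi * x))"
        by (metis of_real_mult sin_of_real)
      ultimately show ?thesis by auto
    qed
    then show "sin (pi * a) \<noteq> 0" "sin (pi * b) \<noteq> 0" by auto
  qed
  have ab1: "a \<le> 1" "b \<le> 1" using a b by auto
  \<comment> \<open>Near \<open>p\<close> the integrand is a holomorphic numerator over a simple
    zero of the sine, so the residue is numerator over derivative. The value cos(pi p) = (-1)^N
    supplies the sign in (- exp w)^N.\<close>
  have res: "residue ?f p = R"
  proof -
    let ?n = "\<lambda>z. of_real pi * rGamma (1 - of_real \<alpha> * z) * exp (- z * w)"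
    have feq: "?f = (\<lambda>z. ?n z / sin (of_real pi * z))"
      by (auto simp: mellin_integrand_def mellin_kernel_def)
    have sp: "sin (of_real pi * p) = 0"
    proof -
      have "sin (of_real pi * p) = of_real (sin (- (real N * pi)))" unfolding p_def by (simp add: mult.commute flip: sin_of_real)
      then show ?thesis by simp
    qed
    have cp: "cos (of_real pi * p) = (-1) ^ N"
    proof -
      have "cos (of_real pi * p) = of_real (cos (- (real N * pi)))" unfolding p_def by (simp add: mult.commute flip: cos_of_real)
      then show ?thesis by (simp add: cos_npi)
    qed
    have a1: "1 - of_real \<alpha> * p = of_real (\<alpha> * real N + 1)" unfolding p_def by simp
    have "\<alpha> * real N + 1 > 0" using assms(1) by (simp add: add_nonneg_pos)
    then have g0: "rGamma (of_real (\<alpha> * real N + 1) :: complex) \<noteq> 0"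
      unfolding rGamma_eq_zero_iff by (auto elim!: nonpos_Ints_cases' simp: complex_eq_iff)
    have "residue (\<lambda>z. ?n z / sin (of_real pi * z)) p = ?n p / (of_real pi * cos (of_real pi * p))"
    proof (rule residue_simple_pole_deriv[of _ S])
      show "((\<lambda>z. sin (complex_of_real pi * z)) has_field_derivative complex_of_real pi * cos (complex_of_real pi * p)) (at p)"
        by (auto intro!: derivative_eq_intros)
      show "?n p \<noteq> 0" unfolding a1 using g0 by simp
    qed (use S sp cp in \<open>auto intro!: holomorphic_intros convex_connected\<close>)
    also have "\<dots> = (-1) ^ N * rGamma (of_real (\<alpha> * real N + 1)) * exp (of_nat N * w)"
      unfolding a1 cp by (simp add: p_def minus_one_power_iff)
    also have "\<dots> = R"
      unfolding R_def by (simp add: exp_of_nat_mult power_minus[of "exp w"])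
    finally show ?thesis unfolding feq .
  qed
  let ?I = "\<lambda>x n. integral {- real n..real n} (\<lambda>y. ?f (Complex x y))"
  define H where "H = (\<lambda>y. contour_integral (linepath (Complex a y) (Complex b y)) ?f)"
  \<comment> \<open>Bottom minus top plus right minus left side of the rectangle with vertical
    extent from - n to n.\<close>
  have eq: "H (- real n) - H (real n) + \<i> * ?I b n - \<i> * ?I a n = 2 * pi * \<i> * R" if "n > 0" for n :: nat
  proof -
    let ?g = "rectpath (Complex a (- real n)) (Complex b (real n))"
    have pb: "p \<in> box (Complex a (- real n)) (Complex b (real n))" using that a b unfolding p_def by (auto simp: in_box_complex_iff)
    have cb: "cbox (Complex a (- real n)) (Complex b (real n)) \<subseteq> S"
      using a b unfolding S_def by (auto simp: in_cbox_complex_iff)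
    have pi: "path_image ?g \<subseteq> S - {p}"
      using path_image_rectpath_cbox_minus_box[of "Complex a (- real n)" "Complex b (real n)"] pb cb a b by auto
    have "contour_integral ?g ?f = 2 * pi * \<i> * (\<Sum>q\<in>{p}. winding_number ?g q * residue ?f q)"
    proof (rule Residue_theorem[OF S(1) _ _ holo])
      show "\<forall>z. z \<notin> S \<longrightarrow> winding_number ?g z = 0"
        using cb a b by (intro allI impI winding_number_rectpath_outside) auto
    qed (use S pi in \<open>auto intro!: convex_connected\<close>)
    also have "\<dots> = 2 * pi * \<i> * R" using winding_number_rectpath[OF pb] res by simp
    finally have 1: "contour_integral ?g ?f = 2 * pi * \<i> * R" .
    have cont: "continuous_on (path_image ?g) ?f"
      using holomorphic_on_imp_continuous_on[OF holo] pi continuous_on_subset by blast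
    have 2: "contour_integral (linepath (Complex x (- real n)) (Complex x (real n))) ?f = \<i> * ?I x n" for x
      by (rule contour_integral_linepath_same_Re) (use that in auto)
    show ?thesis using contour_integral_rectpath[OF cont] 1 2 unfolding H_def by (simp add: algebra_simps)
  qed
  \<comment> \<open>The sign \<open>s\<close> is 1 for the top side and -1 for the bottom
    side.\<close>
  have H0: "((\<lambda>n. H (s * real n)) \<longlongrightarrow> 0) sequentially" if s: "\<bar>s\<bar> = 1" for s :: real
  proof -
    define \<epsilon> where "\<epsilon> = pi - pi * \<alpha> / 2 - \<bar>Im w\<bar>"
    have \<epsilon>: "\<epsilon> > 0" using assms unfolding \<epsilon>_def by simp
    let ?h = "\<lambda>x. 16 * pi * (1 + \<bar>x\<bar>)\<^sup>2 * rGamma (3 - \<alpha> * x) * exp (- x * Re w)"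
    have "compact (?h ` {a..b})"
      by (intro compact_continuous_image continuous_intros continuous_on_compose2[OF continuous_on_rGamma[of UNIV]]) auto
    then obtain M where M: "M > 0" "\<And>x. x \<in> {a..b} \<Longrightarrow> norm (?h x) \<le> M"
      using compact_imp_bounded[of "?h ` {a..b}"] unfolding bounded_pos by auto
    show ?thesis
    proof (rule Lim_null_comparison)
      show "(\<lambda>n. M * ((1 + real n)\<^sup>2 * exp (- \<epsilon> * real n)) * (b - a)) \<longlonglongrightarrow> 0"
        using \<epsilon> by real_asymp
      show "\<forall>\<^sub>F n in sequentially. norm (H (s * real n)) \<le> M * ((1 + real n)\<^sup>2 * exp (- \<epsilon> * real n)) * (b - a)"
        using eventually_gt_at_top[of 0]
      proof eventually_elim
        case (elim n)
        have sn: "\<bar>s * real n\<bar> = real n" using s by (simp add: abs_mult)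
        have seg: "z = Complex (Re z) (s * real n) \<and> Re z \<in> {a..b}" if "z \<in> closed_segment (Complex a (s * real n)) (Complex b (s * real n))" for z
          using that a b by (auto simp: closed_segment_same_Im closed_segment_eq_real_ivl complex_eq_iff)
        \<comment> \<open>The pole is real, so a horizontal side at height n > 0 misses it.\<close>
        have "closed_segment (Complex a (s * real n)) (Complex b (s * real n)) \<subseteq> S - {p}"
        proof
          fix z assume "z \<in> closed_segment (Complex a (s * real n)) (Complex b (s * real n))"
          from seg[OF this] have z: "z = Complex (Re z) (s * real n)" "a \<le> Re z" "Re z \<le> b" by auto
          have "Im z = s * real n" by (subst z(1)) simp
          then have "Im z \<noteq> 0" using sn elim by auto
          then show "z \<in> S - {p}" using z(2,3) a b unfolding S_def p_def by auto
        qed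
        then have ci: "?f contour_integrable_on linepath (Complex a (s * real n)) (Complex b (s * real n))"
          using holomorphic_on_imp_continuous_on[OF holo] continuous_on_subset
          by (intro contour_integrable_continuous_linepath) blast
        have "norm (H (s * real n)) \<le> M * ((1 + real n)\<^sup>2 * exp (- \<epsilon> * real n)) * norm (Complex b (s * real n) - Complex a (s * real n))"
          unfolding H_def
        proof (rule contour_integral_bound_linepath[OF ci])
          fix z assume "z \<in> closed_segment (Complex a (s * real n)) (Complex b (s * real n))"
          from seg[OF this] have z: "z = Complex (Re z) (s * real n)" "Re z \<in> {a..b}" by auto
          have "norm (?f (Complex (Re z) (s * real n))) \<le> ?h (Re z) * ((1 + real n)\<^sup>2 * exp (- \<epsilon> * real n))"
            using norm_mellin_integrand_horizontal[OF assms(1,2), of "Re z" "s * real n" w] z(2) b sn elim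
            unfolding \<epsilon>_def by simp
          also have "\<dots> \<le> M * ((1 + real n)\<^sup>2 * exp (- \<epsilon> * real n))"
            using M(2)[OF z(2)] by (intro mult_right_mono) auto
          finally show "norm (?f z) \<le> M * ((1 + real n)\<^sup>2 * exp (- \<epsilon> * real n))" using z(1) by simp
        qed (use M in auto)
        also have "norm (Complex b (s * real n) - Complex a (s * real n)) = b - a"
          using a b by (simp add: complex_diff cmod_def)
        finally show ?case .
      qed
    qed
  qed
  have int: "integrable lborel (\<lambda>y. ?f (Complex x y))" if "x \<in> {a, b}" for x
    using that snab ab1 by (intro integrable_mellin_integrand assms) auto
  have "(\<lambda>n. H (- real n) - H (real n) + \<i> * ?I b n - \<i> * ?I a n) \<longlonglongrightarrow>
     0 - 0 + \<i> * (LINT y|lborel. ?f (Complex b y)) - \<i> * (LINT y|lborel. ?f (Complex a y))"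
    using H0[of "-1"] H0[of 1] by (intro tendsto_intros tendsto_integral_symmetric_intervals int) auto
  moreover have "(\<lambda>n. H (- real n) - H (real n) + \<i> * ?I b n - \<i> * ?I a n) \<longlonglongrightarrow> 2 * pi * \<i> * R"
    using eq by (intro tendsto_eventually eventually_mono[OF eventually_gt_at_top[of 0]]) auto
  ultimately have "\<i> * (LINT y|lborel. ?f (Complex b y)) - \<i> * (LINT y|lborel. ?f (Complex a y)) = 2 * pi * \<i> * R"
    using LIMSEQ_unique by fastforce
  then have "\<i> * ((LINT y|lborel. ?f (Complex b y)) - (LINT y|lborel. ?f (Complex a y)) - 2 * pi * R) = 0"
    by (simp add: algebra_simps)
  then have zero: "(LINT y|lborel. ?f (Complex b y)) - (LINT y|lborel. ?f (Complex a y)) - 2 * pi * R = 0"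
    by (simp only: mult_eq_0_iff complex_i_not_zero simp_thms)
  have move: "u = v + r" if "u - v - r = 0" for u v r :: complex using that by algebra
  have "(LINT y|lborel. ?f (Complex b y)) = (LINT y|lborel. ?f (Complex a y)) + 2 * pi * R"
    by (rule move[OF zero])
  then show ?thesis unfolding R_def by (simp only: of_real_mult of_real_numeral)
qed

text \<open>Each move to the left past an integer releases one term of the series, and the integral
  that remains tends to 0. Convergence of the series thus comes out together with its sum.\<close>

theorem mittag_leffler_eq_mellin:
  assumes "0 < \<alpha>" "\<alpha> < 2" "\<bar>Im w\<bar> < pi - pi * \<alpha> / 2" "0 < \<sigma>" "\<sigma> < 1"
  shows "mittag_leffler \<alpha> (- exp w) = 1 / (2 * pi) * (LINT y|lborel. mellin_integrand \<alpha> w (Complex \<sigma> y))"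
proof -
  define I where "I = (\<lambda>x. LINT y|lborel. mellin_integrand \<alpha> w (Complex x y))"
  define R where "R = (\<lambda>k. (- exp w) ^ k * rGamma (of_real (\<alpha> * real k + 1)))"
  define \<epsilon> where "\<epsilon> = pi - pi * \<alpha> / 2 - \<bar>Im w\<bar>"
  have \<epsilon>: "\<epsilon> > 0" using assms unfolding \<epsilon>_def by simp
  have step: "I b = I a + 2 * of_real pi * R N"
    if "- real N - 1 < a" "a < - real N" "- real N < b" "b < 1 - real N" for a b N
    using mellin_integrand_shift[OF assms(1-3) that] unfolding I_def R_def .
  have partial: "I \<sigma> = I (1 / 2 - real (Suc n)) + 2 * of_real pi * (\<Sum>k<Suc n. R k)" for n
  proof (induction n)
    case 0
    then show ?case using step[of 0 "-1/2" \<sigma>] assms by simp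
  next
    case (Suc n)
    have "I (1 / 2 - real (Suc n)) = I (1 / 2 - real (Suc (Suc n))) + 2 * of_real pi * R (Suc n)"
      by (rule step) auto
    then show ?case using Suc by (simp add: algebra_simps)
  qed
  define J where "J = (LINT y|lborel. (1 + \<bar>y\<bar>)\<^sup>2 * exp (- \<epsilon> * \<bar>y\<bar>))"
  \<comment> \<open>Chosen so that K^(\<alpha> (n - 1/2)) = exp((Re w + 1) (n - 1/2)): the bound on
    1 / Gamma then beats the growth exp((n - 1/2) Re w) of the power with exp(- (n - 1/2)) to
    spare.\<close>
  define K where "K = exp ((Re w + 1) / \<alpha>)"
  have bound: "norm (I (1 / 2 - real n)) \<le>
      8 * pi * (1 + real n)\<^sup>2 * (exp K * exp (- 2 * ((Re w + 1) / \<alpha>)) * exp (- (Re w + 1) * (real n - 1 / 2))) * exp ((real n - 1 / 2) * Re w) * J"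
    if "n \<ge> 1" for n
  proof -
    let ?x = "1 / 2 - real n"
    \<comment> \<open>Half-integers are the abscissae where the constant in the vertical bound does
      not depend on n.\<close>
    have sn: "\<bar>sin (pi * ?x)\<bar> = 1"
    proof -
      have "sin (pi * ?x) = cos (real n * pi)"
        by (simp add: right_diff_distrib sin_diff mult.commute)
      then show ?thesis by (simp add: cos_npi)
    qed
    then have snz: "sin (pi * ?x) \<noteq> 0" by auto
    define y where "y = 3 - \<alpha> * ?x"
    have "0 \<le> \<alpha> * (real n - 1 / 2)" using that assms by (intro mult_nonneg_nonneg) auto
    then have y: "y \<ge> 1" unfolding y_def by (simp add: algebra_simps)
    have "K powr (y - 1) * exp (- K) \<le> Gamma y"
      by (rule powr_mult_exp_le_Gamma) (use y in \<open>auto simp: K_def\<close>)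
    then have "rGamma y \<le> inverse (K powr (y - 1) * exp (- K))"
      unfolding rGamma_inverse_Gamma by (intro le_imp_inverse_le) (auto simp: K_def)
    also have "\<dots> = exp K * exp (- ((Re w + 1) / \<alpha> * (y - 1)))"
      by (simp add: K_def powr_def exp_minus mult_ac)
    also have "(Re w + 1) / \<alpha> * (y - 1) = 2 * ((Re w + 1) / \<alpha>) + (Re w + 1) * (real n - 1 / 2)"
      unfolding y_def using assms(1) by (simp add: field_simps)
    finally have rG: "rGamma y \<le> exp K * exp (- 2 * ((Re w + 1) / \<alpha>)) * exp (- (Re w + 1) * (real n - 1 / 2))"
      by (simp only: minus_add_distrib[of "2 * ((Re w + 1) / \<alpha>)"] exp_add mult_minus_left mult.assoc)
    have rG0: "0 \<le> rGamma y" unfolding rGamma_inverse_Gamma using y by simp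
    have J0: "J \<ge> 0" unfolding J_def by (intro integral_nonneg_AE) auto
    have "norm (I ?x) \<le> (LINT y|lborel. 8 * pi * (1 + \<bar>?x\<bar>)\<^sup>2 * rGamma (3 - \<alpha> * ?x) * exp (- ?x * Re w)
       * ((1 + \<bar>y\<bar>)\<^sup>2 * exp (- \<epsilon> * \<bar>y\<bar>)))"
      unfolding I_def
    proof (rule Bochner_Integration.integral_norm_bound_integral)
      show "integrable lborel (\<lambda>y. mellin_integrand \<alpha> w (Complex ?x y))"
        using assms snz by (intro integrable_mellin_integrand) auto
      show "integrable lborel (\<lambda>y. 8 * pi * (1 + \<bar>?x\<bar>)\<^sup>2 * rGamma (3 - \<alpha> * ?x) * exp (- ?x * Re w)
         * ((1 + \<bar>y\<bar>)\<^sup>2 * exp (- \<epsilon> * \<bar>y\<bar>)))"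
        using \<epsilon> by (intro integrable_mult_right integrable_power_mult_exp_minus_abs) auto
      fix y :: real
      show "norm (mellin_integrand \<alpha> w (Complex ?x y)) \<le> 8 * pi * (1 + \<bar>?x\<bar>)\<^sup>2 * rGamma (3 - \<alpha> * ?x) * exp (- ?x * Re w)
         * ((1 + \<bar>y\<bar>)\<^sup>2 * exp (- \<epsilon> * \<bar>y\<bar>))"
        using norm_mellin_integrand_vertical[OF assms(1,2) _ snz, of w y] unfolding sn \<epsilon>_def by simp
    qed
    also have "\<dots> = 8 * pi * (1 + \<bar>?x\<bar>)\<^sup>2 * rGamma y * exp ((real n - 1 / 2) * Re w) * J"
    proof -
      have "- ?x * Re w = (real n - 1 / 2) * Re w" by simp
      then show ?thesis unfolding J_def y_def integral_mult_right_zero by (simp only:)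
    qed
    also have "\<dots> \<le> 8 * pi * (1 + real n)\<^sup>2 * (exp K * exp (- 2 * ((Re w + 1) / \<alpha>)) * exp (- (Re w + 1) * (real n - 1 / 2))) * exp ((real n - 1 / 2) * Re w) * J"
    proof -
      have "(1 + \<bar>?x\<bar>)\<^sup>2 \<le> (1 + real n)\<^sup>2" using that by (intro power_mono) auto
      then have h: "8 * pi * (1 + \<bar>?x\<bar>)\<^sup>2 \<le> 8 * pi * (1 + real n)\<^sup>2" by (intro mult_left_mono) auto
      show ?thesis
        by (rule mult_right_mono[OF mult_right_mono[OF mult_mono[OF h rG _ rG0]] J0]) auto
    qed
    finally show ?thesis .
  qed
  define C where "C = 8 * pi * exp K * exp (- 2 * ((Re w + 1) / \<alpha>)) * J"
  have "\<forall>\<^sub>F n in sequentially. norm (I (1 / 2 - real n)) \<le> C * ((1 + real n)\<^sup>2 * exp (- (real n - 1 / 2)))"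
    using eventually_ge_at_top[of 1]
  proof eventually_elim
    case (elim n)
    have "- (Re w + 1) * (real n - 1 / 2) + (real n - 1 / 2) * Re w = - (real n - 1 / 2)" by algebra
    then have e: "exp (- (Re w + 1) * (real n - 1 / 2)) * exp ((real n - 1 / 2) * Re w) = exp (- (real n - 1 / 2))"
      by (simp only: exp_add[symmetric])
    have r: "p * q * (r * u * v) * z * j = p * r * u * j * (q * (v * z))" for p q r u v z j :: real by (simp add: mult_ac)
    from bound[OF elim] show ?case unfolding r e C_def .
  qed
  moreover have "(\<lambda>n. (1 + real n)\<^sup>2 * exp (- (real n - 1 / 2))) \<longlonglongrightarrow> 0" by real_asymp
  then have "(\<lambda>n. C * ((1 + real n)\<^sup>2 * exp (- (real n - 1 / 2)))) \<longlonglongrightarrow> 0"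
    by (rule tendsto_mult_right_zero)
  ultimately have "(\<lambda>n. I (1 / 2 - real n)) \<longlonglongrightarrow> 0" by (rule Lim_null_comparison)
  then have "(\<lambda>n. I (1 / 2 - real (Suc n))) \<longlonglongrightarrow> 0" by (rule LIMSEQ_Suc)
  then have "(\<lambda>n. (I \<sigma> - I (1 / 2 - real (Suc n))) / (2 * of_real pi)) \<longlonglongrightarrow> (I \<sigma> - 0) / (2 * of_real pi)"
    by (intro tendsto_intros) auto
  also have "(\<lambda>n. (I \<sigma> - I (1 / 2 - real (Suc n))) / (2 * of_real pi)) = (\<lambda>n. \<Sum>k<Suc n. R k)"
    using partial by (intro ext) (simp add: field_simps)
  finally have "(\<lambda>n. \<Sum>k<n. R k) \<longlonglongrightarrow> (I \<sigma> - 0) / (2 * of_real pi)"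
    by (rule LIMSEQ_imp_Suc)
  then have "R sums (I \<sigma> / (2 * of_real pi))" unfolding sums_def by simp
  moreover have "R = (\<lambda>k. (- exp w) ^ k / complex_of_real (Gamma (\<alpha> * real k + 1)))"
    unfolding R_def rGamma_inverse_Gamma Gamma_complex_of_real by (simp add: divide_inverse)
  ultimately show ?thesis unfolding mittag_leffler_def I_def by (simp add: sums_iff)
qed

section \<open>Radial integrability, Gaussians and Riesz potentials\<close>

lemma cis_measurable[measurable]: "cis \<in> borel_measurable borel"
  by (intro borel_measurable_continuous_onI continuous_intros)

lemma lborel_Fubini:
  fixes f :: "'a::euclidean_space \<Rightarrow> 'b::euclidean_space \<Rightarrow> 'c::{banach, second_countable_topology}"
  assumes meas: "case_prod f \<in> borel_measurable (lborel \<Otimes>\<^sub>M lborel)"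
    and int: "integrable lborel (\<lambda>x. LINT y|lborel. norm (f x y))"
    and AE: "AE x in lborel. integrable lborel (f x)"
  shows "integrable (lborel \<Otimes>\<^sub>M lborel) (case_prod f)"
    and "(LINT y|lborel. LINT x|lborel. f x y) = (LINT x|lborel. LINT y|lborel. f x y)"
    and "AE y in lborel. integrable lborel (\<lambda>x. f x y)"
    and "integrable lborel (\<lambda>x. LINT y|lborel. f x y)"
    and "integrable lborel (\<lambda>y. LINT x|lborel. f x y)"
proof -
  show 1: "integrable (lborel \<Otimes>\<^sub>M lborel) (case_prod f)"
    by (rule lborel_pair.Fubini_integrable) (use assms in auto)
  show "(LINT y|lborel. LINT x|lborel. f x y) = (LINT x|lborel. LINT y|lborel. f x y)"
    by (rule lborel_pair.Fubini_integral[OF 1])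
  show "AE y in lborel. integrable lborel (\<lambda>x. f x y)"
    by (rule lborel_pair.AE_integrable_snd[OF 1])
  show "integrable lborel (\<lambda>x. LINT y|lborel. f x y)"
    by (rule lborel_pair.integrable_fst[OF 1])
  show "integrable lborel (\<lambda>y. LINT x|lborel. f x y)"
    by (rule lborel_pair.integrable_snd[OF 1])
qed

text \<open>The sum of \<open>c n\<close> over the balls of radius \<open>r n\<close> dominates the
  norm of f, so radial integrability becomes a numerical series of ball volumes. The origin is a
  null set, which is why the cover condition skips it.\<close>

lemma integrable_of_ball_cover:
  fixes f :: "'a::euclidean_space \<Rightarrow> 'b::{banach, second_countable_topology}" and c r :: "nat \<Rightarrow> real"
  assumes meas: "f \<in> borel_measurable lborel"
    and nonneg: "\<And>n. 0 \<le> c n" "\<And>n. 0 \<le> r n"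
    and summ: "summable (\<lambda>n. c n * r n ^ DIM('a))"
    and cover: "\<And>x. x \<noteq> 0 \<Longrightarrow> f x \<noteq> 0 \<Longrightarrow> \<exists>n. norm x < r n \<and> norm (f x) \<le> c n"
  shows "integrable lborel f"
proof (rule integrableI_bounded[OF meas])
  have "(\<integral>\<^sup>+x. ennreal (norm (f x)) \<partial>lborel) \<le> (\<integral>\<^sup>+x. (\<Sum>n. ennreal (c n) * indicator (ball (0::'a) (r n)) x) \<partial>lborel)"
  proof (rule nn_integral_mono_AE)
    show "AE x in lborel. ennreal (norm (f x)) \<le> (\<Sum>n. ennreal (c n) * indicator (ball 0 (r n)) x)"
      using AE_lborel_singleton[of 0]
    proof eventually_elim
      case (elim x)
      show ?case
      proof (cases "f x = 0")
        case False
        then obtain n where n: "norm x < r n" "norm (f x) \<le> c n" using cover elim by blast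
        then have "ennreal (norm (f x)) \<le> ennreal (c n) * indicator (ball 0 (r n)) x" by (simp add: ennreal_leI)
        also have "\<dots> = (\<Sum>k\<in>{n}. ennreal (c k) * indicator (ball 0 (r k)) x)"
          by (simp only: sum.insert finite.emptyI empty_iff not_False_eq_True sum.empty add_0_right)
        also have "\<dots> \<le> (\<Sum>n. ennreal (c n) * indicator (ball 0 (r n)) x)" by (rule sum_le_suminf) auto
        finally show ?thesis .
      qed auto
    qed
  qed
  also have "\<dots> = (\<Sum>n. \<integral>\<^sup>+x. ennreal (c n) * indicator (ball (0::'a) (r n)) x \<partial>lborel)"
    by (rule nn_integral_suminf) (intro borel_measurable_times_ennreal borel_measurable_indicator borel_measurable_const, auto)
  also have "\<dots> = (\<Sum>n. ennreal (unit_ball_vol (real DIM('a)) * (c n * r n ^ DIM('a))))"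
    using nonneg by (intro suminf_cong) (auto simp: nn_integral_cmult_indicator emeasure_ball ennreal_mult[symmetric] mult_ac)
  also have "\<dots> < \<infinity>"
  proof -
    have "(\<Sum>n. ennreal (unit_ball_vol (real DIM('a)) * (c n * r n ^ DIM('a)))) \<noteq> top"
      using nonneg by (intro ennreal_suminf_neq_top summable_mult summ) auto
    then show ?thesis by (simp add: less_top)
  qed
  finally show "(\<integral>\<^sup>+x. ennreal (norm (f x)) \<partial>lborel) < \<infinity>" .
qed

text \<open>On the dyadic shell of radius 2^k the bounds are about 2^(- a k) and 2^(- b k) against a
  volume of about 2^(d k). The geometric series converges near the origin because a < d, and at
  infinity because d < b.\<close>

lemma integrable_norm_powr_bounds:
  fixes f :: "'a::euclidean_space \<Rightarrow> 'b::{banach, second_countable_topology}"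
  assumes meas: "f \<in> borel_measurable lborel"
    and ab: "0 \<le> a" "a < real DIM('a)" "real DIM('a) < b"
    and bound: "\<And>x. x \<noteq> 0 \<Longrightarrow> norm (f x) \<le> C * norm x powr (- a)" "\<And>x. x \<noteq> 0 \<Longrightarrow> norm (f x) \<le> C * norm x powr (- b)"
  shows "integrable lborel f"
proof -
  define d where "d = DIM('a)"
  have C0: "0 \<le> C"
  proof -
    obtain b :: 'a where "b \<in> Basis" using nonempty_Basis by blast
    then have "norm b = 1" "b \<noteq> 0" by auto
    with bound(1)[of b] have "norm (f b) \<le> C" by simp
    then show ?thesis using norm_ge_zero[of "f b"] by linarith
  qed
  have "integrable lborel (\<lambda>x. indicator (ball 0 1) x *\<^sub>R f x)"
  proof (rule integrable_of_ball_cover)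
    show "(\<lambda>x. indicator (ball 0 1) x *\<^sub>R f x) \<in> borel_measurable lborel"
      by (intro borel_measurable_scaleR borel_measurable_indicator meas) auto
    let ?c = "\<lambda>n. C * 2 powr (a * (real n + 1))" and ?r = "\<lambda>n. 2 powr (- real n)"
    have "2 powr (a * (real n + 1)) * (2 powr (- real n)) ^ d = 2 powr a * (2 powr (a - real d)) ^ n" for n
      by (simp add: powr_realpow[symmetric] powr_powr powr_add[symmetric]) (simp add: algebra_simps)
    then have "(\<lambda>n. ?c n * ?r n ^ d) = (\<lambda>n. C * 2 powr a * (2 powr (a - real d)) ^ n)"
      by (intro ext) (simp only: mult.assoc)
    moreover have "summable (\<lambda>n. C * 2 powr a * (2 powr (a - real d)) ^ n)"
    proof (intro summable_mult summable_geometric)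
      have "2 powr (a - real d) < 2 powr (0::real)" using ab unfolding d_def by (subst powr_less_cancel_iff) auto
      then show "norm ((2::real) powr (a - real d)) < 1" by simp
    qed
    ultimately show "summable (\<lambda>n. ?c n * ?r n ^ DIM('a))" unfolding d_def by simp
    fix x :: 'a assume x: "x \<noteq> 0" "indicator (ball 0 1) x *\<^sub>R f x \<noteq> 0"
    then have nx: "0 < norm x" "norm x < 1" by (auto simp: indicator_def split: if_splits)
    \<comment> \<open>Ceiling minus one instead of floor: the shell must be 2^(-(n+1)) \<le> |x| <
      2^(-n), strict above because the balls are open.\<close>
    define n where "n = nat (\<lceil>- log 2 (norm x)\<rceil> - 1)"
    have "0 < - log 2 (norm x)" using nx by simp
    then have n: "real n < - log 2 (norm x)" "- log 2 (norm x) \<le> real n + 1" unfolding n_def by linarith+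
    have "norm x < 2 powr (- real n)" using n(1) nx by (simp add: less_powr_iff) 
    moreover have "norm (f x) \<le> C * 2 powr (a * (real n + 1))"
    proof -
      have "2 powr (- (real n + 1)) \<le> norm x" using n(2) nx by (simp add: powr_le_iff)
      then have "norm x powr (- a) \<le> (2 powr (- (real n + 1))) powr (- a)" using ab by (intro powr_mono2') auto
      also have "\<dots> = 2 powr (a * (real n + 1))"
      proof -
        have "- (real n + 1) * - a = a * (real n + 1)" by algebra
        then show ?thesis by (simp only: powr_powr)
      qed
      finally show ?thesis using bound(1)[OF x(1)] C0 by (meson mult_left_mono order_trans)
    qed
    ultimately show "\<exists>n. norm x < ?r n \<and> norm (indicator (ball 0 1) x *\<^sub>R f x) \<le> ?c n"
      using nx by (intro exI[of _ n]) auto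
  qed (use C0 in auto)
  moreover have "integrable lborel (\<lambda>x. indicator (- ball 0 1) x *\<^sub>R f x)"
  proof (rule integrable_of_ball_cover)
    show "(\<lambda>x. indicator (- ball 0 1) x *\<^sub>R f x) \<in> borel_measurable lborel"
      by (intro borel_measurable_scaleR borel_measurable_indicator meas) auto
    let ?c = "\<lambda>n. C * 2 powr (- b * real n)" and ?r = "\<lambda>n. 2 powr (real n + 1)"
    have "2 powr (- b * real n) * (2 powr (real n + 1)) ^ d = 2 powr d * (2 powr (real d - b)) ^ n" for n
      by (simp add: powr_realpow[symmetric] powr_powr powr_add[symmetric]) (simp add: algebra_simps)
    then have "(\<lambda>n. ?c n * ?r n ^ d) = (\<lambda>n. C * 2 powr d * (2 powr (real d - b)) ^ n)"
      by (intro ext) (simp only: mult.assoc)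
    moreover have "summable (\<lambda>n. C * 2 powr d * (2 powr (real d - b)) ^ n)"
    proof (intro summable_mult summable_geometric)
      have "2 powr (real d - b) < 2 powr (0::real)" using ab unfolding d_def by (subst powr_less_cancel_iff) auto
      then show "norm ((2::real) powr (real d - b)) < 1" by simp
    qed
    ultimately show "summable (\<lambda>n. ?c n * ?r n ^ DIM('a))" unfolding d_def by simp
    fix x :: 'a assume x: "x \<noteq> 0" "indicator (- ball 0 1) x *\<^sub>R f x \<noteq> 0"
    then have nx: "1 \<le> norm x" by (auto simp: indicator_def split: if_splits)
    define n where "n = nat \<lfloor>log 2 (norm x)\<rfloor>"
    from nx have "0 < norm x" by linarith
    with nx have "0 \<le> log 2 (norm x)" by simp
    then have n: "real n \<le> log 2 (norm x)" "log 2 (norm x) < real n + 1" unfolding n_def by linarith+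
    have "norm x < 2 powr (real n + 1)" using n(2) nx by (subst less_powr_iff) auto
    moreover have "norm (f x) \<le> C * 2 powr (- b * real n)"
    proof -
      have "2 powr real n \<le> norm x" using n(1) nx by (subst powr_le_iff) auto
      then have "norm x powr (- b) \<le> (2 powr real n) powr (- b)" using ab by (intro powr_mono2') auto
      also have "\<dots> = 2 powr (- b * real n)" by (simp add: powr_powr mult.commute)
      finally show ?thesis using bound(2)[OF x(1)] C0 by (meson mult_left_mono order_trans)
    qed
    ultimately show "\<exists>n. norm x < ?r n \<and> norm (indicator (- ball 0 1) x *\<^sub>R f x) \<le> ?c n"
      using nx by (intro exI[of _ n]) auto
  qed (use C0 in auto)
  ultimately have "integrable lborel (\<lambda>x. indicator (ball 0 1) x *\<^sub>R f x + indicator (- ball 0 1) x *\<^sub>R f x)"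
    by (rule Bochner_Integration.integrable_add)
  also have "(\<lambda>x. indicator (ball 0 1) x *\<^sub>R f x + indicator (- ball 0 1) x *\<^sub>R f x) = f"
    by (intro ext) (simp add: indicator_def)
  finally show ?thesis .
qed

section \<open>Gamma integrals, Gaussian transforms and the Riesz formula\<close>

lemma integrable_mult_cancel:
  fixes f :: "'a \<Rightarrow> complex"
  assumes "integrable M (\<lambda>x. c * f x)" "c \<noteq> 0"
  shows "integrable M f"
proof -
  have "integrable M (\<lambda>x. inverse c * (c * f x))" using assms(1) by (rule integrable_mult_right)
  then show ?thesis using assms(2) by (simp add: mult.assoc[symmetric])
qed

lemma integrable_exp_mult_exp_exp:
  fixes a :: real
  assumes "a > 0"
  shows "integrable lborel (\<lambda>v::real. exp (v * a) * exp (- exp v))"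
proof -
  obtain n where n: "real n \<ge> a + 1" using real_arch_simple by blast
  define c where "c = min a 1"
  have c: "0 < c" "c \<le> a" "c \<le> 1" using assms unfolding c_def by auto
  show ?thesis
  proof (rule Bochner_Integration.integrable_bound)
    show "integrable lborel (\<lambda>v::real. fact n * exp (- c * \<bar>v\<bar>))"
      by (intro integrable_mult_right integrable_exp_minus_abs c)
    have "exp (v * a) * exp (- exp v) \<le> fact n * exp (- c * \<bar>v\<bar>)" for v
    proof (cases "v \<ge> 0")
      case True
      have "exp v ^ n \<le> fact n * exp (exp v)" by (rule power_le_fact_mult_exp) auto
      then have "exp (real n * v) * exp (- exp v) \<le> fact n * exp (exp v) * exp (- exp v)"
        by (intro mult_right_mono) (auto simp: exp_of_nat_mult)
      then have 1: "exp (real n * v) * exp (- exp v) \<le> fact n" by (simp add: mult.assoc mult_exp_exp)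
      have "v * a + c * v \<le> real n * v"
        using mult_right_mono[of "a + c" "real n" v] True n c by (simp add: algebra_simps)
      then have "exp (v * a) * exp (- exp v) \<le> exp (- c * \<bar>v\<bar>) * (exp (real n * v) * exp (- exp v))"
        using True by (simp add: mult_exp_exp)
      also have "\<dots> \<le> exp (- c * \<bar>v\<bar>) * fact n" using 1 by (intro mult_left_mono) auto
      finally show ?thesis by (simp add: mult.commute)
    next
      case False
      then have "v * a \<le> v * c" using c by (intro mult_left_mono_neg) auto
      then have "exp (v * a) * exp (- exp v) \<le> exp (- c * \<bar>v\<bar>) * 1"
        using False by (intro mult_mono) (auto simp: mult.commute)
      also have "\<dots> \<le> exp (- c * \<bar>v\<bar>) * fact n" by (intro mult_left_mono) auto
      finally show ?thesis by (simp add: mult.commute)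
    qed
    then show "AE v in lborel. norm (exp (v * a) * exp (- exp v)) \<le> norm (fact n * exp (- c * \<bar>v\<bar>))"
      by auto
  qed auto
qed

text \<open>After the substitution \<open>t = e\<^sup>v\<close>, the duality \<open>\<kappa> \<leftrightarrow> 1 / \<kappa>\<close> between Gaussians becomes the reflection \<open>v \<mapsto> - v\<close>.\<close>

lemma Gamma_integral_exp_1:
  fixes z :: complex
  assumes "0 < Re z"
  shows "integrable lborel (\<lambda>v. exp (of_real v * z) * of_real (exp (- exp v)))"
    and "(LINT v|lborel. exp (of_real v * z) * of_real (exp (- exp v))) = Gamma z"
proof -
  let ?f = "\<lambda>t. of_real t powr (z - 1) / of_real (exp t) :: complex"
  show int: "integrable lborel (\<lambda>v. exp (of_real v * z) * of_real (exp (- exp v)))"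
    by (rule Bochner_Integration.integrable_bound[OF integrable_exp_mult_exp_exp[OF assms]]) (auto simp: norm_mult)
  have eq: "exp v *\<^sub>R ?f (exp v) = exp (of_real v * z) * of_real (exp (- exp v))" for v
  proof -
    have "of_real (exp v) powr (z - 1) = exp (of_real v * (z - 1))"
      by (simp add: powr_def Ln_of_real mult.commute)
    moreover have "complex_of_real (exp v) = exp (of_real v)" by (simp add: exp_of_real)
    ultimately have "exp v *\<^sub>R ?f (exp v) = exp (of_real v) * exp (of_real v * (z - 1)) / of_real (exp (exp v))"
      by (simp add: scaleR_conv_of_real)
    also have "exp (of_real v) * exp (of_real v * (z - 1)) = exp (of_real v * z)"
      by (simp add: mult_exp_exp algebra_simps)
    finally show ?thesis by (simp add: exp_minus divide_inverse)
  qed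
  have ei: "einterval (-\<infinity>) \<infinity> = (UNIV :: real set)" by (auto simp: einterval_def)
  have ei2: "einterval 0 \<infinity> = {0::real<..}" by (auto simp: einterval_def zero_ereal_def)
  have sf: "set_integrable lborel {0<..} ?f"
  proof -
    have "?f absolutely_integrable_on {0<..}" using absolutely_integrable_Gamma_integral'[OF assms] .
    moreover have "(\<lambda>t. indicator {0<..} t *\<^sub>R ?f t) \<in> borel_measurable lborel"
    proof -
      have "continuous_on {0<..} ?f" by (auto intro!: continuous_intros simp: complex_nonpos_Reals_iff)
      then have "(\<lambda>t. indicator {0<..} t *\<^sub>R ?f t) \<in> borel_measurable borel"
        by (intro borel_measurable_continuous_on_indicator) auto
      then show ?thesis by simp
    qed
    ultimately show ?thesis unfolding set_integrable_def by (simp add: integrable_completion)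
  qed
  have "(LBINT x=0..\<infinity>. ?f x) = (LBINT x=-\<infinity>..\<infinity>. exp x *\<^sub>R ?f (exp x))"
  proof (rule interval_integral_substitution_integrable)
    show "((ereal \<circ> exp \<circ> real_of_ereal) \<longlongrightarrow> 0) (at_right (- \<infinity>))"
      unfolding zero_ereal_def by (auto simp: ereal_tendsto_simps intro!: exp_at_bot)
    show "((ereal \<circ> exp \<circ> real_of_ereal) \<longlongrightarrow> \<infinity>) (at_left \<infinity>)"
      by (auto simp: ereal_tendsto_simps intro!: exp_at_top)
    show "set_integrable lborel (einterval (-\<infinity>) \<infinity>) (\<lambda>x. exp x *\<^sub>R ?f (exp x))"
      unfolding ei eq set_integrable_def using int by simp
    show "set_integrable lborel (einterval 0 \<infinity>) ?f" unfolding ei2 by (rule sf)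
    show "isCont ?f (exp x)" for x
      by (intro continuous_intros) (auto simp: complex_nonpos_Reals_iff)
  qed (auto intro!: derivative_eq_intros)
  then have "(LINT t:{0<..}|lborel. ?f t) = (LINT v|lborel. exp (of_real v * z) * of_real (exp (- exp v)))"
    unfolding eq by (simp add: interval_lebesgue_integral_def ei ei2 set_lebesgue_integral_def)
  moreover have "(LINT t:{0<..}|lborel. ?f t) = Gamma z"
    using set_borel_integral_eq_integral(2)[OF sf] Gamma_integral_complex'[OF assms] by (simp add: has_integral_iff)
  ultimately show "(LINT v|lborel. exp (of_real v * z) * of_real (exp (- exp v))) = Gamma z" by simp
qed

text \<open>In the variable v, scaling by \<open>A\<close> is translation by ln A. The last factor
  is A^(-z).\<close>

lemma Gamma_integral_exp:
  fixes z :: complex and A :: real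
  assumes "0 < Re z" "0 < A"
  shows "integrable lborel (\<lambda>v. exp (of_real v * z) * of_real (exp (- A * exp v)))"
    and "(LINT v|lborel. exp (of_real v * z) * of_real (exp (- A * exp v))) = Gamma z * exp (- z * of_real (ln A))"
proof -
  let ?g = "\<lambda>v. exp (of_real v * z) * of_real (exp (- exp v)) :: complex"
  have eq: "?g (ln A + 1 * v) = exp (z * of_real (ln A)) * (exp (of_real v * z) * of_real (exp (- A * exp v)))" for v
    using assms by (simp add: exp_add ring_distribs mult_ac)
  have "integrable lborel (\<lambda>v. ?g (ln A + 1 * v))"
    by (rule lborel_integrable_real_affine) (use Gamma_integral_exp_1[OF assms(1)] in auto)
  then show "integrable lborel (\<lambda>v. exp (of_real v * z) * of_real (exp (- A * exp v)))"
    unfolding eq by (rule integrable_mult_cancel) auto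
  have "Gamma z = (LINT v|lborel. ?g (ln A + 1 * v))"
    using lborel_integral_real_affine[of 1 ?g "ln A"] Gamma_integral_exp_1(2)[OF assms(1)] by simp
  also have "\<dots> = exp (z * of_real (ln A)) * (LINT v|lborel. exp (of_real v * z) * of_real (exp (- A * exp v)))"
    unfolding eq by (rule integral_mult_right_zero)
  finally show "(LINT v|lborel. exp (of_real v * z) * of_real (exp (- A * exp v))) = Gamma z * exp (- z * of_real (ln A))"
    by (simp add: exp_minus)
qed

lemma gaussian_fourier_real:
  fixes s \<kappa> :: real
  assumes "\<kappa> > 0"
  shows "integrable lborel (\<lambda>u. cis (2 * pi * (s * u)) * of_real (exp (- pi * \<kappa> * u\<^sup>2)))"
    and "(LINT u|lborel. cis (2 * pi * (s * u)) * of_real (exp (- pi * \<kappa> * u\<^sup>2)))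
       = of_real (\<kappa> powr (- 1 / 2) * exp (- pi * s\<^sup>2 / \<kappa>))"
proof -
  \<comment> \<open>With x = c u the exponent x^2 / 2 of the normal density becomes pi \<kappa> u^2,
    and \<open>t\<close> is chosen to turn the phase t x into 2 pi s u; the value is then read off
    from the normal characteristic function.\<close>
  define c where "c = sqrt (2 * pi * \<kappa>)"
  define t where "t = 2 * pi * s / c"
  let ?g = "\<lambda>x. std_normal_density x *\<^sub>R iexp (t * x)"
  have c: "c > 0" "c\<^sup>2 = 2 * pi * \<kappa>" using assms unfolding c_def by auto
  have eq: "?g (0 + c * u) = of_real (1 / sqrt (2 * pi)) * (cis (2 * pi * (s * u)) * of_real (exp (- pi * \<kappa> * u\<^sup>2)))" for u
  proof -
    have e1: "t * (c * u) = 2 * pi * (s * u)" using c by (simp add: t_def)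
    have e2: "- (c * u)\<^sup>2 / 2 = - pi * \<kappa> * u\<^sup>2" using c by (simp add: power_mult_distrib)
    have "?g (0 + c * u) = (1 / sqrt (2 * pi) * exp (- pi * \<kappa> * u\<^sup>2)) *\<^sub>R cis (2 * pi * (s * u))"
      by (simp only: add_0 std_normal_density_def e1 e2 cis_conv_exp)
    then show ?thesis by (simp add: scaleR_conv_of_real mult_ac)
  qed
  have intg: "integrable lborel ?g"
  proof (rule Bochner_Integration.integrable_bound)
    show "integrable lborel (\<lambda>x. std_normal_density x)" by auto
  qed auto
  have "(LINT x|lborel. ?g x) = char std_normal_distribution t"
    unfolding char_def by (subst integral_density) auto
  also have "\<dots> = of_real (exp (- t\<^sup>2 / 2))" by (simp add: char_std_normal_distribution)
  also have "- t\<^sup>2 / 2 = - pi * s\<^sup>2 / \<kappa>"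
    using c assms by (simp add: t_def power_divide power_mult_distrib) (simp add: power2_eq_square)
  finally have I: "(LINT x|lborel. ?g x) = of_real (exp (- pi * s\<^sup>2 / \<kappa>))" .
  have "integrable lborel (\<lambda>u. ?g (0 + c * u))"
    by (rule lborel_integrable_real_affine[OF intg]) (use c in auto)
  then show "integrable lborel (\<lambda>u. cis (2 * pi * (s * u)) * of_real (exp (- pi * \<kappa> * u\<^sup>2)))"
    unfolding eq by (rule integrable_mult_cancel) auto
  have "(LINT x|lborel. ?g x) = c *\<^sub>R (LINT u|lborel. ?g (0 + c * u))"
    using lborel_integral_real_affine[of c ?g 0] c by simp
  also have "\<dots> = of_real (c / sqrt (2 * pi)) * (LINT u|lborel. cis (2 * pi * (s * u)) * of_real (exp (- pi * \<kappa> * u\<^sup>2)))"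
    unfolding eq integral_mult_right_zero by (simp add: scaleR_conv_of_real)
  also have "c / sqrt (2 * pi) = sqrt \<kappa>" unfolding c_def by (simp add: real_sqrt_mult)
  finally have I': "of_real (sqrt \<kappa>) * (LINT u|lborel. cis (2 * pi * (s * u)) * of_real (exp (- pi * \<kappa> * u\<^sup>2))) = complex_of_real (exp (- pi * s\<^sup>2 / \<kappa>))"
    using I by simp
  have "\<kappa> powr (- 1 / 2) = 1 / sqrt \<kappa>"
    using assms by (simp add: powr_minus_divide powr_half_sqrt)
  then have "\<kappa> powr (- 1 / 2) * sqrt \<kappa> = 1" using assms by simp
  then have m: "of_real (\<kappa> powr (- 1 / 2)) * of_real (sqrt \<kappa>) = (1 :: complex)"
    by (metis of_real_1 of_real_mult)
  have "u = p * v" if "r * u = v" "p * r = 1" for p r u v :: complex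
    using that by (metis mult.assoc mult.left_neutral)
  from this[OF I' m] show "(LINT u|lborel. cis (2 * pi * (s * u)) * of_real (exp (- pi * \<kappa> * u\<^sup>2)))
       = of_real (\<kappa> powr (- 1 / 2) * exp (- pi * s\<^sup>2 / \<kappa>))"
    by (simp only: of_real_mult)
qed

lemma lborel_integral_prod_inner:
  fixes f :: "'a::euclidean_space \<Rightarrow> real \<Rightarrow> complex"
  assumes int: "\<And>b. b \<in> Basis \<Longrightarrow> integrable lborel (f b)"
  shows "integrable lborel (\<lambda>x::'a. \<Prod>b\<in>Basis. f b (x \<bullet> b))"
    and "(LINT x|(lborel::'a measure). (\<Prod>b\<in>Basis. f b (x \<bullet> b))) = (\<Prod>b\<in>Basis. (LINT u|lborel. f b u))"
proof -
  interpret product_sigma_finite "\<lambda>_::'a. lborel :: real measure" ..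
  let ?T = "\<lambda>u. \<Sum>b\<in>Basis. u b *\<^sub>R (b::'a)"
  have m: "?T \<in> (\<Pi>\<^sub>M b\<in>Basis. lborel) \<rightarrow>\<^sub>M borel" by measurable
  have fm: "f b \<in> borel_measurable borel" if "b \<in> Basis" for b
    using borel_measurable_integrable[OF int[OF that]] by simp
  have g: "(\<lambda>x::'a. \<Prod>b\<in>Basis. f b (x \<bullet> b)) \<in> borel_measurable borel"
    by (intro borel_measurable_prod measurable_compose[OF _ fm]) auto
  have eq: "(\<Prod>b\<in>Basis. f b (?T u \<bullet> b)) = (\<Prod>b\<in>Basis. f b (u b))" for u
    by (intro prod.cong) (auto simp: inner_sum_left inner_Basis if_distrib sum.delta cong: if_cong)
  have "integrable (\<Pi>\<^sub>M b\<in>Basis. lborel) (\<lambda>u. \<Prod>b\<in>(Basis::'a set). f b (u b))"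
    by (rule product_integrable_prod) (use int in auto)
  then show "integrable lborel (\<lambda>x::'a. \<Prod>b\<in>Basis. f b (x \<bullet> b))"
    unfolding lborel_eq[where 'a='a] by (subst integrable_distr_eq[OF m g]) (simp only: eq)
  show "(LINT x|(lborel::'a measure). (\<Prod>b\<in>Basis. f b (x \<bullet> b))) = (\<Prod>b\<in>Basis. (LINT u|lborel. f b u))"
    unfolding lborel_eq[where 'a='a] integral_distr[OF m g] eq
    by (rule product_integral_prod) (use int in auto)
qed

lemma gaussian_fourier:
  fixes x :: "'a::euclidean_space" and \<kappa> :: real
  assumes "\<kappa> > 0"
  shows "integrable lborel (\<lambda>\<xi>::'a. cis (2 * pi * (x \<bullet> \<xi>)) * of_real (exp (- pi * \<kappa> * (norm \<xi>)\<^sup>2)))"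
    and "(LINT \<xi>|(lborel::'a measure). cis (2 * pi * (x \<bullet> \<xi>)) * of_real (exp (- pi * \<kappa> * (norm \<xi>)\<^sup>2)))
       = of_real (\<kappa> powr (- real DIM('a) / 2) * exp (- pi * (norm x)\<^sup>2 / \<kappa>))"
proof -
  let ?f = "\<lambda>b u. cis (2 * pi * ((x \<bullet> b) * u)) * of_real (exp (- pi * \<kappa> * u\<^sup>2))"
  have n2: "(norm y)\<^sup>2 = (\<Sum>b\<in>Basis. (y \<bullet> b)\<^sup>2)" for y :: 'a
    unfolding power2_norm_eq_inner by (subst euclidean_inner) (simp add: power2_eq_square)
  have eq: "cis (2 * pi * (x \<bullet> \<xi>)) * of_real (exp (- pi * \<kappa> * (norm \<xi>)\<^sup>2)) = (\<Prod>b\<in>Basis. ?f b (\<xi> \<bullet> b))" for \<xi> :: 'a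
  proof -
    have "cis (2 * pi * (x \<bullet> \<xi>)) = (\<Prod>b\<in>Basis. cis (2 * pi * ((x \<bullet> b) * (\<xi> \<bullet> b))))"
      by (subst euclidean_inner) (simp add: cis_conv_exp sum_distrib_left exp_sum mult_ac)
    moreover have "exp (- pi * \<kappa> * (norm \<xi>)\<^sup>2) = (\<Prod>b\<in>Basis. exp (- pi * \<kappa> * (\<xi> \<bullet> b)\<^sup>2))"
      by (subst n2) (simp add: sum_distrib_left exp_sum sum_negf[symmetric])
    ultimately show ?thesis by (simp add: prod.distrib)
  qed
  show "integrable lborel (\<lambda>\<xi>::'a. cis (2 * pi * (x \<bullet> \<xi>)) * of_real (exp (- pi * \<kappa> * (norm \<xi>)\<^sup>2)))"
    unfolding eq by (rule lborel_integral_prod_inner) (rule gaussian_fourier_real[OF assms])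
  have "(LINT \<xi>|(lborel::'a measure). (\<Prod>b\<in>Basis. ?f b (\<xi> \<bullet> b))) = (\<Prod>b\<in>(Basis::'a set). (LINT u|lborel. ?f b u))"
    by (rule lborel_integral_prod_inner) (rule gaussian_fourier_real[OF assms])
  also have "\<dots> = of_real (\<Prod>b\<in>(Basis::'a set). \<kappa> powr (- 1 / 2) * exp (- pi * (x \<bullet> b)\<^sup>2 / \<kappa>))"
    unfolding gaussian_fourier_real(2)[OF assms] by simp
  also have "(\<Prod>b\<in>(Basis::'a set). \<kappa> powr (- 1 / 2) * exp (- pi * (x \<bullet> b)\<^sup>2 / \<kappa>)) = \<kappa> powr (- real DIM('a) / 2) * exp (- pi * (norm x)\<^sup>2 / \<kappa>)"
  proof -
    have "(\<kappa> powr (- 1 / 2)) ^ DIM('a) = \<kappa> powr (- real DIM('a) / 2)"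
      using assms by (simp add: powr_realpow[symmetric] powr_powr)
    moreover have "(\<Prod>b\<in>(Basis::'a set). exp (- pi * (x \<bullet> b)\<^sup>2 / \<kappa>)) = exp (- pi * (norm x)\<^sup>2 / \<kappa>)"
      unfolding n2 by (simp add: exp_sum[symmetric] sum_distrib_left sum_divide_distrib sum_negf)
    ultimately show ?thesis by (simp add: prod.distrib)
  qed
  finally show "(LINT \<xi>|(lborel::'a measure). cis (2 * pi * (x \<bullet> \<xi>)) * of_real (exp (- pi * \<kappa> * (norm \<xi>)\<^sup>2)))
       = of_real (\<kappa> powr (- real DIM('a) / 2) * exp (- pi * (norm x)\<^sup>2 / \<kappa>))"
    unfolding eq .
qed

text \<open>The complex power \<open>|x|\<^sup>s\<close> is written \<open>exp (s * ln |x|)\<close>; at \<open>x = 0\<close> this has the junk value 1, which is harmless on a null set.\<close>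

lemma mellin_gaussian_integral:
  fixes g :: "'a::euclidean_space \<Rightarrow> complex" and z :: complex
  assumes z: "0 < Re z" and g: "g \<in> borel_measurable lborel"
    and int: "integrable lborel (\<lambda>x. norm x powr (- 2 * Re z) * norm (g x))"
  shows "(LINT v|lborel. exp (of_real v * z) * (LINT x|lborel. of_real (exp (- pi * exp v * (norm x)\<^sup>2)) * g x))
     = Gamma z * exp (- z * of_real (ln pi)) * (LINT x|lborel. exp (- 2 * z * of_real (ln (norm x))) * g x)"
proof -
  have [measurable]: "g \<in> borel_measurable borel" using g by simp
  define f where "f = (\<lambda>x v. exp (of_real v * z) * of_real (exp (- (pi * (norm x)\<^sup>2) * exp v)) * g x)"
  have meas: "case_prod f \<in> borel_measurable (lborel \<Otimes>\<^sub>M lborel)" unfolding f_def by measurable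
  have lnA: "ln (pi * (norm x)\<^sup>2) = ln pi + 2 * ln (norm x)" if "x \<noteq> 0" for x :: 'a
    using that by (simp add: ln_mult ln_realpow)
  have inner: "integrable lborel (f x) \<and> (LINT v|lborel. f x v) = Gamma z * exp (- z * of_real (ln (pi * (norm x)\<^sup>2))) * g x" if "x \<noteq> 0" for x
  proof -
    have A: "0 < pi * (norm x)\<^sup>2" using that by auto
    show ?thesis unfolding f_def
      using Gamma_integral_exp[OF z A] by (simp add: integral_mult_left_zero integrable_mult_left)
  qed
  \<comment> \<open>Taking norms replaces z by Re z in the same Gamma integral, so the formula
    itself reduces the Fubini condition to the hypothesis \<open>int\<close>.\<close>
  have inner_norm: "(LINT v|lborel. norm (f x v)) = Gamma (Re z) * (pi powr (- Re z) * (norm x powr (- 2 * Re z) * norm (g x)))" if "x \<noteq> 0" for x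
  proof -
    have A: "0 < pi * (norm x)\<^sup>2" using that by auto
    have n: "norm (f x v) = Re (exp (of_real v * of_real (Re z)) * of_real (exp (- (pi * (norm x)\<^sup>2) * exp v))) * norm (g x)" for v
    proof -
      have "exp (of_real v * of_real (Re z)) * complex_of_real (exp (- (pi * (norm x)\<^sup>2) * exp v)) = of_real (exp (v * Re z) * exp (- (pi * (norm x)\<^sup>2) * exp v))"
        by (simp only: of_real_mult[symmetric] exp_of_real)
      then show ?thesis unfolding f_def norm_mult by simp
    qed
    have G: "integrable lborel (\<lambda>v. exp (of_real v * of_real (Re z)) * complex_of_real (exp (- (pi * (norm x)\<^sup>2) * exp v)))"
      "(LINT v|lborel. exp (of_real v * of_real (Re z)) * complex_of_real (exp (- (pi * (norm x)\<^sup>2) * exp v))) = Gamma (of_real (Re z)) * exp (- of_real (Re z) * of_real (ln (pi * (norm x)\<^sup>2)))"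
      using Gamma_integral_exp[of "of_real (Re z)", OF _ A] z by auto
    have "(LINT v|lborel. norm (f x v)) = Re (LINT v|lborel. exp (of_real v * of_real (Re z)) * complex_of_real (exp (- (pi * (norm x)\<^sup>2) * exp v))) * norm (g x)"
      unfolding n integral_mult_left_zero using integral_Re[OF G(1)] by simp
    also have "\<dots> = Re (of_real (Gamma (Re z) * exp (- Re z * ln (pi * (norm x)\<^sup>2)))) * norm (g x)"
    proof -
      have "Gamma (of_real (Re z)) * exp (- of_real (Re z) * of_real (ln (pi * (norm x)\<^sup>2)))
          = complex_of_real (Gamma (Re z) * exp (- Re z * ln (pi * (norm x)\<^sup>2)))"
        by (simp add: Gamma_complex_of_real flip: exp_of_real)
      then show ?thesis unfolding G(2) by (simp only:)
    qed
    also have "exp (- Re z * ln (pi * (norm x)\<^sup>2)) = pi powr (- Re z) * norm x powr (- 2 * Re z)"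
      unfolding lnA[OF that] using that by (simp add: powr_def mult_exp_exp algebra_simps)
    finally show ?thesis by simp
  qed
  have nz: "AE x in lborel. x \<noteq> (0::'a)" by (rule AE_lborel_singleton)
  have swap: "(LINT v|lborel. LINT x|lborel. f x v) = (LINT x|lborel. LINT v|lborel. f x v)"
  proof (rule lborel_Fubini(2)[OF meas])
    have "integrable lborel (\<lambda>x. Gamma (Re z) * (pi powr (- Re z) * (norm x powr (- 2 * Re z) * norm (g x))))"
      by (intro integrable_mult_right int)
    then show "integrable lborel (\<lambda>x. LINT v|lborel. norm (f x v))"
    proof (rule integrable_cong_AE_imp)
      show "(\<lambda>x. LINT v|lborel. norm (f x v)) \<in> borel_measurable lborel"
        using meas by measurable
      show "AE x in lborel. Gamma (Re z) * (pi powr (- Re z) * (norm x powr (- 2 * Re z) * norm (g x))) = (LINT v|lborel. norm (f x v))"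
        using nz by eventually_elim (rule inner_norm[symmetric])
    qed
    show "AE x in lborel. integrable lborel (f x)" using nz by eventually_elim (use inner in blast)
  qed
  have "(LINT v|lborel. exp (of_real v * z) * (LINT x|lborel. of_real (exp (- pi * exp v * (norm x)\<^sup>2)) * g x)) = (LINT v|lborel. LINT x|lborel. f x v)"
    unfolding f_def integral_mult_right_zero[symmetric] by (simp add: mult_ac)
  also have "\<dots> = (LINT x|lborel. Gamma z * exp (- z * of_real (ln pi)) * (exp (- 2 * z * of_real (ln (norm x))) * g x))"
    unfolding swap
  proof (rule integral_cong_AE)
    show "AE x in lborel. (LINT v|lborel. f x v) = Gamma z * exp (- z * of_real (ln pi)) * (exp (- 2 * z * of_real (ln (norm x))) * g x)"
      using nz
    proof eventually_elim
      case (elim x)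
      have "exp (- z * of_real (ln (pi * (norm x)\<^sup>2))) = exp (- z * of_real (ln pi)) * exp (- 2 * z * of_real (ln (norm x)))"
        unfolding lnA[OF elim] mult_exp_exp by (simp add: algebra_simps)
      then show ?case using inner[OF elim] by simp
    qed
    show "(\<lambda>x. LINT v|lborel. f x v) \<in> borel_measurable lborel" using meas by measurable
  qed measurable
  finally show ?thesis unfolding integral_mult_right_zero .
qed

text \<open>Fubini moves the Fourier integral from \<open>\<phi>\<close> to the Gaussian, whose
  transform is explicit with \<kappa> replaced by 1 / \<kappa>.\<close>

lemma gaussian_parseval:
  fixes \<phi> :: "'a::euclidean_space \<Rightarrow> complex"
  assumes \<phi>: "integrable lborel \<phi>" and \<kappa>: "\<kappa> > 0"
  shows "(LINT \<xi>|lborel. of_real (exp (- pi * \<kappa> * (norm \<xi>)\<^sup>2)) * inverse_fourier_integral \<phi> \<xi>)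
     = of_real (\<kappa> powr (- real DIM('a) / 2)) * (LINT x|lborel. of_real (exp (- pi * (norm x)\<^sup>2 / \<kappa>)) * \<phi> x)"
proof -
  have [measurable]: "\<phi> \<in> borel_measurable borel" using borel_measurable_integrable[OF \<phi>] by simp
  define f where "f = (\<lambda>\<xi> x. of_real (exp (- pi * \<kappa> * (norm \<xi>)\<^sup>2)) * (cis (2 * pi * (\<xi> \<bullet> x)) * \<phi> x))"
  have gi: "integrable lborel (\<lambda>\<xi>::'a. exp (- pi * \<kappa> * (norm \<xi>)\<^sup>2))"
    using integrable_norm[OF gaussian_fourier(1)[OF \<kappa>, of 0]] by (simp add: norm_mult)
  have meas: "case_prod f \<in> borel_measurable (lborel \<Otimes>\<^sub>M lborel)"
    unfolding f_def by measurable
  have nf: "norm (f \<xi> x) = exp (- pi * \<kappa> * (norm \<xi>)\<^sup>2) * norm (\<phi> x)" for \<xi> x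
    unfolding f_def by (simp add: norm_mult)
  have swap: "(LINT x|lborel. LINT \<xi>|lborel. f \<xi> x) = (LINT \<xi>|lborel. LINT x|lborel. f \<xi> x)"
  proof (rule lborel_Fubini(2)[OF meas])
    show "integrable lborel (\<lambda>\<xi>. LINT x|lborel. norm (f \<xi> x))"
      unfolding nf integral_mult_right_zero by (intro integrable_mult_left gi)
    show "AE \<xi> in lborel. integrable lborel (f \<xi>)"
    proof (rule AE_I2)
      fix \<xi> :: 'a
      show "integrable lborel (f \<xi>)"
      proof (rule Bochner_Integration.integrable_bound)
        show "integrable lborel (\<lambda>x. exp (- pi * \<kappa> * (norm \<xi>)\<^sup>2) * norm (\<phi> x))"
          using \<phi> by (intro integrable_mult_right integrable_norm)
        show "f \<xi> \<in> borel_measurable lborel" unfolding f_def by measurable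
      qed (simp add: nf)
    qed
  qed
  have "(LINT \<xi>|lborel. of_real (exp (- pi * \<kappa> * (norm \<xi>)\<^sup>2)) * inverse_fourier_integral \<phi> \<xi>) = (LINT \<xi>|lborel. LINT x|lborel. f \<xi> x)"
    unfolding f_def inverse_fourier_integral_def integral_mult_right_zero by simp
  also have "\<dots> = (LINT x|lborel. of_real (\<kappa> powr (- real DIM('a) / 2)) * (of_real (exp (- pi * (norm x)\<^sup>2 / \<kappa>)) * \<phi> x))"
    unfolding swap[symmetric]
  proof (rule Bochner_Integration.integral_cong[OF refl])
    fix x :: 'a
    have "f \<xi> x = cis (2 * pi * (x \<bullet> \<xi>)) * of_real (exp (- pi * \<kappa> * (norm \<xi>)\<^sup>2)) * \<phi> x" for \<xi>
      unfolding f_def by (simp add: inner_commute mult_ac)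
    then have "(LINT \<xi>|lborel. f \<xi> x) = (LINT \<xi>|lborel. cis (2 * pi * (x \<bullet> \<xi>)) * of_real (exp (- pi * \<kappa> * (norm \<xi>)\<^sup>2))) * \<phi> x"
      by (simp only: integral_mult_left_zero)
    then show "(LINT \<xi>|lborel. f \<xi> x) = of_real (\<kappa> powr (- real DIM('a) / 2)) * (of_real (exp (- pi * (norm x)\<^sup>2 / \<kappa>)) * \<phi> x)"
      unfolding gaussian_fourier(2)[OF \<kappa>] by (simp add: mult.assoc)
  qed
  finally show ?thesis unfolding integral_mult_right_zero .
qed

text \<open>Multiply the Gaussian identity by \<kappa>^(s/2) and integrate against d\<kappa> /
  \<kappa>, where \<kappa> = exp v. On either side the Gaussians add up to a power of the norm; the
  reflection v to - v together with the factor \<kappa>^(- d/2) exchanges s with d - s. The Gamma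
  factors are left as multipliers of the two sides.\<close>

lemma riesz_pairing:
  fixes \<phi> :: "'a::euclidean_space \<Rightarrow> complex" and s :: complex
  defines "d \<equiv> real DIM('a)"
  assumes s: "0 < Re s" "Re s < d"
    and \<phi>: "integrable lborel \<phi>"
    and \<psi>: "inverse_fourier_integral \<phi> \<in> borel_measurable lborel"
    and int1: "integrable lborel (\<lambda>\<xi>. norm \<xi> powr (- Re s) * norm (inverse_fourier_integral \<phi> \<xi>))"
    and int2: "integrable lborel (\<lambda>x. norm x powr (Re s - d) * norm (\<phi> x))"
  shows "Gamma (s / 2) * exp (- (s / 2) * of_real (ln pi)) * (LINT \<xi>|lborel. exp (- s * of_real (ln (norm \<xi>))) * inverse_fourier_integral \<phi> \<xi>)
    = Gamma ((of_real d - s) / 2) * exp (- ((of_real d - s) / 2) * of_real (ln pi)) * (LINT x|lborel. exp ((s - of_real d) * of_real (ln (norm x))) * \<phi> x)"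
proof -
  let ?A = "\<lambda>v. LINT x|lborel. of_real (exp (- pi * exp v * (norm x)\<^sup>2)) * \<phi> x"
  let ?G = "\<lambda>v. exp (of_real v * ((of_real d - s) / 2)) * ?A v"
  have eq: "exp (of_real v * (s / 2)) * (LINT \<xi>|lborel. of_real (exp (- pi * exp v * (norm \<xi>)\<^sup>2)) * inverse_fourier_integral \<phi> \<xi>) = ?G (0 + (- 1) * v)" for v
  proof -
    have "(LINT \<xi>|lborel. of_real (exp (- pi * exp v * (norm \<xi>)\<^sup>2)) * inverse_fourier_integral \<phi> \<xi>)
       = of_real (exp v powr (- d / 2)) * (LINT x|lborel. of_real (exp (- pi * (norm x)\<^sup>2 / exp v)) * \<phi> x)"
      unfolding d_def by (rule gaussian_parseval[OF \<phi>]) auto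
    moreover have "(LINT x|lborel. of_real (exp (- pi * (norm x)\<^sup>2 / exp v)) * \<phi> x) = ?A (- v)"
      by (simp add: exp_minus divide_inverse mult_ac)
    moreover have "exp (of_real v * (s / 2)) * of_real (exp v powr (- d / 2)) = exp (of_real (- v) * ((of_real d - s) / 2))"
    proof -
      have "complex_of_real (exp v powr (- d / 2)) = exp (of_real (- d / 2 * v))"
        by (simp add: powr_def flip: exp_of_real)
      then show ?thesis by (simp add: mult_exp_exp algebra_simps diff_divide_distrib)
    qed
    ultimately show ?thesis by (simp add: mult.assoc[symmetric])
  qed
  have "Gamma (s / 2) * exp (- (s / 2) * of_real (ln pi)) * (LINT \<xi>|lborel. exp (- 2 * (s / 2) * of_real (ln (norm \<xi>))) * inverse_fourier_integral \<phi> \<xi>)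
     = (LINT v|lborel. exp (of_real v * (s / 2)) * (LINT \<xi>|lborel. of_real (exp (- pi * exp v * (norm \<xi>)\<^sup>2)) * inverse_fourier_integral \<phi> \<xi>))"
    by (rule mellin_gaussian_integral[symmetric]) (use s \<psi> int1 in auto)
  also have "\<dots> = (LINT v|lborel. ?G (0 + (- 1) * v))" unfolding eq ..
  also have "\<dots> = (LINT v|lborel. ?G v)"
    using lborel_integral_real_affine[of "-1" ?G 0] by simp
  also have "\<dots> = Gamma ((of_real d - s) / 2) * exp (- ((of_real d - s) / 2) * of_real (ln pi)) * (LINT x|lborel. exp (- 2 * ((of_real d - s) / 2) * of_real (ln (norm x))) * \<phi> x)"
  proof (rule mellin_gaussian_integral)
    have "- 2 * Re ((of_real d - s) / 2) = Re s - d" by simp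
    then show "integrable lborel (\<lambda>x. norm x powr (- 2 * Re ((of_real d - s) / 2)) * norm (\<phi> x))" using int2 by (simp only:)
  qed (use s \<phi> in auto)
  also have "- 2 * ((of_real d - s) / 2) = s - of_real d" by simp
  also have "- 2 * (s / 2) = - s" by simp
  finally show ?thesis .
qed

section \<open>Schwartz functions and uniqueness of the inverse Fourier transform\<close>

lemma lborel_integral_translate:
  fixes f :: "'a::euclidean_space \<Rightarrow> 'b::{banach, second_countable_topology}"
  assumes "f \<in> borel_measurable borel"
  shows "(LINT x|lborel. f (a + x)) = (LINT x|lborel. f x)"
proof -
  have "(LINT x|lborel. f x) = (LINT x|distr lborel borel ((+) a). f x)"
    by (subst lborel_distr_plus) simp
  also have "\<dots> = (LINT x|lborel. f (a + x))"
    using assms by (subst integral_distr) auto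
  finally show ?thesis by simp
qed

lemma integrable_inverse_power_norm:
  "integrable lborel (\<lambda>x::'a::euclidean_space. 1 / (1 + norm x) ^ (DIM('a) + 1))"
proof (rule integrable_norm_powr_bounds[where a = 0 and b = "real DIM('a) + 1" and C = 1])
  fix x :: 'a assume x: "x \<noteq> 0"
  show "norm (1 / (1 + norm x) ^ (DIM('a) + 1)) \<le> 1 * norm x powr (- 0)"
    using x one_le_power[of "1 + norm x" "DIM('a) + 1"] by (simp add: divide_le_eq)
  have "norm x powr (- (real DIM('a) + 1)) = 1 / norm x ^ (DIM('a) + 1)"
  proof -
    have "norm x powr (real DIM('a) + 1) = norm x ^ (DIM('a) + 1)"
      using x powr_realpow[of "norm x" "DIM('a) + 1"] by (simp add: add.commute)
    then show ?thesis by (simp only: powr_minus_divide)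
  qed
  moreover have "1 / (1 + norm x) ^ (DIM('a) + 1) \<le> 1 / norm x ^ (DIM('a) + 1)"
    using x by (intro divide_left_mono power_mono mult_pos_pos zero_less_power) (auto intro: add_pos_nonneg)
  ultimately show "norm (1 / (1 + norm x) ^ (DIM('a) + 1)) \<le> 1 * norm x powr (- (real DIM('a) + 1))"
    by simp
qed (auto simp: DIM_positive)

lemma has_directional_derivative_bound:
  fixes f :: "'a::euclidean_space \<Rightarrow> complex"
  assumes diff: "\<And>x. f differentiable (at x)"
    and B: "\<And>s. 0 \<le> s \<Longrightarrow> s \<le> t \<Longrightarrow> norm (frechet_derivative f (at (x + s *\<^sub>R h)) h) \<le> B"
    and t: "0 \<le> t"
  shows "norm (f (x + t *\<^sub>R h) - f x) \<le> B * t"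
proof -
  let ?D = "\<lambda>s. frechet_derivative f (at (x + s *\<^sub>R h))"
  have der: "((\<lambda>s. f (x + s *\<^sub>R h)) has_derivative (\<lambda>u. u *\<^sub>R ?D s h)) (at s within {0..t})" for s
  proof -
    have "(f has_derivative ?D s) (at (x + s *\<^sub>R h))" using diff frechet_derivative_works by blast
    then have "((\<lambda>s. f (x + s *\<^sub>R h)) has_derivative (\<lambda>u. ?D s (u *\<^sub>R h))) (at s within {0..t})"
      by (rule has_derivative_compose[rotated]) (auto intro!: derivative_eq_intros)
    moreover have "linear (?D s)" using diff linear_frechet_derivative by blast
    ultimately show ?thesis by (simp add: linear_cmul)
  qed
  have "norm (f (x + t *\<^sub>R h) - f (x + 0 *\<^sub>R h)) \<le> B * norm (t - 0)"
  proof (rule differentiable_bound[OF _ der])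
    fix s assume "s \<in> {0..t}"
    then have "norm (?D s h) \<le> B" using B by auto
    then show "onorm (\<lambda>u. u *\<^sub>R ?D s h) \<le> B"
      by (intro onorm_le) (simp add: mult.commute[of B] mult_left_mono)
  qed (use t in auto)
  then show ?thesis using t by simp
qed

lemma tendsto_cis_difference_quotient:
  fixes c :: real
  shows "(\<lambda>n. of_nat (Suc n) * (cis (c / real (Suc n)) - 1)) \<longlonglongrightarrow> \<i> * of_real c"
proof (cases "c = 0")
  case False
  have "filterlim (\<lambda>n. \<i> * of_real (c / real (Suc n))) (at 0) sequentially"
  proof (rule filterlim_atI)
    have "(\<lambda>n. c / real (Suc n)) \<longlonglongrightarrow> 0" by real_asymp
    then have "(\<lambda>n. \<i> * complex_of_real (c / real (Suc n))) \<longlonglongrightarrow> \<i> * of_real 0"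
      by (intro tendsto_intros)
    then show "(\<lambda>n. \<i> * complex_of_real (c / real (Suc n))) \<longlonglongrightarrow> 0" by simp
    show "\<forall>\<^sub>F n in sequentially. \<i> * complex_of_real (c / real (Suc n)) \<noteq> 0"
      using False by (intro always_eventually allI) (auto simp del: of_nat_Suc)
  qed
  from filterlim_compose[OF lim_exp_minus_1 this]
  have "(\<lambda>n. \<i> * of_real c * ((exp (\<i> * of_real (c / real (Suc n))) - 1) / (\<i> * of_real (c / real (Suc n))))) \<longlonglongrightarrow> \<i> * of_real c * 1"
    by (intro tendsto_intros)
  moreover have "\<i> * of_real c * ((exp (\<i> * of_real (c / real (Suc n))) - 1) / (\<i> * of_real (c / real (Suc n))))
      = of_nat (Suc n) * (cis (c / real (Suc n)) - 1)" for n
    using False by (simp add: cis_conv_exp del: of_nat_Suc)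
  ultimately show ?thesis by simp
qed auto

text \<open>Translation invariance of Lebesgue measure, applied to difference quotients, replaces integration by parts.\<close>

lemma inverse_fourier_integral_derivative:
  fixes f :: "'a::euclidean_space \<Rightarrow> complex" and h :: 'a
  assumes diff: "\<And>x. f differentiable (at x)"
    and f: "integrable lborel f"
    and h: "norm h = 1"
    and f': "(\<lambda>x. frechet_derivative f (at x) h) \<in> borel_measurable borel"
    and C: "\<And>x. (1 + norm x) ^ (DIM('a) + 1) * norm (frechet_derivative f (at x) h) \<le> C"
  shows "inverse_fourier_integral (\<lambda>x. frechet_derivative f (at x) h) \<xi>
      = - (2 * pi * \<i> * (h \<bullet> \<xi>)) * inverse_fourier_integral f \<xi>"
proof -
  define N where "N = DIM('a) + 1"
  define F where "F = inverse_fourier_integral f \<xi>"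
  let ?f' = "\<lambda>x. frechet_derivative f (at x) h"
  let ?e = "\<lambda>x. cis (2 * pi * (\<xi> \<bullet> x))"
  have C0: "0 \<le> C" using order_trans[OF _ C[of 0]] by simp
  have [measurable]: "f \<in> borel_measurable borel" "?f' \<in> borel_measurable borel"
    using borel_measurable_integrable[OF f] f' by auto
  define q where "q = (\<lambda>n x. of_nat (Suc n) * (f (x + (1 / real (Suc n)) *\<^sub>R h) - f x))"
  \<comment> \<open>The increments have length at most 1, so 1 + |x| \<le> 2 (1 + |x + s h|). Decay
    of the derivative along the segment thus gives one majorant for all n, at the cost of
    2^N.\<close>
  have q_bound: "norm (q n x) \<le> C * 2 ^ N * (1 / (1 + norm x) ^ N)" for n x
  proof -
    let ?t = "1 / real (Suc n)"
    have "norm (f (x + ?t *\<^sub>R h) - f x) \<le> C * 2 ^ N / (1 + norm x) ^ N * ?t"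
    proof (rule has_directional_derivative_bound[OF diff])
      fix s assume s: "0 \<le> s" "s \<le> ?t"
      then have s1: "s \<le> 1" by (rule_tac order_trans[OF s(2)]) simp
      let ?y = "x + s *\<^sub>R h"
      have "norm x \<le> norm ?y + norm (s *\<^sub>R h)" by (metis norm_triangle_ineq4 add_diff_cancel_right')
      then have "1 + norm x \<le> 2 * (1 + norm ?y)" using s s1 h norm_ge_zero[of ?y] by (simp del: norm_ge_zero)
      then have "(1 + norm x) ^ N \<le> 2 ^ N * (1 + norm ?y) ^ N"
        by (subst power_mult_distrib[symmetric]) (intro power_mono, auto)
      then have "(1 + norm x) ^ N * norm (?f' ?y) \<le> 2 ^ N * ((1 + norm ?y) ^ N * norm (?f' ?y))"
        by (subst mult.assoc[symmetric]) (intro mult_right_mono, auto)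
      also have "\<dots> \<le> 2 ^ N * C" using C[of ?y] unfolding N_def by (intro mult_left_mono) auto
      finally show "norm (?f' ?y) \<le> C * 2 ^ N / (1 + norm x) ^ N"
        by (subst pos_le_divide_eq) (auto simp: mult_ac add_pos_nonneg)
    qed auto
    then have "real (Suc n) * norm (f (x + ?t *\<^sub>R h) - f x) \<le> real (Suc n) * (C * 2 ^ N / (1 + norm x) ^ N * ?t)"
      by (intro mult_left_mono) auto
    then show ?thesis unfolding q_def norm_mult norm_of_nat by simp
  qed
  have q_lim: "(\<lambda>n. q n x) \<longlonglongrightarrow> ?f' x" for x
  proof -
    have "(f has_derivative frechet_derivative f (at x)) (at x)" using diff frechet_derivative_works by blast
    then have D: "((\<lambda>s. f (x + s *\<^sub>R h)) has_vector_derivative ?f' x) (at 0)"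
    proof -
      have "(f has_derivative frechet_derivative f (at x)) (at (x + 0 *\<^sub>R h))"
        using diff[of x] frechet_derivative_works[of f "at x"] by simp
      then have "((\<lambda>s. f (x + s *\<^sub>R h)) has_derivative (\<lambda>u. frechet_derivative f (at x) (u *\<^sub>R h))) (at 0)"
        by (rule has_derivative_compose[rotated]) (auto intro!: derivative_eq_intros)
      moreover have "linear (frechet_derivative f (at x))" using diff linear_frechet_derivative by blast
      ultimately show ?thesis unfolding has_vector_derivative_def by (simp add: linear_cmul)
    qed
    then have "((\<lambda>t. norm ((f (x + t *\<^sub>R h) - f (x + 0 *\<^sub>R h)) - (t - 0) *\<^sub>R ?f' x) / norm (t - 0)) \<longlongrightarrow> 0) (at 0)"
      unfolding has_vector_derivative_def has_derivative_iff_norm by blast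
    moreover have "filterlim (\<lambda>n. 1 / real (Suc n)) (at 0) sequentially"
    proof (rule filterlim_atI)
      show "(\<lambda>n. 1 / real (Suc n)) \<longlonglongrightarrow> 0" by real_asymp
    qed auto
    ultimately have "(\<lambda>n. norm ((f (x + (1 / real (Suc n)) *\<^sub>R h) - f (x + 0 *\<^sub>R h)) - (1 / real (Suc n) - 0) *\<^sub>R ?f' x) / norm (1 / real (Suc n) - 0)) \<longlonglongrightarrow> 0"
      by (rule filterlim_compose)
    moreover have "norm ((f (x + (1 / real (Suc n)) *\<^sub>R h) - f (x + 0 *\<^sub>R h)) - (1 / real (Suc n) - 0) *\<^sub>R ?f' x) / norm (1 / real (Suc n) - 0) = norm (q n x - ?f' x)" for n
    proof -
      have "q n x - ?f' x = of_nat (Suc n) * ((f (x + (1 / real (Suc n)) *\<^sub>R h) - f x) - (1 / real (Suc n)) *\<^sub>R ?f' x)"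
        by (simp add: q_def scaleR_conv_of_real right_diff_distrib del: of_nat_Suc)
      then show ?thesis by (simp add: norm_mult mult.commute del: of_nat_Suc)
    qed
    ultimately have "(\<lambda>n. norm (q n x - ?f' x)) \<longlonglongrightarrow> 0" by simp
    then show ?thesis by (simp only: tendsto_norm_zero_iff LIM_zero_iff)
  qed
  have dom: "integrable lborel (\<lambda>x::'a. C * 2 ^ N * (1 / (1 + norm x) ^ N))"
    unfolding N_def by (intro integrable_mult_right integrable_inverse_power_norm)
  have lim1: "(\<lambda>n. LINT x|lborel. ?e x * q n x) \<longlonglongrightarrow> (LINT x|lborel. ?e x * ?f' x)"
  proof (rule integral_dominated_convergence[OF _ _ dom])
    show "AE x in lborel. (\<lambda>n. ?e x * q n x) \<longlonglongrightarrow> ?e x * ?f' x"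
      by (intro AE_I2 tendsto_intros q_lim)
    show "AE x in lborel. norm (?e x * q n x) \<le> C * 2 ^ N * (1 / (1 + norm x) ^ N)" for n
      using q_bound[of n] by (intro AE_I2) (simp add: norm_mult)
    show "(\<lambda>x. ?e x * q n x) \<in> borel_measurable lborel" for n unfolding q_def by measurable
    show "(\<lambda>x. ?e x * ?f' x) \<in> borel_measurable lborel" by measurable
  qed
  have inte: "integrable lborel (\<lambda>x. ?e x * f x)"
    by (rule Bochner_Integration.integrable_bound[OF f]) (auto simp: norm_mult)
  \<comment> \<open>Translation moves the difference quotient from \<open>f\<close> to the
    character, where it is a factor that does not depend on x and leaves the integral.\<close>
  have int_q: "(LINT x|lborel. ?e x * q n x) = of_nat (Suc n) * (cis (- (2 * pi * (\<xi> \<bullet> h)) / real (Suc n)) - 1) * F" for n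
  proof -
    let ?t = "1 / real (Suc n)"
    let ?c = "cis (- (2 * pi * (\<xi> \<bullet> h)) / real (Suc n))"
    let ?k = "\<lambda>y. ?c * (?e y * f y)"
    have shift: "?e x * f (x + ?t *\<^sub>R h) = ?k (?t *\<^sub>R h + x)" for x
    proof -
      have "?c * ?e (?t *\<^sub>R h + x) = ?e x" by (simp add: cis_mult inner_add_right distrib_left)
      then show ?thesis by (simp add: mult.assoc[symmetric] add.commute)
    qed
    have km: "?k \<in> borel_measurable borel" by measurable
    have ik: "integrable lborel (\<lambda>x. ?k (?t *\<^sub>R h + x))"
    proof -
      have "integrable (distr lborel borel ((+) (?t *\<^sub>R h))) ?k"
        unfolding lborel_distr_plus by (intro integrable_mult_right inte)
      then show ?thesis by (subst (asm) integrable_distr_eq) auto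
    qed
    have "(LINT x|lborel. ?e x * q n x) = (LINT x|lborel. of_nat (Suc n) * (?k (?t *\<^sub>R h + x) - ?e x * f x))"
      unfolding q_def shift[symmetric] by (simp add: algebra_simps)
    also have "\<dots> = of_nat (Suc n) * ((LINT x|lborel. ?k (?t *\<^sub>R h + x)) - (LINT x|lborel. ?e x * f x))"
      unfolding integral_mult_right_zero Bochner_Integration.integral_diff[OF ik inte] ..
    also have "(LINT x|lborel. ?k (?t *\<^sub>R h + x)) = ?c * (LINT x|lborel. ?e x * f x)"
      by (rule trans[OF lborel_integral_translate[OF km] integral_mult_right_zero])
    finally show ?thesis unfolding F_def inverse_fourier_integral_def by (simp add: algebra_simps)
  qed
  have "(\<lambda>n. of_nat (Suc n) * (cis (- (2 * pi * (\<xi> \<bullet> h)) / real (Suc n)) - 1) * F) \<longlonglongrightarrow> \<i> * of_real (- (2 * pi * (\<xi> \<bullet> h))) * F"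
    by (intro tendsto_mult_right tendsto_cis_difference_quotient)
  then have "(\<lambda>n. LINT x|lborel. ?e x * q n x) \<longlonglongrightarrow> \<i> * of_real (- (2 * pi * (\<xi> \<bullet> h))) * F"
    unfolding int_q .
  from LIMSEQ_unique[OF lim1 this] show ?thesis
    unfolding F_def by (simp add: inverse_fourier_integral_def inner_commute mult_ac)
qed

text \<open>The weight |x|^n of the definition degenerates at 0, so the exponents 0 and n are
  combined, one for |x| \<le> 1 and one for the rest.\<close>

lemma schwartz_derivative_bound:
  assumes "schwartz \<phi>" "set hs \<subseteq> Basis"
  shows "\<exists>C. \<forall>x. (1 + norm x) ^ n * norm (iterated_derivative hs \<phi> x) \<le> C"
proof -
  let ?D = "iterated_derivative hs \<phi>"
  have b: "bounded (range (\<lambda>x. norm x ^ k *\<^sub>R ?D x))" for k using assms unfolding schwartz_def by auto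
  obtain A where A: "\<And>x. norm (?D x) \<le> A" using b[of 0] unfolding bounded_iff by auto
  obtain B where B: "\<And>x. norm x ^ n * norm (?D x) \<le> B" using b[of n] unfolding bounded_iff by auto
  have "(1 + norm x) ^ n * norm (?D x) \<le> 2 ^ n * (A + B)" for x
  proof -
    have A0: "0 \<le> A" using A[of x] norm_ge_zero order_trans by blast
    have B0: "0 \<le> B" using B[of x] by (meson mult_nonneg_nonneg norm_ge_zero order_trans zero_le_power)
    show ?thesis
    proof (cases "norm x \<le> 1")
      case True
      then have "(1 + norm x) ^ n \<le> 2 ^ n" by (intro power_mono) auto
      then have "(1 + norm x) ^ n * norm (?D x) \<le> 2 ^ n * A" by (intro mult_mono A) auto
      then show ?thesis using B0 by (simp add: distrib_left) (smt (verit) mult_nonneg_nonneg zero_le_power)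
    next
      case False
      then have "(1 + norm x) ^ n \<le> (2 * norm x) ^ n" by (intro power_mono) auto
      then have "(1 + norm x) ^ n * norm (?D x) \<le> (2 * norm x) ^ n * norm (?D x)" by (intro mult_right_mono) auto
      also have "\<dots> = 2 ^ n * (norm x ^ n * norm (?D x))" by (simp add: power_mult_distrib)
      also have "\<dots> \<le> 2 ^ n * (A + B)" using B[of x] A0 by (intro mult_left_mono) auto
      finally show ?thesis .
    qed
  qed
  then show ?thesis by blast
qed

lemma schwartz_derivative_measurable:
  assumes "schwartz \<phi>" "set hs \<subseteq> Basis"
  shows "iterated_derivative hs \<phi> \<in> borel_measurable borel"
proof (rule borel_measurable_continuous_onI)
  show "continuous_on UNIV (iterated_derivative hs \<phi>)"
    using assms unfolding schwartz_def
    by (intro differentiable_imp_continuous_on) (auto simp: differentiable_on_def intro: differentiable_at_withinI)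
qed

lemma schwartz_derivative_integrable:
  fixes \<phi> :: "'a::euclidean_space \<Rightarrow> complex"
  assumes "schwartz \<phi>" "set hs \<subseteq> Basis"
  shows "integrable lborel (iterated_derivative hs \<phi>)"
proof -
  obtain C where C: "\<And>x. (1 + norm x) ^ (DIM('a) + 1) * norm (iterated_derivative hs \<phi> x) \<le> C"
    using schwartz_derivative_bound[OF assms] by blast
  have "integrable lborel (\<lambda>x::'a. C * (1 / (1 + norm x) ^ (DIM('a) + 1)))"
    by (intro integrable_mult_right integrable_inverse_power_norm)
  then show ?thesis
  proof (rule Bochner_Integration.integrable_bound)
    show "iterated_derivative hs \<phi> \<in> borel_measurable lborel" using schwartz_derivative_measurable[OF assms] by simp
    have "norm (iterated_derivative hs \<phi> x) \<le> norm (C * (1 / (1 + norm x) ^ (DIM('a) + 1)))" for x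
    proof -
      have "0 < (1 + norm x) ^ (DIM('a) + 1)" by (intro zero_less_power add_pos_nonneg) auto
      then have "norm (iterated_derivative hs \<phi> x) \<le> C * (1 / (1 + norm x) ^ (DIM('a) + 1))"
        using C[of x] by (simp add: pos_le_divide_eq mult.commute del: power_Suc)
      then show ?thesis by (simp only: real_norm_def)
    qed
    then show "AE x in lborel. norm (iterated_derivative hs \<phi> x) \<le> norm (C * (1 / (1 + norm x) ^ (DIM('a) + 1)))" by auto
  qed
qed

lemma inverse_fourier_integral_iterated:
  fixes \<phi> :: "'a::euclidean_space \<Rightarrow> complex"
  assumes \<phi>: "schwartz \<phi>" and h: "h \<in> Basis"
  shows "inverse_fourier_integral (iterated_derivative (replicate n h) \<phi>) \<xi>
     = (- (2 * pi * \<i> * (h \<bullet> \<xi>))) ^ n * inverse_fourier_integral \<phi> \<xi>"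
proof (induction n)
  case (Suc n)
  let ?hs = "replicate n h"
  have sub: "set ?hs \<subseteq> Basis" "set (h # ?hs) \<subseteq> Basis" using h by (auto split: if_splits)
  obtain C where C: "\<And>x. (1 + norm x) ^ (DIM('a) + 1) * norm (iterated_derivative (h # ?hs) \<phi> x) \<le> C"
    using schwartz_derivative_bound[OF \<phi> sub(2)] by blast
  have "inverse_fourier_integral (\<lambda>x. frechet_derivative (iterated_derivative ?hs \<phi>) (at x) h) \<xi>
     = - (2 * pi * \<i> * (h \<bullet> \<xi>)) * inverse_fourier_integral (iterated_derivative ?hs \<phi>) \<xi>"
  proof (rule inverse_fourier_integral_derivative)
    show "iterated_derivative ?hs \<phi> differentiable at x" for x using \<phi> sub unfolding schwartz_def by blast
    show "integrable lborel (iterated_derivative ?hs \<phi>)" by (rule schwartz_derivative_integrable[OF \<phi> sub(1)])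
    show "(\<lambda>x. frechet_derivative (iterated_derivative ?hs \<phi>) (at x) h) \<in> borel_measurable borel"
      using schwartz_derivative_measurable[OF \<phi> sub(2)] by simp
    show "(1 + norm x) ^ (DIM('a) + 1) * norm (frechet_derivative (iterated_derivative ?hs \<phi>) (at x) h) \<le> C" for x
      using C[of x] by simp
  qed (use h in auto)
  then show ?case using Suc by simp
qed simp

lemma norm_inverse_fourier_integral_le:
  "norm (inverse_fourier_integral f \<xi>) \<le> (LINT x|lborel. norm (f x))"
proof -
  have "norm (inverse_fourier_integral f \<xi>) \<le> (LINT x|lborel. norm (cis (2 * pi * (\<xi> \<bullet> x)) * f x))"
    unfolding inverse_fourier_integral_def by (rule integral_norm_bound)
  then show ?thesis by (simp add: norm_mult)
qed

lemma inverse_fourier_integral_measurable: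
  assumes f: "f \<in> borel_measurable lborel"
  shows "inverse_fourier_integral f \<in> borel_measurable borel"
proof -
  have [measurable]: "f \<in> borel_measurable borel" using f by simp
  show ?thesis unfolding inverse_fourier_integral_def by measurable
qed

text \<open>Some coordinate of \<xi> has size at least |\<xi>| / d, and n derivatives in that
  direction produce |\<xi>|^n up to a constant. The sum over all directions removes the dependence
  of this choice on \<xi>.\<close>

lemma schwartz_inverse_fourier_decay:
  fixes \<phi> :: "'a::euclidean_space \<Rightarrow> complex"
  assumes \<phi>: "schwartz \<phi>"
  shows "\<exists>C. \<forall>\<xi>. norm \<xi> ^ n * norm (inverse_fourier_integral \<phi> \<xi>) \<le> C"
proof -
  define L where "L = (\<lambda>h. LINT x|lborel. norm (iterated_derivative (replicate n h) \<phi> x))"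
  define d where "d = real DIM('a)"
  have L0: "0 \<le> L h" for h unfolding L_def by (intro integral_nonneg_AE) auto
  have "norm \<xi> ^ n * norm (inverse_fourier_integral \<phi> \<xi>) \<le> d ^ n * (\<Sum>h\<in>Basis. L h)" for \<xi>
  proof -
    have "\<exists>h\<in>Basis. norm \<xi> \<le> d * \<bar>h \<bullet> \<xi>\<bar>"
    proof (rule ccontr)
      assume "\<not> ?thesis"
      then have lt: "\<bar>h \<bullet> \<xi>\<bar> < norm \<xi> / d" if "h \<in> Basis" for h
        using that unfolding d_def by (auto simp: field_simps DIM_positive)
      have "norm \<xi> \<le> (\<Sum>h\<in>Basis. \<bar>\<xi> \<bullet> h\<bar>)" by (rule norm_le_l1)
      also have "\<dots> < (\<Sum>h\<in>(Basis::'a set). norm \<xi> / d)"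
        using lt by (intro sum_strict_mono) (auto simp: inner_commute)
      also have "\<dots> = norm \<xi>" unfolding d_def by simp
      finally show False by simp
    qed
    then obtain h where h: "h \<in> Basis" "norm \<xi> \<le> d * \<bar>h \<bullet> \<xi>\<bar>" by blast
    have "norm \<xi> ^ n \<le> d ^ n * \<bar>h \<bullet> \<xi>\<bar> ^ n"
      using h by (subst power_mult_distrib[symmetric]) (intro power_mono, auto)
    also have "\<dots> \<le> d ^ n * (2 * pi * \<bar>h \<bullet> \<xi>\<bar>) ^ n"
    proof (intro mult_left_mono power_mono)
      have "1 * \<bar>h \<bullet> \<xi>\<bar> \<le> (2 * pi) * \<bar>h \<bullet> \<xi>\<bar>" using pi_ge_two by (intro mult_right_mono) auto
      then show "\<bar>h \<bullet> \<xi>\<bar> \<le> 2 * pi * \<bar>h \<bullet> \<xi>\<bar>" by simp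
    qed (auto simp: d_def)
    finally have "norm \<xi> ^ n * norm (inverse_fourier_integral \<phi> \<xi>) \<le> d ^ n * (2 * pi * \<bar>h \<bullet> \<xi>\<bar>) ^ n * norm (inverse_fourier_integral \<phi> \<xi>)"
      by (intro mult_right_mono) auto
    also have "\<dots> = d ^ n * norm (inverse_fourier_integral (iterated_derivative (replicate n h) \<phi>) \<xi>)"
      unfolding inverse_fourier_integral_iterated[OF \<phi> h(1)] by (simp add: norm_mult norm_power)
    also have "\<dots> \<le> d ^ n * L h" unfolding L_def
      by (intro mult_left_mono norm_inverse_fourier_integral_le) (auto simp: d_def)
    also have "\<dots> \<le> d ^ n * (\<Sum>h\<in>Basis. L h)"
      using h L0 by (intro mult_left_mono member_le_sum) (auto simp: d_def)
    finally show ?thesis .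
  qed
  then show ?thesis by blast
qed

text \<open>Boundedness of g handles the singularity at 0, and decay of order d + 1 handles
  infinity. This lets Schwartz functions and their transforms be paired with singular powers of the
  norm.\<close>

lemma integrable_powr_mult_of_decay:
  fixes g :: "'a::euclidean_space \<Rightarrow> complex"
  assumes g: "g \<in> borel_measurable borel"
    and decay: "\<And>n. \<exists>C. \<forall>x. norm x ^ n * norm (g x) \<le> C"
    and a: "0 \<le> a" "a < real DIM('a)"
  shows "integrable lborel (\<lambda>x. norm x powr (- a) * norm (g x))"
proof -
  obtain A where A: "\<And>x. norm (g x) \<le> A" using decay[of 0] by auto
  obtain B where B: "\<And>x. norm x ^ (DIM('a) + 1) * norm (g x) \<le> B" using decay by blast
  have "A \<ge> 0" "B \<ge> 0" using order_trans[OF norm_ge_zero A[of 0]] order_trans[OF _ B[of 0]] by auto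
  show ?thesis
  proof (rule integrable_norm_powr_bounds[where a = a and b = "real DIM('a) + 1 + a" and C = "A + B"])
    show "(\<lambda>x. norm x powr (- a) * norm (g x)) \<in> borel_measurable lborel" using g by measurable
    fix x :: 'a assume x: "x \<noteq> 0"
    have "norm x powr (- a) * norm (g x) \<le> norm x powr (- a) * (A + B)"
      using A[of x] \<open>B \<ge> 0\<close> by (intro mult_left_mono) auto
    then show "norm (norm x powr (- a) * norm (g x)) \<le> (A + B) * norm x powr (- a)"
      by (simp add: mult.commute)
    have "norm x powr (real DIM('a) + 1) = norm x ^ (DIM('a) + 1)"
      using x powr_realpow[of "norm x" "DIM('a) + 1"] by (simp add: add.commute)
    then have "norm x powr (real DIM('a) + 1) * norm (g x) \<le> A + B" using B[of x] \<open>A \<ge> 0\<close> by simp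
    then have "norm x powr (- (real DIM('a) + 1 + a)) * (norm x powr (real DIM('a) + 1) * norm (g x)) \<le> norm x powr (- (real DIM('a) + 1 + a)) * (A + B)"
      by (intro mult_left_mono) auto
    moreover have "norm x powr (- (real DIM('a) + 1 + a)) * (norm x powr (real DIM('a) + 1) * norm (g x)) = norm x powr (- a) * norm (g x)"
      using x by (simp add: mult.assoc[symmetric] powr_add[symmetric])
    ultimately have "norm x powr (- a) * norm (g x) \<le> norm x powr (- (real DIM('a) + 1 + a)) * (A + B)"
      by (simp only:)
    then show "norm (norm x powr (- a) * norm (g x)) \<le> (A + B) * norm x powr (- (real DIM('a) + 1 + a))"
      by (simp add: mult.commute)
  qed (use a in auto)
qed

lemma schwartz_decay:
  assumes "schwartz \<phi>"
  shows "\<exists>C. \<forall>x. norm x ^ n * norm (\<phi> x) \<le> C"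
proof -
  have "bounded (range (\<lambda>x. norm x ^ n *\<^sub>R iterated_derivative [] \<phi> x))"
    using assms unfolding schwartz_def by (metis empty_set empty_subsetI)
  then show ?thesis unfolding bounded_iff by auto
qed

section \<open>Gaussians as Schwartz functions\<close>

lemma real_polynomial_function_derivative:
  assumes "real_polynomial_function p"
  shows "\<exists>p'. real_polynomial_function p' \<and> (\<forall>x. \<exists>D. (p has_derivative D) (at x) \<and> D h = p' x)"
  using assms
proof (induction rule: real_polynomial_function.induct)
  case (linear f)
  then show ?case
    by (intro exI[of _ "\<lambda>_. f h"] conjI allI exI[of _ f]) (auto intro: bounded_linear_imp_has_derivative)
next
  case (const c)
  show ?case by (intro exI[of _ "\<lambda>_. 0"] conjI allI exI[of _ "\<lambda>_. 0"]) auto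
next
  case (add f g)
  then obtain f' g' where f': "real_polynomial_function f'" "\<And>x. \<exists>D. (f has_derivative D) (at x) \<and> D h = f' x"
    and g': "real_polynomial_function g'" "\<And>x. \<exists>D. (g has_derivative D) (at x) \<and> D h = g' x" by blast
  have "\<exists>D. ((\<lambda>x. f x + g x) has_derivative D) (at x) \<and> D h = f' x + g' x" for x
  proof -
    obtain D E where "(f has_derivative D) (at x)" "D h = f' x" "(g has_derivative E) (at x)" "E h = g' x"
      using f'(2)[of x] g'(2)[of x] by blast
    then show ?thesis by (intro exI[of _ "\<lambda>u. D u + E u"]) (auto intro: has_derivative_add)
  qed
  then show ?case using f'(1) g'(1) by (intro exI[of _ "\<lambda>x. f' x + g' x"]) auto
next
  case (mult f g)
  then obtain f' g' where f': "real_polynomial_function f'" "\<And>x. \<exists>D. (f has_derivative D) (at x) \<and> D h = f' x"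
    and g': "real_polynomial_function g'" "\<And>x. \<exists>D. (g has_derivative D) (at x) \<and> D h = g' x" by blast
  have "\<exists>D. ((\<lambda>x. f x * g x) has_derivative D) (at x) \<and> D h = f x * g' x + f' x * g x" for x
  proof -
    obtain D E where "(f has_derivative D) (at x)" "D h = f' x" "(g has_derivative E) (at x)" "E h = g' x"
      using f'(2)[of x] g'(2)[of x] by blast
    then show ?thesis by (intro exI[of _ "\<lambda>u. f x * E u + D u * g x"]) (auto intro: has_derivative_mult)
  qed
  then show ?case using f'(1) g'(1) mult.hyps by (intro exI[of _ "\<lambda>x. f x * g' x + f' x * g x"]) auto
qed

lemma real_polynomial_function_growth:
  assumes "real_polynomial_function p"
  shows "\<exists>C n. 0 \<le> C \<and> (\<forall>x. \<bar>p x\<bar> \<le> C * (1 + norm x) ^ n)"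
  using assms
proof (induction rule: real_polynomial_function.induct)
  case (linear f)
  then obtain K where K: "K > 0" "\<And>x. norm (f x) \<le> norm x * K" using bounded_linear.pos_bounded by blast
  have "\<bar>f x\<bar> \<le> K * (1 + norm x) ^ 1" for x
    using K(2)[of x] K(1) by (simp add: algebra_simps)
  then show ?case using K(1) less_imp_le by blast
next
  case (const c)
  have "\<bar>c\<bar> \<le> \<bar>c\<bar> * (1 + norm x) ^ 0" for x :: 'a by simp
  then show ?case using abs_ge_zero by blast
next
  case (add f g)
  then obtain C n E m where *: "0 \<le> C" "\<And>x. \<bar>f x\<bar> \<le> C * (1 + norm x) ^ n" "0 \<le> E" "\<And>x. \<bar>g x\<bar> \<le> E * (1 + norm x) ^ m" by blast
  have "\<bar>f x + g x\<bar> \<le> (C + E) * (1 + norm x) ^ (n + m)" for x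
  proof -
    have "(1 + norm x) ^ n \<le> (1 + norm x) ^ (n + m)" "(1 + norm x) ^ m \<le> (1 + norm x) ^ (n + m)"
      by (intro power_increasing; simp)+
    then have "C * (1 + norm x) ^ n \<le> C * (1 + norm x) ^ (n + m)" "E * (1 + norm x) ^ m \<le> E * (1 + norm x) ^ (n + m)"
      using * by (auto intro: mult_left_mono)
    then show ?thesis using *(2)[of x] *(4)[of x] by (simp add: distrib_right)
  qed
  then show ?case using *(1,3) add_nonneg_nonneg by blast
next
  case (mult f g)
  then obtain C n E m where *: "0 \<le> C" "\<And>x. \<bar>f x\<bar> \<le> C * (1 + norm x) ^ n" "0 \<le> E" "\<And>x. \<bar>g x\<bar> \<le> E * (1 + norm x) ^ m" by blast
  have "\<bar>f x * g x\<bar> \<le> (C * E) * (1 + norm x) ^ (n + m)" for x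
  proof -
    have "\<bar>f x * g x\<bar> \<le> (C * (1 + norm x) ^ n) * (E * (1 + norm x) ^ m)"
      unfolding abs_mult using * by (intro mult_mono) (auto intro!: mult_nonneg_nonneg)
    then show ?thesis by (simp add: power_add mult_ac)
  qed
  then show ?case using *(1,3) mult_nonneg_nonneg by blast
qed

text \<open>Polynomials times a fixed Gaussian form a class closed under directional derivatives, so
  one growth bound for this class covers all iterated derivatives.\<close>

lemma schwartz_gaussian:
  fixes a :: "'a::euclidean_space"
  assumes c: "c > 0"
  shows "schwartz (\<lambda>x. complex_of_real (exp (- c * (norm (x - a))\<^sup>2)))"
proof -
  define E where "E = (\<lambda>x. exp (- c * ((x - a) \<bullet> (x - a))))"
  define G where "G = (\<lambda>p x. complex_of_real (p x * E x))"
  have dG: "\<exists>q. real_polynomial_function q \<and> (\<forall>x. \<exists>D. (G p has_derivative D) (at x) \<and> D h = G q x)"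
    if p: "real_polynomial_function p" for p and h :: 'a
  proof -
    obtain p' where p': "real_polynomial_function p'" "\<And>x. \<exists>D. (p has_derivative D) (at x) \<and> D h = p' x"
      using real_polynomial_function_derivative[OF p] by blast
    define q where "q = (\<lambda>x. p' x + p x * (- 2 * c * (x \<bullet> h + (- (a \<bullet> h)))))"
    have "bounded_linear (\<lambda>x. x \<bullet> h)" by (rule bounded_linear_inner_left)
    then have "real_polynomial_function q" unfolding q_def
      by (intro real_polynomial_function.intros(2,3,4) p p'(1) real_polynomial_function.intros(1))
    moreover have "\<exists>D. (G p has_derivative D) (at x) \<and> D h = G q x" for x
    proof -
      obtain D where D: "(p has_derivative D) (at x)" "D h = p' x" using p'(2) by blast
      have 1: "(E has_derivative (\<lambda>u. E x * (- c * (2 * ((x - a) \<bullet> u))))) (at x)"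
        unfolding E_def by (auto intro!: derivative_eq_intros simp: inner_commute algebra_simps)
      have "((\<lambda>x. p x * E x) has_derivative (\<lambda>u. p x * (E x * (- c * (2 * ((x - a) \<bullet> u)))) + D u * E x)) (at x)"
        by (rule has_derivative_mult[OF D(1) 1])
      then have "(G p has_derivative (\<lambda>u. complex_of_real (p x * (E x * (- c * (2 * ((x - a) \<bullet> u)))) + D u * E x))) (at x)"
        unfolding G_def by (rule has_derivative_of_real)
      moreover have "p x * (E x * (- c * (2 * ((x - a) \<bullet> h)))) + D h * E x = q x * E x"
        unfolding q_def D(2) by (simp add: inner_diff_left algebra_simps)
      ultimately show ?thesis unfolding G_def by fastforce
    qed
    ultimately show ?thesis by blast
  qed
  have G1: "(\<lambda>x. complex_of_real (exp (- c * (norm (x - a))\<^sup>2))) = G (\<lambda>_. 1)"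
    unfolding G_def E_def power2_norm_eq_inner by simp
  have iter: "\<exists>p. real_polynomial_function p \<and> iterated_derivative hs (G (\<lambda>_. 1)) = G p" for hs
  proof (induction hs)
    case Nil
    then show ?case by auto
  next
    case (Cons h hs)
    then obtain p where p: "real_polynomial_function p" "iterated_derivative hs (G (\<lambda>_. 1)) = G p" by blast
    obtain q where q: "real_polynomial_function q" "\<And>x. \<exists>D. (G p has_derivative D) (at x) \<and> D h = G q x"
      using dG[OF p(1)] by blast
    have "frechet_derivative (G p) (at x) h = G q x" for x
    proof -
      obtain D where "(G p has_derivative D) (at x)" "D h = G q x" using q(2) by blast
      then show ?thesis using frechet_derivative_at by metis
    qed
    then have "iterated_derivative (h # hs) (G (\<lambda>_. 1)) = G q" using p(2) by auto
    then show ?case using q(1) by blast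
  qed
  have bnd: "bounded (range (\<lambda>x. norm x ^ k *\<^sub>R G p x))" if p: "real_polynomial_function p" for p k
  proof -
    obtain C n where C: "0 \<le> C" "\<And>x. \<bar>p x\<bar> \<le> C * (1 + norm x) ^ n"
      using real_polynomial_function_growth[OF p] by blast
    define N where "N = k + n"
    \<comment> \<open>With u the distance to the centre, the polynomial part is at most
      \<open>C * fact N\<close> times exp(1 + |a| + u), and completing the square gives u - c u^2
      \<le> 1 / (4 c).\<close>
    have "norm (norm x ^ k *\<^sub>R G p x) \<le> C * (fact N * exp (1 + norm a) * exp (1 / (4 * c)))" for x
    proof -
      define u where "u = norm (x - a)"
      have u0: "u \<ge> 0" unfolding u_def by simp
      have xu: "norm x \<le> norm a + u" unfolding u_def by (metis norm_triangle_sub add.commute)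
      have Eu: "E x = exp (- c * u\<^sup>2)" unfolding E_def u_def power2_norm_eq_inner ..
      have "norm x ^ k * \<bar>p x\<bar> \<le> (1 + norm x) ^ k * (C * (1 + norm x) ^ n)"
        by (intro mult_mono power_mono C) auto
      also have "\<dots> = C * (1 + norm x) ^ N" unfolding N_def by (simp add: power_add)
      also have "\<dots> \<le> C * (1 + norm a + u) ^ N" using xu C by (intro mult_left_mono power_mono) auto
      also have "\<dots> \<le> C * (fact N * exp (1 + norm a + u))"
        using u0 C by (intro mult_left_mono power_le_fact_mult_exp) auto
      finally have "norm x ^ k * \<bar>p x\<bar> * E x \<le> C * (fact N * exp (1 + norm a + u)) * E x"
        by (intro mult_right_mono) (auto simp: E_def)
      also have "\<dots> = C * (fact N * exp (1 + norm a) * exp (u - c * u\<^sup>2))"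
        unfolding Eu by (simp add: exp_add exp_diff exp_minus divide_inverse)
      also have "\<dots> \<le> C * (fact N * exp (1 + norm a) * exp (1 / (4 * c)))"
      proof -
        have "0 \<le> c * (u - 1 / (2 * c))\<^sup>2" using c by simp
        also have "\<dots> = c * u\<^sup>2 - u + 1 / (4 * c)" using c by (simp add: power2_eq_square field_simps)
        finally have "u - c * u\<^sup>2 \<le> 1 / (4 * c)" by simp
        then show ?thesis using C by (intro mult_left_mono) auto
      qed
      finally show ?thesis unfolding G_def using C by (simp add: abs_mult E_def norm_mult mult.assoc)
    qed
    then show ?thesis unfolding bounded_iff by blast
  qed
  show ?thesis unfolding schwartz_def G1
  proof (intro allI impI conjI)
    fix hs x
    obtain p where p: "real_polynomial_function p" "iterated_derivative hs (G (\<lambda>_. 1)) = G p" using iter by blast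
    show "iterated_derivative hs (G (\<lambda>_. 1)) differentiable (at x)"
      using dG[OF p(1), of 0] unfolding p(2) differentiable_def by blast
  next
    fix hs and k :: nat
    obtain p where p: "real_polynomial_function p" "iterated_derivative hs (G (\<lambda>_. 1)) = G p" using iter by blast
    show "bounded (range (\<lambda>x. norm x ^ k *\<^sub>R iterated_derivative hs (G (\<lambda>_. 1)) x))"
      unfolding p(2) by (rule bnd[OF p(1)])
  qed
qed

section \<open>Separating functions by their pairings with Gaussians\<close>

lemma lborel_integral_affine:
  fixes f :: "'a::euclidean_space \<Rightarrow> 'b::{banach, second_countable_topology}"
  assumes "f \<in> borel_measurable borel" "c \<noteq> 0"
  shows "(LINT y|lborel. f y) = \<bar>c\<bar> ^ DIM('a) *\<^sub>R (LINT x|lborel. f (t + c *\<^sub>R x))"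
proof -
  have [measurable]: "f \<in> borel_measurable borel" by fact
  have "(LINT y|lborel. f y) = (LINT y|density (distr lborel borel (\<lambda>x. t + c *\<^sub>R x)) (\<lambda>_. ennreal (\<bar>c\<bar> ^ DIM('a))). f y)"
    by (subst lborel_affine[OF assms(2), of t]) (simp add: ennreal_power)
  also have "\<dots> = \<bar>c\<bar> ^ DIM('a) *\<^sub>R (LINT x|lborel. f (t + c *\<^sub>R x))"
    by (subst integral_density) (auto simp: integral_distr)
  finally show ?thesis .
qed

text \<open>Boxes are an intersection-stable generator of the Borel sets, so vanishing spreads to
  all measurable sets by Dynkin induction. The complement step requires the total integral to
  vanish, which follows by exhausting the space with boxes.\<close>

lemma AE_zero_of_box_integrals:
  fixes f :: "'a::euclidean_space \<Rightarrow> complex"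
  assumes int: "integrable lborel f"
    and box: "\<And>l u. (LINT x|lborel. indicator (box l u) x *\<^sub>R f x) = 0"
  shows "AE x in lborel. f x = 0"
proof (rule sigma_finite_measure.density_zero[OF sigma_finite_lborel int])
  fix A :: "'a set" assume "A \<in> sets lborel"
  let ?G = "range (\<lambda>(a, b). box a b :: 'a set)"
  have A: "A \<in> sigma_sets UNIV ?G" using \<open>A \<in> sets lborel\<close> by (simp add: borel_eq_box)
  have meas: "B \<in> sets lborel" if "B \<in> sigma_sets UNIV ?G" for B using that by (simp add: borel_eq_box)
  have [measurable]: "f \<in> borel_measurable lborel" using int by simp
  have total: "(LINT x|lborel. f x) = 0"
  proof -
    let ?B = "\<lambda>n. box (- (real n *\<^sub>R One)) (real n *\<^sub>R One) :: 'a set"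
    have "(\<lambda>n. LINT x|lborel. indicator (?B n) x *\<^sub>R f x) \<longlonglongrightarrow> (LINT x|lborel. f x)"
    proof (rule integral_dominated_convergence[where w = "\<lambda>x. norm (f x)"])
      show "AE x in lborel. (\<lambda>n. indicator (?B n) x *\<^sub>R f x) \<longlonglongrightarrow> f x"
      proof (rule AE_I2, rule tendsto_eventually)
        fix x :: 'a
        obtain N where N: "real N > norm x" using reals_Archimedean2 by blast
        have "x \<in> ?B n" if "n \<ge> N" for n
        proof -
          have "norm x < real n" using N that by linarith
          then have "- real n < x \<bullet> i \<and> x \<bullet> i < real n" if "i \<in> Basis" for i
            using Basis_le_norm[OF that, of x] by linarith
          then show ?thesis by (auto simp: mem_box)
        qed
        then show "\<forall>\<^sub>F n in sequentially. indicator (?B n) x *\<^sub>R f x = f x"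
          unfolding eventually_sequentially by (intro exI[of _ N]) auto
      qed
      show "AE x in lborel. norm (indicator (?B n) x *\<^sub>R f x) \<le> norm (f x)" for n
        by (rule AE_I2) (auto simp: indicator_def)
      show "integrable lborel (\<lambda>x. norm (f x))" using int by (rule integrable_norm)
    qed measurable
    then show ?thesis unfolding box using LIMSEQ_unique tendsto_const by blast
  qed
  have stable: "Int_stable ?G" by (auto simp: Int_stable_def box_Int_box)
  have "?G \<subseteq> Pow UNIV" by simp
  from stable this A show "set_lebesgue_integral lborel A f = 0"
  proof (induction A rule: sigma_sets_induct_disjoint)
    case (basic B)
    then show ?case using box by (auto simp: set_lebesgue_integral_def)
  next
    case (compl B)
    have "set_integrable lborel B f" "set_integrable lborel (UNIV - B) f"
      using meas[OF compl(1)] int unfolding set_integrable_def by (auto intro!: integrable_mult_indicator)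
    then have "set_lebesgue_integral lborel (B \<union> (UNIV - B)) f = set_lebesgue_integral lborel B f + set_lebesgue_integral lborel (UNIV - B) f"
      by (intro set_integral_Un) auto
    then show ?case using compl(2) total by (simp add: set_lebesgue_integral_def)
  next
    case (union B)
    have "set_lebesgue_integral lborel (\<Union>i. B i) f = (\<Sum>i. set_lebesgue_integral lborel (B i) f)"
    proof (rule lebesgue_integral_countable_add)
      show "B i \<in> sets lborel" for i using union(2) by (intro meas) auto
      then show "set_integrable lborel (\<Union>i. B i) f"
        unfolding set_integrable_def using int by (intro integrable_mult_indicator) auto
      show "i \<noteq> j \<Longrightarrow> B i \<inter> B j = {}" for i j using union(1) unfolding disjoint_family_on_def by auto
    qed
    then show ?case using union(3) by simp
  qed (auto simp: set_lebesgue_integral_def)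
qed

text \<open>Normalised so that \<open>gauss 1\<close> has integral 1 and is its own Fourier
  transform.\<close>

definition gauss :: "real \<Rightarrow> 'a::euclidean_space \<Rightarrow> real" where
  "gauss \<kappa> x = exp (- pi * \<kappa> * (norm x)\<^sup>2)"

lemma gauss_measurable[measurable]: "gauss \<kappa> \<in> borel_measurable borel"
  unfolding gauss_def by measurable

lemma gauss_pos: "0 < gauss \<kappa> x" unfolding gauss_def by simp

lemma gauss_integral:
  assumes "\<kappa> > 0"
  shows "integrable lborel (gauss \<kappa> :: 'a::euclidean_space \<Rightarrow> real)"
    and "(LINT x|(lborel::'a measure). gauss \<kappa> x) = \<kappa> powr (- real DIM('a) / 2)"
proof -
  have c: "integrable lborel (\<lambda>x::'a. complex_of_real (gauss \<kappa> x))"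
    using gaussian_fourier(1)[OF assms, of "0::'a"] unfolding gauss_def by simp
  show i: "integrable lborel (gauss \<kappa> :: 'a \<Rightarrow> real)" using integrable_Re[OF c] by simp
  have "complex_of_real (LINT x|(lborel::'a measure). gauss \<kappa> x) = of_real (\<kappa> powr (- real DIM('a) / 2))"
    using gaussian_fourier(2)[OF assms, of "0::'a"] unfolding integral_complex_of_real[symmetric] gauss_def by simp
  then show "(LINT x|(lborel::'a measure). gauss \<kappa> x) = \<kappa> powr (- real DIM('a) / 2)"
    by (simp only: of_real_eq_iff)
qed

text \<open>\<open>W\<close> is tested with Gaussians only. They are bounded below on a box, which
  makes \<open>W\<close> locally integrable; and averages of their translates over the box
  approximate its indicator, while every single translate pairs to 0.\<close>

lemma schwartz_pairing_box:
  fixes W :: "'a::euclidean_space \<Rightarrow> complex"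
  assumes W: "W \<in> borel_measurable borel"
    and pair: "\<And>\<phi>. schwartz \<phi> \<Longrightarrow> integrable lborel (\<lambda>x. W x * \<phi> x) \<and> (LINT x|lborel. W x * \<phi> x) = 0"
  shows "integrable lborel (\<lambda>x. indicator (box l u) x *\<^sub>R W x)"
    and "(LINT x|lborel. indicator (box l u) x *\<^sub>R W x) = 0"
proof -
  have [measurable]: "W \<in> borel_measurable borel" by fact
  let ?B = "box l u"
  obtain R where R: "R > 0" "\<And>y. y \<in> ?B \<Longrightarrow> norm y \<le> R"
    using bounded_box[of l u] unfolding bounded_pos by auto
  have gw: "integrable lborel (\<lambda>x. W x * of_real (exp (- c * (norm (x - a))\<^sup>2)))"
    "(LINT x|lborel. W x * of_real (exp (- c * (norm (x - a))\<^sup>2))) = 0" if "c > 0" for c and a :: 'a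
    using pair[OF schwartz_gaussian[OF that, of a]] by auto
  have gwn: "integrable lborel (\<lambda>x. norm (W x) * exp (- c * (norm x)\<^sup>2))" if "c > 0" for c
    using integrable_norm[OF gw(1)[OF that, of 0]] by (simp add: norm_mult)
  show intB: "integrable lborel (\<lambda>x. indicator ?B x *\<^sub>R W x)"
  proof (rule Bochner_Integration.integrable_bound)
    show "integrable lborel (\<lambda>x. exp (R\<^sup>2) * (norm (W x) * exp (- 1 * (norm x)\<^sup>2)))"
      by (intro integrable_mult_right gwn) auto
    have "norm (indicator ?B x *\<^sub>R W x) \<le> exp (R\<^sup>2) * (norm (W x) * exp (- 1 * (norm x)\<^sup>2))" for x
    proof (cases "x \<in> ?B")
      case True
      then have "(norm x)\<^sup>2 \<le> R\<^sup>2" using R by (intro power_mono) auto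
      then have "1 \<le> exp (R\<^sup>2) * exp (- 1 * (norm x)\<^sup>2)" by (simp add: mult_exp_exp)
      then have "norm (W x) * 1 \<le> norm (W x) * (exp (R\<^sup>2) * exp (- 1 * (norm x)\<^sup>2))" by (intro mult_left_mono) auto
      then show ?thesis using True by (simp add: mult_ac)
    qed auto
    then show "AE x in lborel. norm (indicator ?B x *\<^sub>R W x) \<le> norm (exp (R\<^sup>2) * (norm (W x) * exp (- 1 * (norm x)\<^sup>2)))"
      by (intro AE_I2) (simp add: abs_mult)
  qed measurable
  \<comment> \<open>The mollified indicator \<open>h n\<close> is an average of translated Gaussians with centres in the box.\<close>
  define h where "h = (\<lambda>n x. LINT z|lborel. indicator ?B (x + (1 / real (Suc n)) *\<^sub>R z) * gauss 1 z)"
  have hW: "(LINT x|lborel. W x * of_real (h n x)) = 0" for n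
  proof -
    define k where "k = real (Suc n)"
    have k: "k \<ge> 1" unfolding k_def by simp
    define c where "c = pi * k\<^sup>2"
    have c: "c > 0" using k unfolding c_def by auto
    let ?F = "\<lambda>x y. indicator ?B y * exp (- c * (norm (x - y))\<^sup>2)"
    have hF: "h n x = k ^ DIM('a) * (LINT y|lborel. ?F x y)" for x
    proof -
      have "(LINT y|lborel. ?F x y) = \<bar>1 / k\<bar> ^ DIM('a) *\<^sub>R (LINT z|lborel. ?F x (x + (1 / k) *\<^sub>R z))"
        by (rule lborel_integral_affine) (use k in auto)
      also have "(LINT z|lborel. ?F x (x + (1 / k) *\<^sub>R z)) = h n x"
        unfolding h_def gauss_def k_def[symmetric] c_def using k by (simp add: power_divide)
      finally show ?thesis using k by (simp add: power_divide)
    qed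
    define f where "f = (\<lambda>y x. of_real (?F x y) * W x)"
    have meas: "case_prod f \<in> borel_measurable (lborel \<Otimes>\<^sub>M lborel)" unfolding f_def by measurable
    have swap: "(LINT x|lborel. LINT y|lborel. f y x) = (LINT y|lborel. LINT x|lborel. f y x)"
    proof (rule lborel_Fubini(2)[OF meas])
      show "AE y in lborel. integrable lborel (f y)"
      proof (rule AE_I2)
        fix y
        have "integrable lborel (\<lambda>x. of_real (indicator ?B y) * (W x * of_real (exp (- c * (norm (x - y))\<^sup>2))))"
          by (intro integrable_mult_right gw c)
        then show "integrable lborel (f y)" unfolding f_def by (simp add: mult_ac)
      qed
      \<comment> \<open>For centres y in the box, |x|^2 \<le> 2 |x - y|^2 + 2 R^2, so all the
        translates lie below exp(c R^2) times the centred Gaussian of half the rate.\<close>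
      define L where "L = exp (c * R\<^sup>2) * (LINT x|lborel. norm (W x) * exp (- (c / 2) * (norm x)\<^sup>2))"
      have inner: "(LINT x|lborel. norm (f y x)) \<le> indicator ?B y * L" for y
      proof (cases "y \<in> ?B")
        case True
        have i2: "integrable lborel (\<lambda>x. exp (c * R\<^sup>2) * (norm (W x) * exp (- (c / 2) * (norm x)\<^sup>2)))"
          using c by (intro integrable_mult_right gwn) auto
        have le: "norm (f y x) \<le> exp (c * R\<^sup>2) * (norm (W x) * exp (- (c / 2) * (norm x)\<^sup>2))" for x
        proof -
          have "(norm x)\<^sup>2 \<le> (norm (x - y) + norm y)\<^sup>2"
            by (intro power_mono) (metis norm_triangle_sub add.commute, auto)
          also have "\<dots> \<le> 2 * (norm (x - y))\<^sup>2 + 2 * (norm y)\<^sup>2"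
            using sum_squares_bound[of "norm (x - y)" "norm y"] by (simp add: power2_sum)
          also have "(norm y)\<^sup>2 \<le> R\<^sup>2" using R(2)[OF True] by (intro power_mono) auto
          finally have "(norm x)\<^sup>2 / 2 - R\<^sup>2 \<le> (norm (x - y))\<^sup>2" by simp
          then have "c * ((norm x)\<^sup>2 / 2 - R\<^sup>2) \<le> c * (norm (x - y))\<^sup>2" using c by (intro mult_left_mono) auto
          then have "exp (- c * (norm (x - y))\<^sup>2) \<le> exp (c * R\<^sup>2) * exp (- (c / 2) * (norm x)\<^sup>2)"
            by (simp add: mult_exp_exp algebra_simps)
          then have "exp (- c * (norm (x - y))\<^sup>2) * norm (W x) \<le> exp (c * R\<^sup>2) * exp (- (c / 2) * (norm x)\<^sup>2) * norm (W x)"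
            by (intro mult_right_mono) auto
          then show ?thesis using True unfolding f_def by (simp add: norm_mult mult_ac)
        qed
        have "integrable lborel (f y)"
        proof -
          have "integrable lborel (\<lambda>x. of_real (indicator ?B y) * (W x * of_real (exp (- c * (norm (x - y))\<^sup>2))))"
            by (intro integrable_mult_right gw c)
          then show ?thesis unfolding f_def by (simp add: mult_ac)
        qed
        then have "(LINT x|lborel. norm (f y x)) \<le> (LINT x|lborel. exp (c * R\<^sup>2) * (norm (W x) * exp (- (c / 2) * (norm x)\<^sup>2)))"
          by (intro integral_mono_AE i2 integrable_norm AE_I2 le)
        then show ?thesis using True unfolding L_def by simp
      qed (simp add: f_def)
      show "integrable lborel (\<lambda>y. LINT x|lborel. norm (f y x))"
      proof (rule Bochner_Integration.integrable_bound)
        show "integrable lborel (\<lambda>y. indicator ?B y * L)"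
          by (intro integrable_mult_left) (auto simp: emeasure_lborel_box_eq)
        show "(\<lambda>y. LINT x|lborel. norm (f y x)) \<in> borel_measurable lborel" using meas by measurable
        have "0 \<le> (LINT x|lborel. norm (f y x))" for y by (intro integral_nonneg_AE) auto
        then show "AE y in lborel. norm (LINT x|lborel. norm (f y x)) \<le> norm (indicator ?B y * L)"
          using inner by (intro AE_I2) (smt (verit) real_norm_def)
      qed
    qed
    have "(LINT x|lborel. f y x) = of_real (indicator ?B y) * (LINT x|lborel. W x * of_real (exp (- c * (norm (x - y))\<^sup>2)))" for y
      unfolding f_def integral_mult_right_zero[symmetric] by (simp add: mult_ac)
    then have "(LINT y|lborel. LINT x|lborel. f y x) = 0" using gw(2)[OF c] by simp
    moreover have "W x * of_real (h n x) = of_real (k ^ DIM('a)) * (LINT y|lborel. f y x)" for x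
    proof -
      have "(LINT y|lborel. f y x) = of_real (LINT y|lborel. ?F x y) * W x"
        unfolding f_def integral_mult_left_zero integral_complex_of_real ..
      then show ?thesis unfolding hF by simp
    qed
    ultimately show ?thesis using swap by simp
  qed
  \<comment> \<open>A majorant uniform in n. If x + z / (n + 1) lies in the box then |x| \<le> R +
    |z|, hence |x|^2 / 4 \<le> R^2 / 2 + |z|^2 / 2. The term |z|^2 / 2 is paid out of pi |z|^2,
    which leaves pi (1 - 1 / (2 pi)) in the exponent.\<close>
  have h_bound: "norm (h n x) \<le> exp (R\<^sup>2 / 2) * exp (- (1 / 4) * (norm x)\<^sup>2) * (LINT z|(lborel::'a measure). gauss (1 - 1 / (2 * pi)) z)" for n x
  proof -
    have \<kappa>: "0 < 1 - 1 / (2 * pi)" using pi_ge_two by (simp add: field_simps)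
    let ?S = "exp (R\<^sup>2 / 2) * exp (- (1 / 4) * (norm x)\<^sup>2)"
    have "norm (h n x) \<le> (LINT z|(lborel::'a measure). ?S * gauss (1 - 1 / (2 * pi)) z)"
      unfolding h_def
    proof (rule Bochner_Integration.integral_norm_bound_integral)
      show "integrable lborel (\<lambda>z::'a. ?S * gauss (1 - 1 / (2 * pi)) z)"
        by (intro integrable_mult_right gauss_integral \<kappa>)
      show "integrable lborel (\<lambda>z. indicator ?B (x + (1 / real (Suc n)) *\<^sub>R z) * gauss 1 z)"
      proof (rule Bochner_Integration.integrable_bound[OF gauss_integral(1)[of 1]])
        show "AE z in lborel. norm (indicator ?B (x + (1 / real (Suc n)) *\<^sub>R z) * gauss 1 z) \<le> norm (gauss 1 z)"
          by (intro AE_I2) (auto simp: indicator_def)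
      qed auto
      fix z :: 'a
      show "norm (indicator ?B (x + (1 / real (Suc n)) *\<^sub>R z) * gauss 1 z) \<le> ?S * gauss (1 - 1 / (2 * pi)) z"
      proof (cases "x + (1 / real (Suc n)) *\<^sub>R z \<in> ?B")
        case True
        let ?y = "(1 / real (Suc n)) *\<^sub>R z"
        have "norm ?y \<le> norm z" using mult_left_le_one_le[of "norm z" "1 / real (Suc n)"] by simp
        then have "norm x \<le> R + norm z"
          using R(2)[OF True] norm_triangle_ineq4[of "x + ?y" ?y] by simp
        then have "(norm x)\<^sup>2 \<le> (R + norm z)\<^sup>2" by (intro power_mono) auto
        also have "\<dots> \<le> 2 * R\<^sup>2 + 2 * (norm z)\<^sup>2"
          using sum_squares_bound[of R "norm z"] by (simp add: power2_sum)
        finally have "0 \<le> R\<^sup>2 / 2 + (norm z)\<^sup>2 / 2 - (norm x)\<^sup>2 / 4" by simp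
        then have "gauss 1 z * 1 \<le> gauss 1 z * exp (R\<^sup>2 / 2 + (norm z)\<^sup>2 / 2 - (norm x)\<^sup>2 / 4)"
          by (intro mult_left_mono) (auto simp: gauss_pos less_imp_le)
        also have "\<dots> = ?S * gauss (1 - 1 / (2 * pi)) z"
          unfolding gauss_def mult_exp_exp by (simp add: field_simps)
        finally show ?thesis using True gauss_pos[of 1 z] by simp
      qed (auto simp: gauss_pos less_imp_le)
    qed
    then show ?thesis by simp
  qed
  \<comment> \<open>On the faces of the box the averages need not tend to the value of the
    indicator; the boundary is excluded here and is a null set.\<close>
  have h_lim: "(\<lambda>n. h n x) \<longlonglongrightarrow> indicator ?B x" if x: "x \<notin> cbox l u - box l u" for x
  proof -
    have "(\<lambda>n. h n x) \<longlonglongrightarrow> (LINT z|(lborel::'a measure). indicator ?B x * gauss 1 z)"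
      unfolding h_def
    proof (rule integral_dominated_convergence[where w = "gauss 1"])
      show "integrable lborel (gauss 1 :: 'a \<Rightarrow> real)" by (rule gauss_integral) auto
      show "AE z in lborel. norm (indicator ?B (x + (1 / real (Suc n)) *\<^sub>R z) * gauss 1 z) \<le> gauss 1 z" for n
        by (intro AE_I2) (auto simp: indicator_def gauss_pos less_imp_le)
      show "AE z in lborel. (\<lambda>n. indicator ?B (x + (1 / real (Suc n)) *\<^sub>R z) * gauss 1 z) \<longlonglongrightarrow> indicator ?B x * gauss 1 z"
      proof (rule AE_I2, rule tendsto_mult_right, rule tendsto_eventually)
        fix z :: 'a
        have "(\<lambda>n. 1 / real (Suc n)) \<longlonglongrightarrow> 0" by real_asymp
        then have "(\<lambda>n. x + (1 / real (Suc n)) *\<^sub>R z) \<longlonglongrightarrow> x + 0 *\<^sub>R z" by (intro tendsto_intros)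
        then have lim: "(\<lambda>n. x + (1 / real (Suc n)) *\<^sub>R z) \<longlonglongrightarrow> x" by simp
        show "\<forall>\<^sub>F n in sequentially. indicator ?B (x + (1 / real (Suc n)) *\<^sub>R z) = indicat_real ?B x"
        proof (cases "x \<in> ?B")
          case True
          from topological_tendstoD[OF lim open_box True] show ?thesis by eventually_elim (simp add: True)
        next
          case False
          then have "x \<in> - cbox l u" using x by auto
          from topological_tendstoD[OF lim _ this] have "\<forall>\<^sub>F n in sequentially. x + (1 / real (Suc n)) *\<^sub>R z \<in> - cbox l u"
            by (simp add: closed_cbox open_Compl)
          then show ?thesis by eventually_elim (use False box_subset_cbox in \<open>auto simp: indicator_def\<close>)
        qed
      qed
    qed measurable
    then show ?thesis using gauss_integral(2)[of 1, where 'a = 'a] by simp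
  qed
  have "(\<lambda>n. LINT x|lborel. W x * of_real (h n x)) \<longlonglongrightarrow> (LINT x|lborel. W x * of_real (indicator ?B x))"
  proof (rule integral_dominated_convergence)
    let ?Z = "LINT z|(lborel::'a measure). gauss (1 - 1 / (2 * pi)) z"
    show "integrable lborel (\<lambda>x. exp (R\<^sup>2 / 2) * ?Z * (norm (W x) * exp (- (1 / 4) * (norm x)\<^sup>2)))"
      by (intro integrable_mult_right gwn) auto
    show "AE x in lborel. norm (W x * of_real (h n x)) \<le> exp (R\<^sup>2 / 2) * ?Z * (norm (W x) * exp (- (1 / 4) * (norm x)\<^sup>2))" for n
    proof (rule AE_I2)
      fix x
      have "norm (W x) * norm (h n x) \<le> norm (W x) * (exp (R\<^sup>2 / 2) * exp (- (1 / 4) * (norm x)\<^sup>2) * ?Z)"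
        by (intro mult_left_mono h_bound) auto
      then show "norm (W x * of_real (h n x)) \<le> exp (R\<^sup>2 / 2) * ?Z * (norm (W x) * exp (- (1 / 4) * (norm x)\<^sup>2))"
        by (simp add: norm_mult mult_ac)
    qed
    show "AE x in lborel. (\<lambda>n. W x * of_real (h n x)) \<longlonglongrightarrow> W x * of_real (indicator ?B x)"
      using AE_not_in[OF null_sets_cbox_Diff_box[of l u]]
      by eventually_elim (intro tendsto_intros h_lim)
    show "(\<lambda>x. W x * of_real (h n x)) \<in> borel_measurable lborel" for n unfolding h_def by measurable
  qed measurable
  then have "(LINT x|lborel. W x * of_real (indicator ?B x)) = 0"
    unfolding hW using LIMSEQ_unique tendsto_const by blast
  then show "(LINT x|lborel. indicator ?B x *\<^sub>R W x) = 0" by (simp add: scaleR_conv_of_real mult.commute)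
qed

text \<open>\<open>W\<close> is known to be integrable on boxes but not on the whole space, hence
  the truncation to growing boxes. Box integrals of a truncation are again box integrals of
  \<open>W\<close>, as two boxes meet in a box.\<close>

lemma schwartz_pairing_zero_imp_AE_zero:
  fixes W :: "'a::euclidean_space \<Rightarrow> complex"
  assumes W: "W \<in> borel_measurable borel"
    and pair: "\<And>\<phi>. schwartz \<phi> \<Longrightarrow> integrable lborel (\<lambda>x. W x * \<phi> x) \<and> (LINT x|lborel. W x * \<phi> x) = 0"
  shows "AE x in lborel. W x = 0"
proof -
  let ?B = "\<lambda>n::nat. box (- (real n *\<^sub>R One)) (real n *\<^sub>R One) :: 'a set"
  have "AE x in lborel. indicator (?B n) x *\<^sub>R W x = 0" for n
  proof (rule AE_zero_of_box_integrals)
    show "integrable lborel (\<lambda>x. indicator (?B n) x *\<^sub>R W x)" by (rule schwartz_pairing_box[OF assms])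
    fix l u :: 'a
    obtain a b where ab: "box l u \<inter> ?B n = box a b" by (auto simp: box_Int_box)
    have e: "indicator (box l u) x *\<^sub>R indicator (?B n) x *\<^sub>R W x = indicator (box a b) x *\<^sub>R W x" for x
      unfolding ab[symmetric] by (simp add: indicator_inter_arith)
    show "(LINT x|lborel. indicator (box l u) x *\<^sub>R indicator (?B n) x *\<^sub>R W x) = 0"
      unfolding e by (rule schwartz_pairing_box(2)[OF assms])
  qed
  then have "AE x in lborel. \<forall>n. indicator (?B n) x *\<^sub>R W x = 0" by (subst AE_all_countable) blast
  then show ?thesis
  proof eventually_elim
    case (elim x)
    have "x \<in> (\<Union>n. ?B n)" unfolding UN_box_eq_UNIV by simp
    then obtain n where "x \<in> ?B n" by blast
    then show ?case using elim[rule_format, of n] by simp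
  qed
qed

text \<open>Through this lemma an estimate of an explicit inverse transform becomes valid for the
  representative picked by \<open>inverse_fourier\<close>.\<close>

lemma inverse_fourier_AE_unique:
  assumes "is_inverse_fourier m V1" "is_inverse_fourier m V2"
  shows "AE x in lborel. V1 x = V2 x"
proof -
  have "AE x in lborel. V1 x - V2 x = 0"
  proof (rule schwartz_pairing_zero_imp_AE_zero)
    show "(\<lambda>x. V1 x - V2 x) \<in> borel_measurable borel" using assms unfolding is_inverse_fourier_def by auto
    fix \<phi> :: "'a \<Rightarrow> complex" assume "schwartz \<phi>"
    then have "integrable lborel (\<lambda>x. V1 x * \<phi> x)" "integrable lborel (\<lambda>x. V2 x * \<phi> x)"
      "(LINT x|lborel. V1 x * \<phi> x) = (LINT x|lborel. V2 x * \<phi> x)"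
      using assms unfolding is_inverse_fourier_def by auto
    then show "integrable lborel (\<lambda>x. (V1 x - V2 x) * \<phi> x) \<and> (LINT x|lborel. (V1 x - V2 x) * \<phi> x) = 0"
      by (simp add: left_diff_distrib)
  qed
  then show ?thesis by simp
qed

section \<open>Young's convolution inequality\<close>

lemma lborel_distr_reflect:
  fixes x :: "'a::euclidean_space"
  shows "distr lborel borel (\<lambda>y. x - y) = lborel"
  by (subst (2) lborel_affine[of "-1" x]) (auto simp: density_1)

lemma lborel_integrable_reflect_iff:
  fixes f :: "'a::euclidean_space \<Rightarrow> 'b::{banach, second_countable_topology}"
  assumes "f \<in> borel_measurable borel"
  shows "integrable lborel (\<lambda>y. f (x - y)) \<longleftrightarrow> integrable lborel f"
  using integrable_distr_eq[of "\<lambda>y. x - y" lborel borel f] assms by (simp add: lborel_distr_reflect)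

lemma lborel_integral_reflect:
  fixes f :: "'a::euclidean_space \<Rightarrow> 'b::{banach, second_countable_topology}"
  assumes "f \<in> borel_measurable borel"
  shows "(LINT y|lborel. f (x - y)) = (LINT y|lborel. f y)"
  using integral_distr[of "\<lambda>y. x - y" lborel borel f] assms by (simp add: lborel_distr_reflect)

lemma lborel_AE_reflect:
  fixes x :: "'a::euclidean_space"
  assumes "AE y in lborel. P y" "Measurable.pred borel P"
  shows "AE y in lborel. P (x - y)"
proof -
  have "AE y in distr lborel borel (\<lambda>y. x - y). P y" unfolding lborel_distr_reflect by (rule assms(1))
  then show ?thesis using assms(2) by (subst (asm) AE_distr_iff) auto
qed

text \<open>The exponential lies above its tangent at the weighted mean m, and the linear terms
  cancel in the weighted sum.\<close>

lemma exp_convex_three: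
  fixes a b c s t w :: real
  assumes "0 \<le> a" "0 \<le> b" "0 \<le> c" "a + b + c = 1"
  shows "exp (a * s + b * t + c * w) \<le> a * exp s + b * exp t + c * exp w"
proof -
  define m where "m = a * s + b * t + c * w"
  have tangent: "exp m * (1 + (u - m)) \<le> exp u" for u
  proof -
    have "exp m * (1 + (u - m)) \<le> exp m * exp (u - m)" by (intro mult_left_mono) auto
    then show ?thesis by (simp add: mult_exp_exp)
  qed
  have ring: "E * ((a + b + c) * (1 - m) + (a * s + b * t + c * w))
      = a * (E * (1 + (s - m))) + b * (E * (1 + (t - m))) + c * (E * (1 + (w - m)))" for E
    by algebra
  have "exp m = exp m * ((a + b + c) * (1 - m) + (a * s + b * t + c * w))"
    unfolding assms(4) m_def[symmetric] by simp
  also have "\<dots> = a * (exp m * (1 + (s - m))) + b * (exp m * (1 + (t - m))) + c * (exp m * (1 + (w - m)))"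
    by (rule ring)
  also have "\<dots> \<le> a * exp s + b * exp t + c * exp w"
    using assms by (intro add_mono mult_left_mono tangent)
  finally show ?thesis unfolding m_def .
qed

text \<open>In Young's inequality the weights are \<open>a = 1/q\<close>, \<open>b = 1/r - 1/q\<close>, \<open>c = 1/p - 1/q\<close>.\<close>

lemma Young_pointwise:
  fixes X Y I M N a b c r p :: real
  assumes "0 \<le> X" "0 \<le> Y" "0 < I" "0 < M" "0 < N"
    and abc: "0 \<le> a" "0 \<le> b" "0 \<le> c" "a + b + c = 1"
    and exps: "r * (a + b) = 1" "p * (a + c) = 1"
  shows "X * Y \<le> I powr a * M powr b * N powr c *
     (a * (X powr r * Y powr p) / I + b * X powr r / M + c * Y powr p / N)"
proof (cases "X = 0 \<or> Y = 0")
  case True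
  then have "X * Y = 0" by auto
  moreover have "0 \<le> I powr a * M powr b * N powr c *
     (a * (X powr r * Y powr p) / I + b * X powr r / M + c * Y powr p / N)"
    using assms by (intro mult_nonneg_nonneg add_nonneg_nonneg divide_nonneg_pos) auto
  ultimately show ?thesis by linarith
next
  case False
  then have XY: "0 < X" "0 < Y" using assms by auto
  define s t w where "s = r * ln X + p * ln Y - ln I" and "t = r * ln X - ln M" and "w = p * ln Y - ln N"
  have es: "exp s = X powr r * Y powr p / I" "exp t = X powr r / M" "exp w = Y powr p / N"
    using assms XY by (auto simp: s_def t_def w_def exp_diff exp_add powr_def)
  define L where "L = a * ln I + b * ln M + c * ln N"
  have "a * s + b * t + c * w = (r * (a + b)) * ln X + (p * (a + c)) * ln Y - L"
    unfolding s_def t_def w_def L_def by algebra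
  then have "L + (a * s + b * t + c * w) = ln X + ln Y" unfolding exps by simp
  then have "X * Y = exp L * exp (a * s + b * t + c * w)"
    using XY by (simp only: exp_add[symmetric]) (simp add: exp_add)
  also have "\<dots> \<le> exp L * (a * exp s + b * exp t + c * exp w)"
    by (intro mult_left_mono exp_convex_three abc) auto
  also have "exp L = I powr a * M powr b * N powr c"
    using assms unfolding L_def by (simp add: powr_def exp_add)
  finally show ?thesis unfolding es by (simp only: times_divide_eq_right)
qed

context
  fixes K f :: "'a::euclidean_space \<Rightarrow> complex" and p r M :: real
  assumes K: "K \<in> borel_measurable borel" and f: "f \<in> borel_measurable borel"
    and pos: "0 < p" "0 < r" "0 < M"
    and Kr: "integrable lborel (\<lambda>x. norm (K x) powr r)" "(LINT x|lborel. norm (K x) powr r) \<le> M"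
    and fp: "integrable lborel (\<lambda>x. norm (f x) powr p)"
begin

lemma AE_zero_of_powr_integral_zero:
  assumes "(LINT x|lborel. norm (f x) powr p) = 0"
  shows "AE y in lborel. f y = 0"
proof -
  have "AE x in lborel. norm (f x) powr p = 0"
    using assms integral_nonneg_eq_0_iff_AE[OF fp] by simp
  then show ?thesis by eventually_elim (auto simp: powr_eq_0_iff)
qed

text \<open>In the integral over y each of the three terms is divided by its own integral or, for
  \<open>M\<close>, an upper bound of it, so the total is at most a + b + c = 1. The alternative a =
  0 is the case q = \<infinity>: there the mixed term disappears and \<open>I\<close> may be any
  positive number.\<close>

lemma convolution_pointwise_bound:
  fixes a b c I :: real
  defines "N \<equiv> LINT x|lborel. norm (f x) powr p"
  assumes abc: "0 \<le> a" "0 \<le> b" "0 \<le> c" "a + b + c = 1"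
    and exps: "r * (a + b) = 1" "p * (a + c) = 1"
    and N: "0 < N" and I: "0 < I"
    and int: "a = 0 \<or> integrable lborel (\<lambda>y. norm (K (x - y)) powr r * norm (f y) powr p)"
    and I_ge: "a = 0 \<or> (LINT y|lborel. norm (K (x - y)) powr r * norm (f y) powr p) = I"
  shows "integrable lborel (\<lambda>y. K (x - y) * f y)"
    and "norm (convolve K f x) \<le> I powr a * M powr b * N powr c"
proof -
  have [measurable]: "K \<in> borel_measurable borel" "f \<in> borel_measurable borel" using K f by auto
  let ?P = "\<lambda>y. norm (K (x - y)) powr r * norm (f y) powr p"
  let ?g = "\<lambda>y. a * ?P y / I + b * norm (K (x - y)) powr r / M + c * norm (f y) powr p / N"
  let ?Q = "I powr a * M powr b * N powr c"
  have Kx: "integrable lborel (\<lambda>y. norm (K (x - y)) powr r)"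
    using Kr(1) lborel_integrable_reflect_iff[of "\<lambda>y. norm (K y) powr r" x] by simp
  have Kxi: "(LINT y|lborel. norm (K (x - y)) powr r) = (LINT y|lborel. norm (K y) powr r)"
    by (rule lborel_integral_reflect) measurable
  have 1: "integrable lborel (\<lambda>y. a * ?P y / I)" using int by (cases "a = 0") auto
  have 2: "integrable lborel (\<lambda>y. b * norm (K (x - y)) powr r / M)" using Kx by auto
  have 3: "integrable lborel (\<lambda>y. c * norm (f y) powr p / N)" using fp by auto
  have g: "integrable lborel ?g" using 1 2 3 by (intro Bochner_Integration.integrable_add)
  have bound: "norm (K (x - y) * f y) \<le> ?Q * ?g y" for y
    unfolding norm_mult by (rule Young_pointwise) (use abc exps N I pos in auto)
  show kf: "integrable lborel (\<lambda>y. K (x - y) * f y)"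
  proof (rule Bochner_Integration.integrable_bound[OF integrable_mult_right[OF g]])
    show "AE y in lborel. norm (K (x - y) * f y) \<le> norm (?Q * ?g y)"
      unfolding real_norm_def[of "?Q * _"] by (intro AE_I2) (rule order_trans[OF bound abs_ge_self])
  qed auto
  have "norm (convolve K f x) \<le> (LINT y|lborel. norm (K (x - y) * f y))"
    unfolding convolve_def by (rule integral_norm_bound)
  also have "\<dots> \<le> (LINT y|lborel. ?Q * ?g y)"
    by (intro integral_mono_AE integrable_norm kf integrable_mult_right g AE_I2 bound)
  also have "\<dots> = ?Q * (LINT y|lborel. ?g y)" by simp
  also have "(LINT y|lborel. ?g y) \<le> 1"
  proof -
    have "(LINT y|lborel. ?g y) = (LINT y|lborel. a * ?P y / I) + (LINT y|lborel. b * norm (K (x - y)) powr r / M) + (LINT y|lborel. c * norm (f y) powr p / N)"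
      using 1 2 3 by (simp add: Bochner_Integration.integral_add)
    moreover have "(LINT y|lborel. a * ?P y / I) = a" using I_ge I by (cases "a = 0") auto
    moreover have "(LINT y|lborel. b * norm (K (x - y)) powr r / M) \<le> b"
    proof -
      have "(LINT y|lborel. b * norm (K (x - y)) powr r / M) = b * ((LINT y|lborel. norm (K y) powr r) / M)"
        using Kxi by simp
      also have "\<dots> \<le> b * 1" using Kr(2) pos abc by (intro mult_left_mono) auto
      finally show ?thesis by simp
    qed
    moreover have "(LINT y|lborel. c * norm (f y) powr p / N) = c" using N unfolding N_def by simp
    ultimately show ?thesis using abc by linarith
  qed
  then have "?Q * (LINT y|lborel. ?g y) \<le> ?Q * 1" by (intro mult_left_mono) auto
  finally show "norm (convolve K f x) \<le> ?Q" by simp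
qed

lemma Young_convolution_sup:
  assumes conj: "1 / p + 1 / r = 1"
  shows "integrable lborel (\<lambda>y. K (x - y) * f y)"
    and "norm (convolve K f x) \<le> M powr (1 / r) * (LINT x|lborel. norm (f x) powr p) powr (1 / p)"
proof -
  define N where "N = (LINT x|lborel. norm (f x) powr p)"
  have N0: "0 \<le> N" unfolding N_def by (intro integral_nonneg_AE) auto
  have "integrable lborel (\<lambda>y. K (x - y) * f y) \<and> norm (convolve K f x) \<le> M powr (1 / r) * N powr (1 / p)"
  proof (cases "N = 0")
    \<comment> \<open>The pointwise bound divides by N. If N = 0, then f vanishes almost everywhere
      and the convolution is 0.\<close>
    case True
    then have AE0: "AE y in lborel. K (x - y) * f y = 0" using AE_zero_of_powr_integral_zero N_def by auto
    have [measurable]: "K \<in> borel_measurable borel" "f \<in> borel_measurable borel" using K f by auto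
    have "integrable lborel (\<lambda>y. K (x - y) * f y)"
      by (rule integrable_cong_AE_imp[of _ "\<lambda>_. 0"]) (use AE0 in auto)
    moreover have "convolve K f x = 0" unfolding convolve_def
      by (rule integral_eq_zero_AE[OF AE0])
    ultimately show ?thesis by simp
  next
    case False
    then have "0 < N" using N0 by simp
    have "r * (0 + 1 / r) = 1" "p * (0 + 1 / p) = 1" using pos by auto
    then show ?thesis
      using convolution_pointwise_bound[of 0 "1 / r" "1 / p" 1 x] conj pos \<open>0 < N\<close> unfolding N_def by (auto simp: add.commute)
  qed
  then show "integrable lborel (\<lambda>y. K (x - y) * f y)"
    and "norm (convolve K f x) \<le> M powr (1 / r) * (LINT x|lborel. norm (f x) powr p) powr (1 / p)"
    unfolding N_def by auto
qed

text \<open>\<open>I\<close> is the convolution of |K|^r with |f|^p, with total integral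
  \<open>M0 * N\<close>. The pointwise bound controls the convolution by I^(1/q) times a constant,
  and integrating its q-th power turns this into the norm estimate.\<close>

lemma Young_convolution:
  assumes q: "0 < q" and conj: "1 / p + 1 / r = 1 + 1 / q" and "p \<le> q" "r \<le> q"
  shows "AE x in lborel. integrable lborel (\<lambda>y. K (x - y) * f y)"
    and "integrable lborel (\<lambda>x. norm (convolve K f x) powr q)"
    and "(LINT x|lborel. norm (convolve K f x) powr q) powr (1 / q)
       \<le> M powr (1 / r) * (LINT x|lborel. norm (f x) powr p) powr (1 / p)"
proof -
  have [measurable]: "K \<in> borel_measurable borel" "f \<in> borel_measurable borel" using K f by auto
  define N where "N = (LINT x|lborel. norm (f x) powr p)"
  define M0 where "M0 = (LINT x|lborel. norm (K x) powr r)"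
  define I where "I = (\<lambda>x. LINT y|lborel. norm (K (x - y)) powr r * norm (f y) powr p)"
  define a b c where "a = 1 / q" and "b = 1 / r - 1 / q" and "c = 1 / p - 1 / q"
  have abc: "0 \<le> a" "0 \<le> b" "0 \<le> c" "a + b + c = 1"
    using q pos conj assms(3,4) unfolding a_def b_def c_def by (auto simp: frac_le)
  have exps: "r * (a + b) = 1" "p * (a + c) = 1" using pos unfolding a_def b_def c_def by auto
  have N0: "0 \<le> N" unfolding N_def by (intro integral_nonneg_AE) auto
  have M00: "0 \<le> M0" unfolding M0_def by (intro integral_nonneg_AE) auto
  have trans: "integrable lborel (\<lambda>x. norm (K (x - y)) powr r)" "(LINT x|lborel. norm (K (x - y)) powr r) = M0" for y
  proof -
    have D: "distr lborel borel ((+) (- y)) = lborel" by (rule lborel_distr_plus)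
    have "integrable (distr lborel borel ((+) (- y))) (\<lambda>x. norm (K x) powr r)" unfolding D by (rule Kr(1))
    then show "integrable lborel (\<lambda>x. norm (K (x - y)) powr r)"
      by (subst (asm) integrable_distr_eq) auto
    have "M0 = (LINT x|distr lborel borel ((+) (- y)). norm (K x) powr r)" unfolding D M0_def ..
    also have "\<dots> = (LINT x|lborel. norm (K (x - y)) powr r)" by (subst integral_distr) auto
    finally show "(LINT x|lborel. norm (K (x - y)) powr r) = M0" by simp
  qed
  let ?F = "\<lambda>y x. norm (K (x - y)) powr r * norm (f y) powr p"
  have meas: "case_prod ?F \<in> borel_measurable (lborel \<Otimes>\<^sub>M lborel)" by measurable
  have i1: "integrable lborel (\<lambda>y. LINT x|lborel. norm (?F y x))"
    using fp by (simp add: trans abs_mult)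
  have i2: "AE y in lborel. integrable lborel (?F y)" using trans by (intro AE_I2) auto
  note Fub = lborel_Fubini[OF meas i1 i2]
  have AEint: "AE x in lborel. integrable lborel (\<lambda>y. ?F y x)" by (rule Fub(3))
  have Iint: "integrable lborel I" unfolding I_def by (rule Fub(5))
  have Itot: "(LINT x|lborel. I x) = M0 * N" unfolding I_def Fub(2) N_def by (simp add: trans)
  have I0: "0 \<le> I x" for x unfolding I_def by (intro integral_nonneg_AE) auto
  define Q where "Q = M powr b * N powr c"
  have main: "AE x in lborel. integrable lborel (\<lambda>y. K (x - y) * f y) \<and> norm (convolve K f x) \<le> I x powr a * Q"
    using AEint
  proof eventually_elim
    case (elim x)
    show ?case
    proof (cases "I x = 0 \<or> N = 0")
      case True
      have AE0: "AE y in lborel. K (x - y) * f y = 0"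
      proof (cases "N = 0")
        case True
        then show ?thesis using AE_zero_of_powr_integral_zero N_def by auto
      next
        case False
        then have "AE y in lborel. ?F y x = 0"
          using True integral_nonneg_eq_0_iff_AE[OF elim] unfolding I_def by auto
        then show ?thesis by eventually_elim (auto simp: powr_eq_0_iff)
      qed
      have "integrable lborel (\<lambda>y. K (x - y) * f y)"
        by (rule integrable_cong_AE_imp[of _ "\<lambda>_. 0"]) (use AE0 in auto)
      moreover have "convolve K f x = 0" unfolding convolve_def
        by (rule integral_eq_zero_AE[OF AE0])
      ultimately show ?thesis unfolding Q_def by simp
    next
      case False
      then have "0 < I x" "0 < N" using N0 I0[of x] by auto
      then show ?thesis
        using convolution_pointwise_bound[OF abc exps, of "I x" x] elim unfolding N_def I_def Q_def by (auto simp: mult.assoc)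
    qed
  qed
  then show "AE x in lborel. integrable lborel (\<lambda>y. K (x - y) * f y)" by eventually_elim auto
  have Q0: "0 \<le> Q" unfolding Q_def by simp
  have bq: "AE x in lborel. norm (convolve K f x) powr q \<le> I x * Q powr q"
    using main
  proof eventually_elim
    case (elim x)
    then have "norm (convolve K f x) powr q \<le> (I x powr a * Q) powr q" using q by (intro powr_mono2) auto
    also have "\<dots> = I x * Q powr q" using Q0 q I0[of x] by (simp add: powr_mult powr_powr a_def)
    finally show ?case .
  qed
  have cm: "(\<lambda>x. norm (convolve K f x) powr q) \<in> borel_measurable lborel" unfolding convolve_def by measurable
  show ci: "integrable lborel (\<lambda>x. norm (convolve K f x) powr q)"
  proof (rule Bochner_Integration.integrable_bound)
    show "integrable lborel (\<lambda>x. I x * Q powr q)" by (intro integrable_mult_left Iint)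
    show "AE x in lborel. norm (norm (convolve K f x) powr q) \<le> norm (I x * Q powr q)"
      using bq by eventually_elim auto
  qed (rule cm)
  have "(LINT x|lborel. norm (convolve K f x) powr q) \<le> (LINT x|lborel. I x * Q powr q)"
    by (intro integral_mono_AE ci integrable_mult_left Iint bq)
  also have "\<dots> = M0 * N * Q powr q" using Itot by simp
  also have "\<dots> \<le> M * N * Q powr q" using Kr(2) N0 unfolding M0_def by (intro mult_right_mono) auto
  finally have "(LINT x|lborel. norm (convolve K f x) powr q) powr (1 / q) \<le> (M * N * Q powr q) powr (1 / q)"
    using q by (intro powr_mono2) (auto intro!: integral_nonneg_AE)
  also have "\<dots> = M powr (1 / q) * N powr (1 / q) * Q"
    using pos N0 Q0 q by (simp add: powr_mult powr_powr)
  also have "\<dots> = (M powr (1 / q) * M powr b) * (N powr (1 / q) * N powr c)" unfolding Q_def by simp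
  also have "\<dots> = M powr (1 / r) * N powr (1 / p)" unfolding b_def c_def by (simp add: powr_add[symmetric])
  finally show "(LINT x|lborel. norm (convolve K f x) powr q) powr (1 / q)
       \<le> M powr (1 / r) * (LINT x|lborel. norm (f x) powr p) powr (1 / p)" unfolding N_def .
qed

end

section \<open>Potential estimates for the kernel\<close>

text \<open>The bound is asked only off the origin, since there the two notations for powers part:
  at x = 0 a power written with \<open>powr\<close> is 0, while one written with exp and ln is
  1.\<close>

lemma lborel_Fubini_product_bound:
  fixes f :: "'a::euclidean_space \<Rightarrow> 'b::euclidean_space \<Rightarrow> complex" and g :: "'a \<Rightarrow> real" and h :: "'b \<Rightarrow> real"
  assumes meas: "case_prod f \<in> borel_measurable (lborel \<Otimes>\<^sub>M lborel)"
    and g: "integrable lborel g" and h: "integrable lborel h"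
    and bound: "\<And>x y. x \<noteq> 0 \<Longrightarrow> norm (f x y) \<le> g x * h y"
  shows "(LINT y|lborel. LINT x|lborel. f x y) = (LINT x|lborel. LINT y|lborel. f x y)"
proof (rule lborel_Fubini(2)[OF meas])
  have nz: "AE x in lborel. x \<noteq> (0::'a)" by (rule AE_lborel_singleton)
  have i: "integrable lborel (f x)" if "x \<noteq> 0" for x
  proof (rule Bochner_Integration.integrable_bound)
    show "integrable lborel (\<lambda>y. g x * h y)" by (intro integrable_mult_right h)
    show "f x \<in> borel_measurable lborel" using measurable_Pair2[OF meas, of x] by simp
    show "AE y in lborel. norm (f x y) \<le> norm (g x * h y)"
      using bound[OF that] unfolding real_norm_def by (intro AE_I2 order_trans[OF bound[OF that] abs_ge_self])
  qed
  show "AE x in lborel. integrable lborel (f x)" using nz by eventually_elim (rule i)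
  show "integrable lborel (\<lambda>x. LINT y|lborel. norm (f x y))"
  proof (rule Bochner_Integration.integrable_bound)
    show "integrable lborel (\<lambda>x. g x * (LINT y|lborel. h y))" by (intro integrable_mult_left g)
    show "(\<lambda>x. LINT y|lborel. norm (f x y)) \<in> borel_measurable lborel" using meas by measurable
    show "AE x in lborel. norm (LINT y|lborel. norm (f x y)) \<le> norm (g x * (LINT y|lborel. h y))"
      using nz
    proof eventually_elim
      case (elim x)
      have "(LINT y|lborel. norm (f x y)) \<le> (LINT y|lborel. g x * h y)"
        by (intro integral_mono_AE integrable_norm i elim integrable_mult_right h AE_I2 bound)
      moreover have "0 \<le> (LINT y|lborel. norm (f x y))" by (intro integral_nonneg_AE) auto
      ultimately show ?case by simp
    qed
  qed
qed

text \<open>The constant in front of |x|^(s - d) in the inverse Fourier transform of |\<xi>|^(-s),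
  for 0 < Re s < d.\<close>

definition riesz_factor :: "real \<Rightarrow> complex \<Rightarrow> complex" where
  "riesz_factor d s = Gamma ((of_real d - s) / 2) * rGamma (s / 2) * exp ((s - of_real d / 2) * of_real (ln pi))"

lemma riesz_pairing_factor:
  fixes \<phi> :: "'a::euclidean_space \<Rightarrow> complex"
  assumes "schwartz \<phi>" "0 < Re s" "Re s < real DIM('a)"
  shows "(LINT \<xi>|lborel. exp (- s * of_real (ln (norm \<xi>))) * inverse_fourier_integral \<phi> \<xi>)
    = riesz_factor (real DIM('a)) s * (LINT x|lborel. exp ((s - of_real (real DIM('a))) * of_real (ln (norm x))) * \<phi> x)"
proof -
  let ?d = "real DIM('a)"
  let ?A = "LINT \<xi>|lborel. exp (- s * of_real (ln (norm \<xi>))) * inverse_fourier_integral \<phi> \<xi>"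
  let ?B = "LINT x|lborel. exp ((s - of_real ?d) * of_real (ln (norm x))) * \<phi> x"
  have i: "integrable lborel \<phi>" using schwartz_derivative_integrable[OF assms(1), of "[]"] by simp
  then have m: "\<phi> \<in> borel_measurable borel" by (simp add: borel_measurable_integrable)
  have im: "inverse_fourier_integral \<phi> \<in> borel_measurable borel"
    using m by (intro inverse_fourier_integral_measurable) simp
  have "Gamma (s / 2) * exp (- (s / 2) * of_real (ln pi)) * ?A = Gamma ((of_real ?d - s) / 2) * exp (- ((of_real ?d - s) / 2) * of_real (ln pi)) * ?B"
  proof (rule riesz_pairing[OF assms(2,3) i])
    show "integrable lborel (\<lambda>\<xi>. norm \<xi> powr - Re s * norm (inverse_fourier_integral \<phi> \<xi>))"
      using assms im by (intro integrable_powr_mult_of_decay schwartz_inverse_fourier_decay) auto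
    have "integrable lborel (\<lambda>x. norm x powr - (?d - Re s) * norm (\<phi> x))"
      using assms m by (intro integrable_powr_mult_of_decay schwartz_decay) auto
    then show "integrable lborel (\<lambda>x. norm x powr (Re s - ?d) * norm (\<phi> x))" by simp
  qed (use im in simp)
  then have "rGamma (s / 2) * exp ((s / 2) * of_real (ln pi)) * (Gamma (s / 2) * exp (- (s / 2) * of_real (ln pi)) * ?A)
     = rGamma (s / 2) * exp ((s / 2) * of_real (ln pi)) * (Gamma ((of_real ?d - s) / 2) * exp (- ((of_real ?d - s) / 2) * of_real (ln pi)) * ?B)"
    by (rule arg_cong)
  moreover have "rGamma (s / 2) * Gamma (s / 2) = 1"
  proof -
    have "s / 2 \<notin> \<int>\<^sub>\<le>\<^sub>0" using assms(2) by (auto elim!: nonpos_Ints_cases' simp: complex_eq_iff)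
    then show ?thesis by (simp add: rGamma_inverse_Gamma Gamma_eq_zero_iff)
  qed
  then have "rGamma (s / 2) * exp ((s / 2) * of_real (ln pi)) * (Gamma (s / 2) * exp (- (s / 2) * of_real (ln pi)) * ?A) = ?A"
  proof -
    have "exp ((s / 2) * of_real (ln pi)) * exp (- (s / 2) * of_real (ln pi)) = 1" by (simp add: mult_exp_exp)
    then have "(rGamma (s / 2) * Gamma (s / 2)) * (exp ((s / 2) * of_real (ln pi)) * exp (- (s / 2) * of_real (ln pi))) * ?A = ?A"
      using \<open>rGamma (s / 2) * Gamma (s / 2) = 1\<close> by simp
    then show ?thesis by (simp only: mult_ac)
  qed
  moreover have h: "exp ((s / 2) * of_real (ln pi)) * exp (- ((of_real ?d - s) / 2) * of_real (ln pi)) = exp ((s - of_real ?d / 2) * of_real (ln pi))"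
    by (simp add: mult_exp_exp field_simps)
  have r: "u * v * (w * z * b) = w * u * (v * z) * b" for u v w z b :: complex by (simp only: mult_ac)
  have "rGamma (s / 2) * exp ((s / 2) * of_real (ln pi)) * (Gamma ((of_real ?d - s) / 2) * exp (- ((of_real ?d - s) / 2) * of_real (ln pi)) * ?B)
     = riesz_factor ?d s * ?B"
    unfolding riesz_factor_def r h ..
  ultimately show ?thesis by (rule box_equals)
qed

text \<open>Both Gamma factors sit at height |y| / 2, so their quotient grows only polynomially; the
  remaining exponential has modulus independent of y.\<close>

lemma norm_riesz_factor_le:
  assumes "0 < a" "a < d"
  obtains C n where "0 \<le> C" "\<And>y. norm (riesz_factor d (Complex a y)) \<le> C * (1 + \<bar>y\<bar>) ^ n"
proof -
  obtain C n where C: "C > 0" "\<And>y. norm (Gamma (Complex ((d - a) / 2) y)) \<le> C * (1 + \<bar>y\<bar>) ^ n * norm (Gamma (Complex (a / 2) y))"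
    using norm_Gamma_le_power_mult[of "(d - a) / 2" "a / 2"] assms by auto
  have "norm (riesz_factor d (Complex a y)) \<le> C * exp ((a - d / 2) * ln pi) * (1 + \<bar>y\<bar>) ^ n" for y
  proof -
    \<comment> \<open>Conjugation leaves the modulus unchanged and gives both Gamma arguments the
      same imaginary part y / 2.\<close>
    have e1: "(of_real d - Complex a y) / 2 = cnj (Complex ((d - a) / 2) (y / 2))" by (simp add: complex_eq_iff)
    have e2: "Complex a y / 2 = Complex (a / 2) (y / 2)" by (simp add: complex_eq_iff)
    have nz: "Gamma (Complex (a / 2) (y / 2)) \<noteq> 0"
      unfolding Gamma_eq_zero_iff using assms by (auto elim!: nonpos_Ints_cases' simp: complex_eq_iff)
    have "norm (Gamma ((of_real d - Complex a y) / 2)) = norm (Gamma (Complex ((d - a) / 2) (y / 2)))"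
      unfolding e1 cnj_Gamma[symmetric] by simp
    also have "\<dots> \<le> C * (1 + \<bar>y / 2\<bar>) ^ n * norm (Gamma (Complex (a / 2) (y / 2)))" by (rule C(2))
    also have "\<dots> \<le> C * (1 + \<bar>y\<bar>) ^ n * norm (Gamma (Complex (a / 2) (y / 2)))"
      using C(1) by (intro mult_right_mono mult_left_mono power_mono) auto
    finally have "norm (Gamma ((of_real d - Complex a y) / 2)) * norm (rGamma (Complex a y / 2)) \<le> C * (1 + \<bar>y\<bar>) ^ n * norm (Gamma (Complex (a / 2) (y / 2))) * norm (rGamma (Complex a y / 2))"
      by (intro mult_right_mono) auto
    also have "\<dots> = C * (1 + \<bar>y\<bar>) ^ n" using nz unfolding e2 by (simp add: rGamma_inverse_Gamma norm_inverse)
    finally have "norm (Gamma ((of_real d - Complex a y) / 2)) * norm (rGamma (Complex a y / 2)) * exp ((a - d / 2) * ln pi) \<le> C * (1 + \<bar>y\<bar>) ^ n * exp ((a - d / 2) * ln pi)"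
      by (intro mult_right_mono) auto
    moreover have "norm (exp ((Complex a y - of_real d / 2) * of_real (ln pi))) = exp ((a - d / 2) * ln pi)"
      by simp
    ultimately show ?thesis unfolding riesz_factor_def norm_mult by (simp only: mult_ac)
  qed
  moreover have "0 \<le> C * exp ((a - d / 2) * ln pi)" using C(1) by simp
  ultimately show ?thesis using that by blast
qed

lemma exp_mult_ln_norm:
  fixes x :: "'a::real_normed_vector"
  assumes "x \<noteq> 0"
  shows "norm (exp (s * of_real (ln (norm x)))) = norm x powr Re s"
  using assms by (simp add: powr_def)

text \<open>Multiplying u by exp l translates \<open>w\<close> by l. This is how the time and the
  frequency are separated from each other.\<close>

lemma mellin_integrand_shift_weight:
  "mellin_integrand \<alpha> (Complex (L + l) \<theta>) z = mellin_integrand \<alpha> (Complex L \<theta>) z * exp (- z * of_real l)"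
proof -
  have "Complex (L + l) \<theta> = Complex L \<theta> + of_real l" by (simp add: complex_eq_iff)
  then show ?thesis unfolding mellin_integrand_def by (simp add: distrib_left exp_add exp_diff exp_minus divide_inverse mult_ac)
qed

context
  fixes \<alpha> \<beta> \<theta> \<sigma> :: real
  assumes \<alpha>: "0 < \<alpha>" "\<alpha> < 2" and \<theta>: "\<bar>\<theta>\<bar> < pi - pi * \<alpha> / 2" and \<sigma>: "0 < \<sigma>" "\<sigma> < 1" and \<beta>: "0 < \<beta>"
begin

lemma sin_pi_\<sigma>: "sin (pi * \<sigma>) \<noteq> 0"
  using sin_gt_zero[of "pi * \<sigma>"] \<sigma> by auto

text \<open>\<open>L\<close> stands for \<alpha> ln t and carries the time, \<open>\<theta>\<close>
  carries the phase of the symbol. The dependence on \<xi> is kept outside as a power of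
  |\<xi>|.\<close>

definition symbol_density :: "real \<Rightarrow> real \<Rightarrow> complex" where
  "symbol_density L y = mellin_integrand \<alpha> (Complex L \<theta>) (Complex \<sigma> y)"

text \<open>What remains as density once |\<xi>|^(- \<beta> z) has been replaced by its inverse
  Fourier transform, a multiple of |x|^(\<beta> z - d).\<close>

definition kernel_density :: "real \<Rightarrow> real \<Rightarrow> real \<Rightarrow> complex" where
  "kernel_density d L y = symbol_density L y * riesz_factor d (of_real \<beta> * Complex \<sigma> y)"

lemma symbol_density_measurable[measurable]: "symbol_density L \<in> borel_measurable borel"
  unfolding symbol_density_def[abs_def]
  by (intro borel_measurable_continuous_onI continuous_mellin_integrand_vertical sin_pi_\<sigma>)

lemma symbol_density_integrable: "integrable lborel (\<lambda>y. norm (symbol_density L y))"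
  unfolding symbol_density_def
  by (intro integrable_norm integrable_mellin_integrand sin_pi_\<sigma>) (use \<alpha> \<theta> \<sigma> in auto)

text \<open>At L = \<alpha> ln t the factor is t^(- \<alpha> \<sigma>), the power of time in all the
  bounds below.\<close>

lemma norm_symbol_density: "norm (symbol_density L y) = exp (- \<sigma> * L) * norm (symbol_density 0 y)"
proof -
  have "symbol_density L y = symbol_density 0 y * exp (- Complex \<sigma> y * of_real L)"
    unfolding symbol_density_def using mellin_integrand_shift_weight[of \<alpha> 0 L \<theta>] by simp
  then show ?thesis by (simp add: norm_mult)
qed

lemma kernel_density_measurable[measurable]:
  assumes "\<beta> * \<sigma> < d"
  shows "kernel_density d L \<in> borel_measurable borel"
proof -
  have Gamma_cont: "continuous_on {z::complex. 0 < Re z} Gamma"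
    by (intro continuous_on_Gamma) (auto elim!: nonpos_Ints_cases')
  have "continuous_on UNIV (\<lambda>y. riesz_factor d (of_real \<beta> * Complex \<sigma> y))"
    unfolding riesz_factor_def Complex_eq
    using assms
    by (intro continuous_intros continuous_on_compose2[OF continuous_on_rGamma[of UNIV]] continuous_on_compose2[OF Gamma_cont]) auto
  then have "(\<lambda>y. riesz_factor d (of_real \<beta> * Complex \<sigma> y)) \<in> borel_measurable borel"
    by (rule borel_measurable_continuous_onI)
  then show ?thesis unfolding kernel_density_def[abs_def] by measurable
qed

lemma norm_kernel_density: "norm (kernel_density d L y) = exp (- \<sigma> * L) * norm (kernel_density d 0 y)"
  unfolding kernel_density_def norm_mult using norm_symbol_density[of L y] by simp

text \<open>Polynomial growth of the Riesz factor is beaten by exponential decay at rate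
  \<open>\<epsilon>\<close>, the margin in the sector condition. The condition \<beta> \<sigma> < d
  keeps the line to the left of the poles of the Riesz factor.\<close>

lemma kernel_density_integrable:
  assumes "\<beta> * \<sigma> < d"
  shows "integrable lborel (\<lambda>y. norm (kernel_density d L y))"
proof -
  define \<epsilon> where "\<epsilon> = pi - pi * \<alpha> / 2 - \<bar>\<theta>\<bar>"
  have \<epsilon>: "\<epsilon> > 0" using \<theta> unfolding \<epsilon>_def by simp
  obtain C n where C: "0 \<le> C" "\<And>y. norm (riesz_factor d (Complex (\<beta> * \<sigma>) y)) \<le> C * (1 + \<bar>y\<bar>) ^ n"
    using norm_riesz_factor_le[of "\<beta> * \<sigma>" d] assms \<beta> \<sigma> by auto
  define E where "E = 8 * pi / \<bar>sin (pi * \<sigma>)\<bar> * (1 + \<bar>\<sigma>\<bar>)\<^sup>2 * rGamma (3 - \<alpha> * \<sigma>) * exp (- \<sigma> * L)"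
  have A: "norm (symbol_density L y) \<le> E * ((1 + \<bar>y\<bar>)\<^sup>2 * exp (- \<epsilon> * \<bar>y\<bar>))" for y
    using norm_mellin_integrand_vertical[OF \<alpha> _ sin_pi_\<sigma>, of "Complex L \<theta>" y] \<sigma> unfolding E_def \<epsilon>_def symbol_density_def by simp
  have E0: "0 \<le> E" using order_trans[OF norm_ge_zero A[of 0]] by simp
  show ?thesis
  proof (rule Bochner_Integration.integrable_bound)
    show "integrable lborel (\<lambda>y. E * (C * (1 + \<beta>) ^ n) * ((1 + \<bar>y\<bar>) ^ (2 + n) * exp (- \<epsilon> * \<bar>y\<bar>)))"
      by (intro integrable_mult_right integrable_power_mult_exp_minus_abs \<epsilon>)
    have k: "norm (kernel_density d L y) \<le> E * (C * (1 + \<beta>) ^ n) * ((1 + \<bar>y\<bar>) ^ (2 + n) * exp (- \<epsilon> * \<bar>y\<bar>))" for y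
    proof -
      have e: "of_real \<beta> * Complex \<sigma> y = Complex (\<beta> * \<sigma>) (\<beta> * y)" by (simp add: complex_eq_iff)
      have "(1 + \<bar>\<beta> * y\<bar>) ^ n \<le> ((1 + \<beta>) * (1 + \<bar>y\<bar>)) ^ n"
        using \<beta> by (intro power_mono) (auto simp: abs_mult algebra_simps)
      then have "C * (1 + \<bar>\<beta> * y\<bar>) ^ n \<le> C * ((1 + \<beta>) ^ n * (1 + \<bar>y\<bar>) ^ n)"
        using C(1) by (simp only: power_mult_distrib mult_left_mono)
      then have R: "norm (riesz_factor d (of_real \<beta> * Complex \<sigma> y)) \<le> C * ((1 + \<beta>) ^ n * (1 + \<bar>y\<bar>) ^ n)"
        unfolding e using C(2)[of "\<beta> * y"] by linarith
      have "norm (kernel_density d L y) \<le> (E * ((1 + \<bar>y\<bar>)\<^sup>2 * exp (- \<epsilon> * \<bar>y\<bar>))) * (C * ((1 + \<beta>) ^ n * (1 + \<bar>y\<bar>) ^ n))"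
        unfolding kernel_density_def norm_mult using E0 by (intro mult_mono A R) auto
      then show ?thesis by (simp only: power_add mult_ac)
    qed
    show "AE y in lborel. norm (norm (kernel_density d L y)) \<le> norm (E * (C * (1 + \<beta>) ^ n) * ((1 + \<bar>y\<bar>) ^ (2 + n) * exp (- \<epsilon> * \<bar>y\<bar>)))"
      by (rule AE_I2, simp only: real_norm_def abs_norm_cancel, rule order_trans[OF k abs_ge_self])
    show "(\<lambda>y. norm (kernel_density d L y)) \<in> borel_measurable lborel"
      using kernel_density_measurable[OF assms] by measurable
  qed
qed

definition mellin_symbol :: "real \<Rightarrow> 'a::euclidean_space \<Rightarrow> complex" where
  "mellin_symbol L \<xi> = 1 / (2 * pi) * (LINT y|lborel. symbol_density L y * exp (- (of_real \<beta> * Complex \<sigma> y) * of_real (ln (norm \<xi>))))"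

definition mellin_potential :: "real \<Rightarrow> 'a::euclidean_space \<Rightarrow> complex" where
  "mellin_potential L x = 1 / (2 * pi) * (LINT y|lborel. kernel_density (real DIM('a)) L y * exp ((of_real \<beta> * Complex \<sigma> y - of_real (real DIM('a))) * of_real (ln (norm x))))"

lemma mellin_symbol_eq:
  fixes \<xi> :: "'a::euclidean_space"
  assumes "\<xi> \<noteq> 0" "0 < t"
  shows "mittag_leffler \<alpha> (- (cis \<theta> * of_real (t powr \<alpha> * norm \<xi> powr \<beta>))) = mellin_symbol (\<alpha> * ln t) \<xi>"
proof -
  let ?w = "Complex (\<alpha> * ln t + \<beta> * ln (norm \<xi>)) \<theta>"
  have "exp ?w = cis \<theta> * of_real (t powr \<alpha> * norm \<xi> powr \<beta>)"
    using assms by (simp add: exp_eq_polar powr_def exp_add mult.commute)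
  moreover have "mittag_leffler \<alpha> (- exp ?w) = 1 / (2 * pi) * (LINT y|lborel. mellin_integrand \<alpha> ?w (Complex \<sigma> y))"
    by (rule mittag_leffler_eq_mellin) (use \<alpha> \<theta> \<sigma> in auto)
  ultimately show ?thesis
    unfolding mellin_symbol_def symbol_density_def mellin_integrand_shift_weight by (simp add: mult_ac)
qed

lemma norm_mellin_symbol_le:
  fixes \<xi> :: "'a::euclidean_space"
  assumes "\<xi> \<noteq> 0"
  shows "norm (mellin_symbol L \<xi>) \<le> 1 / (2 * pi) * (LINT y|lborel. norm (symbol_density L y)) * norm \<xi> powr (- (\<beta> * \<sigma>))"
proof -
  have "norm (LINT y|lborel. symbol_density L y * exp (- (of_real \<beta> * Complex \<sigma> y) * of_real (ln (norm \<xi>))))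
     \<le> (LINT y|lborel. norm (symbol_density L y * exp (- (of_real \<beta> * Complex \<sigma> y) * of_real (ln (norm \<xi>)))))"
    by (rule integral_norm_bound)
  also have "\<dots> = (LINT y|lborel. norm (symbol_density L y)) * norm \<xi> powr (- (\<beta> * \<sigma>))"
    unfolding norm_mult exp_mult_ln_norm[OF assms] by simp
  finally show ?thesis unfolding mellin_symbol_def norm_mult by (simp add: divide_right_mono norm_divide norm_mult)
qed

lemma norm_mellin_potential_le:
  fixes x :: "'a::euclidean_space"
  assumes "x \<noteq> 0"
  shows "norm (mellin_potential L x) \<le> 1 / (2 * pi) * (LINT y|lborel. norm (kernel_density (real DIM('a)) L y)) * norm x powr (\<beta> * \<sigma> - real DIM('a))"
proof -
  have "norm (LINT y|lborel. kernel_density (real DIM('a)) L y * exp ((of_real \<beta> * Complex \<sigma> y - of_real (real DIM('a))) * of_real (ln (norm x))))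
     \<le> (LINT y|lborel. norm (kernel_density (real DIM('a)) L y * exp ((of_real \<beta> * Complex \<sigma> y - of_real (real DIM('a))) * of_real (ln (norm x)))))"
    by (rule integral_norm_bound)
  also have "\<dots> = (LINT y|lborel. norm (kernel_density (real DIM('a)) L y)) * norm x powr (\<beta> * \<sigma> - real DIM('a))"
    unfolding norm_mult exp_mult_ln_norm[OF assms] by simp
  finally show ?thesis unfolding mellin_potential_def norm_mult by (simp add: divide_right_mono norm_divide norm_mult)
qed

lemma mellin_symbol_measurable: "mellin_symbol L \<in> borel_measurable borel"
  unfolding mellin_symbol_def[abs_def] Complex_eq by measurable

lemma mellin_potential_measurable:
  assumes "\<beta> * \<sigma> < real DIM('a)"
  shows "(mellin_potential L :: 'a::euclidean_space \<Rightarrow> complex) \<in> borel_measurable borel"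
proof -
  note [measurable] = kernel_density_measurable[OF assms]
  show ?thesis unfolding mellin_potential_def[abs_def] Complex_eq by measurable
qed

text \<open>Fubini on both sides of the pairing reduces the claim to the Riesz formula for each y.
  The symbol \<open>m\<close> is compared with \<open>mellin_symbol\<close> off the origin only,
  because the latter contains ln |\<xi>| and has a junk value at 0.\<close>

lemma mellin_is_inverse_fourier:
  fixes m :: "'a::euclidean_space \<Rightarrow> complex"
  assumes small: "\<beta> * \<sigma> < real DIM('a)"
    and m: "m \<in> borel_measurable borel" "\<And>\<xi>. \<xi> \<noteq> 0 \<Longrightarrow> m \<xi> = mellin_symbol L \<xi>"
  shows "is_inverse_fourier m (mellin_potential L)"
  unfolding is_inverse_fourier_def
proof (intro conjI allI impI)
  let ?d = "real DIM('a)"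
  let ?s = "\<lambda>y. of_real \<beta> * Complex \<sigma> y"
  let ?D = "kernel_density ?d L"
  let ?S = "symbol_density L"
  show "m \<in> borel_measurable lborel" using m by simp
  show "(mellin_potential L :: 'a \<Rightarrow> complex) \<in> borel_measurable lborel" using mellin_potential_measurable[OF small] by simp
  fix \<phi> :: "'a \<Rightarrow> complex" assume \<phi>: "schwartz \<phi>"
  define \<psi> where "\<psi> = inverse_fourier_integral \<phi>"
  have \<phi>m: "\<phi> \<in> borel_measurable borel" using schwartz_derivative_measurable[OF \<phi>, of "[]"] by simp
  have \<psi>m: "\<psi> \<in> borel_measurable borel" unfolding \<psi>_def using \<phi>m by (intro inverse_fourier_integral_measurable) simp
  note [measurable] = \<phi>m \<psi>m m(1) mellin_potential_measurable[OF small, of L] kernel_density_measurable[OF small, of L]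
  have \<sigma>0: "0 < \<beta> * \<sigma>" using \<beta> \<sigma> by simp
  have nz: "AE x in lborel. x \<noteq> (0::'a)" by (rule AE_lborel_singleton)
  have i\<phi>: "integrable lborel (\<lambda>x. norm x powr (\<beta> * \<sigma> - ?d) * norm (\<phi> x))"
    using integrable_powr_mult_of_decay[OF \<phi>m schwartz_decay[OF \<phi>], of "?d - \<beta> * \<sigma>"] small \<sigma>0 by simp
  have i\<psi>: "integrable lborel (\<lambda>\<xi>. norm \<xi> powr (- (\<beta> * \<sigma>)) * norm (\<psi> \<xi>))"
    using integrable_powr_mult_of_decay[OF \<psi>m, of "\<beta> * \<sigma>"] schwartz_inverse_fourier_decay[OF \<phi>] small \<sigma>0 unfolding \<psi>_def by simp
  show "integrable lborel (\<lambda>x. mellin_potential L x * \<phi> x)"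
  proof (rule Bochner_Integration.integrable_bound)
    let ?C = "1 / (2 * pi) * (LINT y|lborel. norm (?D y))"
    show "integrable lborel (\<lambda>x. ?C * (norm x powr (\<beta> * \<sigma> - ?d) * norm (\<phi> x)))" by (intro integrable_mult_right i\<phi>)
    show "AE x in lborel. norm (mellin_potential L x * \<phi> x) \<le> norm (?C * (norm x powr (\<beta> * \<sigma> - ?d) * norm (\<phi> x)))"
      using nz
    proof eventually_elim
      case (elim x)
      have "norm (mellin_potential L x) * norm (\<phi> x) \<le> ?C * norm x powr (\<beta> * \<sigma> - ?d) * norm (\<phi> x)"
        by (intro mult_right_mono norm_mellin_potential_le elim) auto
      then show ?case unfolding norm_mult[of "mellin_potential L x"] real_norm_def[of "?C * _"] by (simp only: mult.assoc)
    qed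
  qed measurable
  show "integrable lborel (\<lambda>\<xi>. m \<xi> * inverse_fourier_integral \<phi> \<xi>)"
    unfolding \<psi>_def[symmetric]
  proof (rule Bochner_Integration.integrable_bound)
    let ?C = "1 / (2 * pi) * (LINT y|lborel. norm (?S y))"
    show "integrable lborel (\<lambda>\<xi>. ?C * (norm \<xi> powr (- (\<beta> * \<sigma>)) * norm (\<psi> \<xi>)))" by (intro integrable_mult_right i\<psi>)
    show "AE \<xi> in lborel. norm (m \<xi> * \<psi> \<xi>) \<le> norm (?C * (norm \<xi> powr (- (\<beta> * \<sigma>)) * norm (\<psi> \<xi>)))"
      using nz
    proof eventually_elim
      case (elim x)
      have "norm (m x) * norm (\<psi> x) \<le> ?C * norm x powr (- (\<beta> * \<sigma>)) * norm (\<psi> x)"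
        unfolding m(2)[OF elim] by (intro mult_right_mono norm_mellin_symbol_le elim) auto
      then show ?case unfolding norm_mult[of "m x"] real_norm_def[of "?C * _"] by (simp only: mult.assoc)
    qed
  qed measurable
  have swap1: "(LINT y|lborel. LINT x|lborel. ?D y * (exp ((?s y - of_real ?d) * of_real (ln (norm x))) * \<phi> x))
     = (LINT x|lborel. LINT y|lborel. ?D y * (exp ((?s y - of_real ?d) * of_real (ln (norm x))) * \<phi> x))"
  proof (rule lborel_Fubini_product_bound[OF _ i\<phi> kernel_density_integrable[OF small, of L]])
    show "(\<lambda>(x, y). ?D y * (exp ((?s y - of_real ?d) * of_real (ln (norm x))) * \<phi> x)) \<in> borel_measurable (lborel \<Otimes>\<^sub>M lborel)"
      unfolding Complex_eq by measurable
    fix x :: 'a and y :: real assume "x \<noteq> 0"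
    then show "norm (?D y * (exp ((?s y - of_real ?d) * of_real (ln (norm x))) * \<phi> x)) \<le> norm x powr (\<beta> * \<sigma> - ?d) * norm (\<phi> x) * norm (?D y)"
      unfolding norm_mult exp_mult_ln_norm[OF \<open>x \<noteq> 0\<close>] by simp
  qed
  have swap2: "(LINT y|lborel. LINT \<xi>|lborel. ?S y * (exp (- ?s y * of_real (ln (norm \<xi>))) * \<psi> \<xi>))
     = (LINT \<xi>|lborel. LINT y|lborel. ?S y * (exp (- ?s y * of_real (ln (norm \<xi>))) * \<psi> \<xi>))"
  proof (rule lborel_Fubini_product_bound[OF _ i\<psi> symbol_density_integrable[of L]])
    show "(\<lambda>(\<xi>, y). ?S y * (exp (- ?s y * of_real (ln (norm \<xi>))) * \<psi> \<xi>)) \<in> borel_measurable (lborel \<Otimes>\<^sub>M lborel)"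
      unfolding Complex_eq by measurable
    fix x :: 'a and y :: real assume "x \<noteq> 0"
    then show "norm (?S y * (exp (- ?s y * of_real (ln (norm x))) * \<psi> x)) \<le> norm x powr (- (\<beta> * \<sigma>)) * norm (\<psi> x) * norm (?S y)"
      unfolding norm_mult exp_mult_ln_norm[OF \<open>x \<noteq> 0\<close>] by simp
  qed
  \<comment> \<open>The Riesz formula at s = \<beta> z, with z fixed on the line Re z = \<sigma>;
    its range 0 < Re s < d is where \<open>small\<close> enters.\<close>
  have inner: "(LINT x|lborel. ?D y * (exp ((?s y - of_real ?d) * of_real (ln (norm x))) * \<phi> x))
     = (LINT \<xi>|lborel. ?S y * (exp (- ?s y * of_real (ln (norm \<xi>))) * \<psi> \<xi>))" for y
  proof -
    have "(LINT \<xi>|lborel. exp (- ?s y * of_real (ln (norm \<xi>))) * \<psi> \<xi>)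
      = riesz_factor ?d (?s y) * (LINT x|lborel. exp ((?s y - of_real ?d) * of_real (ln (norm x))) * \<phi> x)"
      unfolding \<psi>_def by (rule riesz_pairing_factor[OF \<phi>]) (use small \<sigma>0 in auto)
    then show ?thesis unfolding integral_mult_right_zero kernel_density_def by (simp only: mult.assoc)
  qed
  have "(LINT x|lborel. mellin_potential L x * \<phi> x)
     = (LINT x|lborel. 1 / (2 * pi) * (LINT y|lborel. ?D y * (exp ((?s y - of_real ?d) * of_real (ln (norm x))) * \<phi> x)))"
    unfolding mellin_potential_def mult.assoc[symmetric] integral_mult_left_zero ..
  also have "\<dots> = 1 / (2 * pi) * (LINT y|lborel. LINT x|lborel. ?D y * (exp ((?s y - of_real ?d) * of_real (ln (norm x))) * \<phi> x))"
    unfolding swap1 by (rule integral_mult_right_zero)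
  also have "\<dots> = 1 / (2 * pi) * (LINT \<xi>|lborel. LINT y|lborel. ?S y * (exp (- ?s y * of_real (ln (norm \<xi>))) * \<psi> \<xi>))"
    unfolding inner swap2 ..
  also have "\<dots> = (LINT \<xi>|lborel. 1 / (2 * pi) * (LINT y|lborel. ?S y * (exp (- ?s y * of_real (ln (norm \<xi>))) * \<psi> \<xi>)))"
    by (rule integral_mult_right_zero[symmetric])
  also have "\<dots> = (LINT \<xi>|lborel. mellin_symbol L \<xi> * \<psi> \<xi>)"
    unfolding mellin_symbol_def mult.assoc[symmetric] integral_mult_left_zero ..
  also have "\<dots> = (LINT \<xi>|lborel. m \<xi> * \<psi> \<xi>)"
  proof (rule integral_cong_AE)
    show "AE \<xi> in lborel. mellin_symbol L \<xi> * \<psi> \<xi> = m \<xi> * \<psi> \<xi>" using nz by eventually_elim (simp add: m(2))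
    show "(\<lambda>\<xi>. mellin_symbol L \<xi> * \<psi> \<xi>) \<in> borel_measurable lborel"
      using mellin_symbol_measurable by measurable
  qed measurable
  finally show "(LINT x|lborel. mellin_potential L x * \<phi> x) = (LINT \<xi>|lborel. m \<xi> * inverse_fourier_integral \<phi> \<xi>)"
    unfolding \<psi>_def .
qed

lemma norm_mellin_symbol_scaled:
  fixes \<xi> :: "'a::euclidean_space"
  assumes "\<xi> \<noteq> 0" "0 < t"
  shows "norm (mellin_symbol (\<alpha> * ln t) \<xi>) \<le> 1 / (2 * pi) * (LINT y|lborel. norm (symbol_density 0 y)) * t powr (- (\<alpha> * \<sigma>)) * norm \<xi> powr (- (\<beta> * \<sigma>))"
proof -
  have "(LINT y|lborel. norm (symbol_density (\<alpha> * ln t) y)) = t powr (- (\<alpha> * \<sigma>)) * (LINT y|lborel. norm (symbol_density 0 y))"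
    unfolding norm_symbol_density[of "\<alpha> * ln t"] integral_mult_right_zero using assms by (simp add: powr_def mult_ac)
  then show ?thesis using norm_mellin_symbol_le[OF assms(1), of "\<alpha> * ln t"] by (simp add: mult_ac)
qed

lemma norm_mellin_potential_scaled:
  fixes x :: "'a::euclidean_space"
  assumes "x \<noteq> 0" "0 < t"
  shows "norm (mellin_potential (\<alpha> * ln t) x) \<le> 1 / (2 * pi) * (LINT y|lborel. norm (kernel_density (real DIM('a)) 0 y)) * t powr (- (\<alpha> * \<sigma>)) * norm x powr (\<beta> * \<sigma> - real DIM('a))"
proof -
  have "(LINT y|lborel. norm (kernel_density (real DIM('a)) (\<alpha> * ln t) y)) = t powr (- (\<alpha> * \<sigma>)) * (LINT y|lborel. norm (kernel_density (real DIM('a)) 0 y))"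
    unfolding norm_kernel_density[of _ "\<alpha> * ln t"] integral_mult_right_zero using assms by (simp add: powr_def mult_ac)
  then show ?thesis using norm_mellin_potential_le[OF assms(1), of "\<alpha> * ln t"] by (simp add: mult_ac)
qed

end

section \<open>From the sector condition to bounds on the evolution kernel\<close>

lemma cis_eq_minus_cis:
  fixes \<alpha> \<mu> \<nu> :: real
  assumes "0 < \<alpha>" "\<bar>\<mu> - \<nu>\<bar> > \<alpha> / 2" "\<bar>\<mu> - \<nu>\<bar> < 2 - \<alpha> / 2"
  obtains \<theta> where "cis ((\<nu> - \<mu>) * pi) = - cis \<theta>" "\<bar>\<theta>\<bar> < pi - pi * \<alpha> / 2"
proof -
  \<comment> \<open>The two bounds on |\<mu> - \<nu>| are the two sides of |\<delta>| < 1 - \<alpha>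
    / 2. Taking a half turn off (\<nu> - \<mu>) pi, in the direction of its sign, leaves pi \<delta>
    or - pi \<delta>.\<close>
  define \<delta> where "\<delta> = \<bar>\<mu> - \<nu>\<bar> - 1"
  have "\<bar>\<delta>\<bar> < 1 - \<alpha> / 2" using assms unfolding \<delta>_def by linarith
  then have "pi * \<bar>\<delta>\<bar> < pi * (1 - \<alpha> / 2)" by (intro mult_strict_left_mono) auto
  then have \<delta>: "\<bar>pi * \<delta>\<bar> < pi - pi * \<alpha> / 2" by (simp add: abs_mult algebra_simps)
  have c: "cis (pi + x) = - cis x" "cis (- pi + x) = - cis x" for x
    by (simp_all add: cis_mult[symmetric] cis.ctr complex_eq_iff)
  show ?thesis
  proof (cases "\<nu> \<ge> \<mu>")
    case True
    then have "(\<nu> - \<mu>) * pi = pi + pi * \<delta>" unfolding \<delta>_def by (simp add: algebra_simps)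
    then show ?thesis using that[of "pi * \<delta>"] \<delta> c(1) by simp
  next
    case False
    then have "(\<nu> - \<mu>) * pi = - pi + (- (pi * \<delta>))" unfolding \<delta>_def by (simp add: algebra_simps)
    then show ?thesis using that[of "- (pi * \<delta>)"] \<delta> c(2)[of "- (pi * \<delta>)"] by simp
  qed
qed

lemma evolution_symbol_measurable:
  "(evolution_symbol \<alpha> \<beta> \<mu> \<nu> t :: 'a::euclidean_space \<Rightarrow> complex) \<in> borel_measurable borel"
  unfolding evolution_symbol_def[abs_def] mittag_leffler_def by measurable

lemma is_inverse_fourier_inverse_fourier:
  assumes "is_inverse_fourier m V"
  shows "is_inverse_fourier m (inverse_fourier m)"
  using assms unfolding inverse_fourier_def by (rule someI[where P = "is_inverse_fourier m"])

text \<open>Fubini; each pairing converges because one factor is integrable and the other is a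
  bounded Fourier integral. It provides the bounded kernel when the symbol is integrable.\<close>

lemma is_inverse_fourier_of_integrable:
  fixes m :: "'a::euclidean_space \<Rightarrow> complex"
  assumes m: "integrable lborel m"
  shows "is_inverse_fourier m (inverse_fourier_integral m)"
  unfolding is_inverse_fourier_def
proof (intro conjI allI impI)
  have [measurable]: "m \<in> borel_measurable borel" using borel_measurable_integrable[OF m] by simp
  show "m \<in> borel_measurable lborel" by simp
  have im[measurable]: "inverse_fourier_integral m \<in> borel_measurable borel"
    by (rule inverse_fourier_integral_measurable) simp
  then show "inverse_fourier_integral m \<in> borel_measurable lborel" by simp
  fix \<phi> :: "'a \<Rightarrow> complex" assume \<phi>: "schwartz \<phi>"
  have i\<phi>: "integrable lborel \<phi>" using schwartz_derivative_integrable[OF \<phi>, of "[]"] by simp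
  have [measurable]: "\<phi> \<in> borel_measurable borel" using borel_measurable_integrable[OF i\<phi>] by simp
  have [measurable]: "inverse_fourier_integral \<phi> \<in> borel_measurable borel"
    by (rule inverse_fourier_integral_measurable) simp
  have bounded_mult: "integrable lborel (\<lambda>x. inverse_fourier_integral g x * h x)"
    if "integrable lborel h" "inverse_fourier_integral g \<in> borel_measurable borel" for g h :: "'a \<Rightarrow> complex"
  proof (rule Bochner_Integration.integrable_bound)
    show "integrable lborel (\<lambda>x. (LINT y|lborel. norm (g y)) * norm (h x))"
      using that by (intro integrable_mult_right integrable_norm)
    have "0 \<le> (LINT y|lborel. norm (g y))" by (intro integral_nonneg_AE) auto
    then show "AE x in lborel. norm (inverse_fourier_integral g x * h x) \<le> norm ((LINT y|lborel. norm (g y)) * norm (h x))"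
      by (intro AE_I2) (simp add: norm_mult mult_right_mono norm_inverse_fourier_integral_le)
    show "(\<lambda>x. inverse_fourier_integral g x * h x) \<in> borel_measurable lborel"
      using that(2) borel_measurable_integrable[OF that(1)] by measurable
  qed
  show "integrable lborel (\<lambda>x. inverse_fourier_integral m x * \<phi> x)" by (rule bounded_mult[OF i\<phi>]) simp
  show "integrable lborel (\<lambda>\<xi>. m \<xi> * inverse_fourier_integral \<phi> \<xi>)"
    using bounded_mult[OF m, of \<phi>] by (simp add: mult.commute)
  have "(LINT y|lborel. LINT x|lborel. cis (2 * pi * (x \<bullet> y)) * (m y * \<phi> x)) = (LINT x|lborel. LINT y|lborel. cis (2 * pi * (x \<bullet> y)) * (m y * \<phi> x))"
    by (rule lborel_Fubini_product_bound[OF _ integrable_norm[OF i\<phi>] integrable_norm[OF m]]) (measurable, simp add: norm_mult)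
  moreover have "(LINT x|lborel. cis (2 * pi * (x \<bullet> y)) * (m y * \<phi> x)) = m y * inverse_fourier_integral \<phi> y" for y
    unfolding inverse_fourier_integral_def integral_mult_right_zero[symmetric] by (simp add: inner_commute mult_ac)
  moreover have "(LINT y|lborel. cis (2 * pi * (x \<bullet> y)) * (m y * \<phi> x)) = inverse_fourier_integral m x * \<phi> x" for x
    unfolding inverse_fourier_integral_def integral_mult_left_zero[symmetric] by (simp add: mult_ac)
  ultimately show "(LINT x|lborel. inverse_fourier_integral m x * \<phi> x) = (LINT \<xi>|lborel. m \<xi> * inverse_fourier_integral \<phi> \<xi>)"
    by simp
qed

context
  fixes \<alpha> \<beta> \<mu> \<nu> :: real
  assumes \<beta>: "0 < \<beta>" and \<alpha>: "0 < \<alpha>" "\<alpha> < 2"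
    and sep: "\<bar>\<mu> - \<nu>\<bar> > \<alpha> / 2" "\<bar>\<mu> - \<nu>\<bar> < 2 - \<alpha> / 2"
begin

text \<open>Take \<sigma> = a / \<beta>, so that \<beta> \<sigma> - d = a - d: a < \<beta> means
  \<sigma> < 1, and a < d is the range of the Riesz formula.\<close>

lemma evolution_kernel_potential_bound:
  fixes a :: real
  defines "d \<equiv> real DIM('a::euclidean_space)"
  assumes a: "0 < a" "a < \<beta>" "a < d"
  shows "\<exists>C>0. \<forall>t>0. is_inverse_fourier (evolution_symbol \<alpha> \<beta> \<mu> \<nu> t) (evolution_kernel \<alpha> \<beta> \<mu> \<nu> t :: 'a \<Rightarrow> complex) \<and>
     (AE x in lborel. norm (evolution_kernel \<alpha> \<beta> \<mu> \<nu> t (x::'a)) \<le> C * t powr (- (\<alpha> * (a / \<beta>))) * norm x powr (a - d))"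
proof -
  obtain \<theta> where \<theta>: "cis ((\<nu> - \<mu>) * pi) = - cis \<theta>" "\<bar>\<theta>\<bar> < pi - pi * \<alpha> / 2"
    using cis_eq_minus_cis[OF \<alpha>(1) sep] by blast
  define \<sigma> where "\<sigma> = a / \<beta>"
  have \<sigma>: "0 < \<sigma>" "\<sigma> < 1" and \<beta>\<sigma>: "\<beta> * \<sigma> = a" using a \<beta> unfolding \<sigma>_def by auto
  have small: "\<beta> * \<sigma> < real DIM('a)" using a(3) unfolding \<beta>\<sigma> d_def .
  let ?V = "\<lambda>t. mellin_potential \<alpha> \<beta> \<theta> \<sigma> (\<alpha> * ln t) :: 'a \<Rightarrow> complex"
  define C where "C = 1 / (2 * pi) * (LINT y|lborel. norm (kernel_density \<alpha> \<beta> \<theta> \<sigma> d 0 y)) + 1"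
  have "0 \<le> (LINT y|lborel. norm (kernel_density \<alpha> \<beta> \<theta> \<sigma> d 0 y))" by (intro integral_nonneg_AE) auto
  then have C: "C > 0" unfolding C_def by (intro add_nonneg_pos mult_nonneg_nonneg) auto
  have "is_inverse_fourier (evolution_symbol \<alpha> \<beta> \<mu> \<nu> t) (evolution_kernel \<alpha> \<beta> \<mu> \<nu> t :: 'a \<Rightarrow> complex) \<and>
     (AE x in lborel. norm (evolution_kernel \<alpha> \<beta> \<mu> \<nu> t (x::'a)) \<le> C * t powr (- (\<alpha> * (a / \<beta>))) * norm x powr (a - d))"
    if t: "t > 0" for t
  proof -
    have V: "is_inverse_fourier (evolution_symbol \<alpha> \<beta> \<mu> \<nu> t) (?V t)"
    proof (rule mellin_is_inverse_fourier[OF \<alpha> \<theta>(2) \<sigma> \<beta> small evolution_symbol_measurable])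
      fix \<xi> :: 'a assume "\<xi> \<noteq> 0"
      from mellin_symbol_eq[OF \<alpha> \<theta>(2) \<sigma> \<beta> this t]
      show "evolution_symbol \<alpha> \<beta> \<mu> \<nu> t \<xi> = mellin_symbol \<alpha> \<beta> \<theta> \<sigma> (\<alpha> * ln t) \<xi>"
        unfolding evolution_symbol_def \<theta>(1) by simp
    qed
    then have K: "is_inverse_fourier (evolution_symbol \<alpha> \<beta> \<mu> \<nu> t) (evolution_kernel \<alpha> \<beta> \<mu> \<nu> t :: 'a \<Rightarrow> complex)"
      unfolding evolution_kernel_def by (rule is_inverse_fourier_inverse_fourier)
    have "AE x in lborel. norm (evolution_kernel \<alpha> \<beta> \<mu> \<nu> t (x::'a)) \<le> C * t powr (- (\<alpha> * (a / \<beta>))) * norm x powr (a - d)"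
      using inverse_fourier_AE_unique[OF K V] AE_lborel_singleton[of 0]
    proof eventually_elim
      case (elim x)
      have "norm (?V t x) \<le> 1 / (2 * pi) * (LINT y|lborel. norm (kernel_density \<alpha> \<beta> \<theta> \<sigma> d 0 y)) * t powr (- (\<alpha> * \<sigma>)) * norm x powr (a - d)"
        using norm_mellin_potential_scaled[OF \<alpha> \<theta>(2) \<sigma> \<beta> elim(2) t] unfolding \<beta>\<sigma> d_def .
      also have "\<dots> \<le> C * t powr (- (\<alpha> * \<sigma>)) * norm x powr (a - d)"
        unfolding C_def by (intro mult_right_mono) auto
      finally show ?case unfolding elim(1) \<sigma>_def .
    qed
    with K show ?thesis by blast
  qed
  then show ?thesis using C by blast
qed

text \<open>All the power bounds scale alike under x = R y with R = t^(\<alpha> / \<beta>). The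
  kernel therefore lies below R^(-d) times one fixed profile of x / R, and its r-th power integral
  is at most R^(d - d r) times that of the profile. The hypothesis on r says e < \<beta>, which
  leaves room for an exponent between e and min d \<beta>.\<close>

lemma evolution_kernel_Lr_bound:
  fixes r :: real
  defines "d \<equiv> real DIM('a::euclidean_space)"
  assumes r: "1 < r" "d * (1 - 1 / r) < \<beta>"
  shows "\<exists>M>0. \<forall>t>0. integrable lborel (\<lambda>x::'a. norm (evolution_kernel \<alpha> \<beta> \<mu> \<nu> t x) powr r) \<and>
     (LINT x|(lborel::'a measure). norm (evolution_kernel \<alpha> \<beta> \<mu> \<nu> t x) powr r) \<le> (t powr (\<alpha> / \<beta>)) powr (d - d * r) * M"
proof -
  have d: "0 < d" unfolding d_def by simp
  define e where "e = d * (1 - 1 / r)"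
  have e: "0 < e" "e < d" "e < \<beta>" using r d unfolding e_def by (auto simp: field_simps)
  have er: "r * (d - e) = d" using r unfolding e_def by (simp add: field_simps)
  \<comment> \<open>\<open>|x|\<close> to the power \<open>e - d\<close> just fails to be in \<open>L\<^sup>r\<close>; \<open>a1 < e\<close> controls infinity and \<open>a2 > e\<close> the origin.\<close>
  define a1 where "a1 = e / 2"
  define a2 where "a2 = (e + min d \<beta>) / 2"
  have a1: "0 < a1" "a1 < \<beta>" "a1 < d" "a1 < e" using e unfolding a1_def by auto
  have a2: "0 < a2" "a2 < \<beta>" "a2 < d" "e < a2" using e unfolding a2_def by (auto simp: min_def)
  obtain C1 where C1: "C1 > 0" "\<And>t. t > 0 \<Longrightarrow> AE x in lborel. norm (evolution_kernel \<alpha> \<beta> \<mu> \<nu> t (x::'a)) \<le> C1 * t powr (- (\<alpha> * (a1 / \<beta>))) * norm x powr (a1 - d)"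
    using evolution_kernel_potential_bound[OF a1(1,2), where 'a = 'a] a1(3) unfolding d_def by blast
  obtain C2 where C2: "C2 > 0" "\<And>t. t > 0 \<Longrightarrow> AE x in lborel. norm (evolution_kernel \<alpha> \<beta> \<mu> \<nu> t (x::'a)) \<le> C2 * t powr (- (\<alpha> * (a2 / \<beta>))) * norm x powr (a2 - d)"
    using evolution_kernel_potential_bound[OF a2(1,2), where 'a = 'a] a2(3) unfolding d_def by blast
  define C where "C = max C1 C2"
  have C: "C > 0" "C1 \<le> C" "C2 \<le> C" using C1(1) unfolding C_def by auto
  define \<Phi> where "\<Phi> = (\<lambda>x::'a. (C * min (norm x powr (a1 - d)) (norm x powr (a2 - d))) powr r)"
  have [measurable]: "\<Phi> \<in> borel_measurable borel" unfolding \<Phi>_def by measurable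
  have powr_bound: "\<Phi> x \<le> C powr r * norm x powr (- (r * (d - a)))" if "a \<in> {a1, a2}" for a x
  proof -
    have "\<Phi> x \<le> (C * norm x powr (a - d)) powr r"
      unfolding \<Phi>_def using that C r by (intro powr_mono2 mult_left_mono) (auto simp: min_def)
    also have "\<dots> = C powr r * norm x powr (- (r * (d - a)))"
      using C by (simp add: powr_mult powr_powr algebra_simps)
    finally show ?thesis .
  qed
  have \<Phi>0: "0 \<le> \<Phi> x" for x unfolding \<Phi>_def by simp
  have \<Phi>_int: "integrable lborel \<Phi>"
  proof (rule integrable_norm_powr_bounds[where a = "r * (d - a2)" and b = "r * (d - a1)" and C = "C powr r"])
    show "0 \<le> r * (d - a2)" using r a2 by simp
    have "r * (d - a2) < r * (d - e)" "r * (d - e) < r * (d - a1)" using r a1 a2 by auto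
    then show "r * (d - a2) < real DIM('a)" "real DIM('a) < r * (d - a1)" using er unfolding d_def by auto
    show "norm (\<Phi> x) \<le> C powr r * norm x powr (- (r * (d - a2)))" "norm (\<Phi> x) \<le> C powr r * norm x powr (- (r * (d - a1)))" for x
      using powr_bound[of a2 x] powr_bound[of a1 x] \<Phi>0[of x] by auto
  qed simp
  define M where "M = (LINT x|lborel. \<Phi> x) + 1"
  have M: "M > 0" unfolding M_def using \<Phi>0 by (intro add_nonneg_pos integral_nonneg_AE) auto
  have "integrable lborel (\<lambda>x::'a. norm (evolution_kernel \<alpha> \<beta> \<mu> \<nu> t x) powr r) \<and>
     (LINT x|(lborel::'a measure). norm (evolution_kernel \<alpha> \<beta> \<mu> \<nu> t x) powr r) \<le> (t powr (\<alpha> / \<beta>)) powr (d - d * r) * M"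
    if t: "t > 0" for t
  proof -
    define R where "R = t powr (\<alpha> / \<beta>)"
    have R: "R > 0" using t unfolding R_def by simp
    let ?K = "evolution_kernel \<alpha> \<beta> \<mu> \<nu> t :: 'a \<Rightarrow> complex"
    have Km: "?K \<in> borel_measurable lborel"
      using evolution_kernel_potential_bound[OF a1(1,2), where 'a = 'a] a1(3) t unfolding d_def is_inverse_fourier_def by blast
    have scale: "t powr (- (\<alpha> * (a / \<beta>))) * norm x powr (a - d) = R powr (- d) * norm ((1 / R) *\<^sub>R x) powr (a - d)" for a and x :: 'a
    proof -
      have "norm ((1 / R) *\<^sub>R x) powr (a - d) = R powr (- (a - d)) * norm x powr (a - d)"
      proof -
        have n: "norm ((1 / R) *\<^sub>R x) = norm x / R" using R by simp
        have "(norm x / R) powr (a - d) = norm x powr (a - d) / R powr (a - d)"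
          using R by (simp add: powr_divide)
        then show ?thesis unfolding n by (simp only: powr_minus divide_inverse mult.commute)
      qed
      moreover have "R powr (- d) * R powr (- (a - d)) = t powr (- (\<alpha> * (a / \<beta>)))"
      proof -
        have "\<alpha> / \<beta> * - d + \<alpha> / \<beta> * - (a - d) = - (\<alpha> * (a / \<beta>))" using \<beta> by (simp add: field_simps)
        then show ?thesis unfolding R_def by (simp only: powr_powr powr_add[symmetric])
      qed
      ultimately show ?thesis by simp
    qed
    have bound: "AE x in lborel. norm (?K x) powr r \<le> R powr (- (d * r)) * \<Phi> ((1 / R) *\<^sub>R x)"
      using C1(2)[OF t] C2(2)[OF t]
    proof eventually_elim
      case (elim x)
      let ?y = "(1 / R) *\<^sub>R x"
      have "norm (?K x) \<le> R powr (- d) * (C * norm ?y powr (a1 - d))"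
      proof -
        have "norm (?K x) \<le> C1 * (R powr (- d) * norm ?y powr (a1 - d))" using elim(1) unfolding mult.assoc scale .
        also have "\<dots> \<le> C * (R powr (- d) * norm ?y powr (a1 - d))" using C by (intro mult_right_mono) auto
        finally show ?thesis by (simp only: mult_ac)
      qed
      moreover have "norm (?K x) \<le> R powr (- d) * (C * norm ?y powr (a2 - d))"
      proof -
        have "norm (?K x) \<le> C2 * (R powr (- d) * norm ?y powr (a2 - d))" using elim(2) unfolding mult.assoc scale .
        also have "\<dots> \<le> C * (R powr (- d) * norm ?y powr (a2 - d))" using C by (intro mult_right_mono) auto
        finally show ?thesis by (simp only: mult_ac)
      qed
      ultimately have "norm (?K x) \<le> R powr (- d) * (C * min (norm ?y powr (a1 - d)) (norm ?y powr (a2 - d)))"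
        by (simp add: min_def)
      then have "norm (?K x) powr r \<le> (R powr (- d) * (C * min (norm ?y powr (a1 - d)) (norm ?y powr (a2 - d)))) powr r"
        using r by (intro powr_mono2) auto
      also have "\<dots> = R powr (- (d * r)) * \<Phi> ?y"
        unfolding \<Phi>_def using C R by (simp add: powr_mult powr_powr)
      finally show ?case .
    qed
    have \<Phi>R: "integrable lborel (\<lambda>x. \<Phi> ((1 / R) *\<^sub>R x))"
    proof -
      have "integrable (density (distr lborel borel (\<lambda>x::'a. 0 + (1 / R) *\<^sub>R x)) (\<lambda>_. ennreal (\<bar>1 / R\<bar> ^ DIM('a)))) \<Phi>"
        using \<Phi>_int lborel_affine[of "1 / R" "0::'a"] R by (simp add: ennreal_power)
      then have "integrable lborel (\<lambda>x. \<bar>1 / R\<bar> ^ DIM('a) *\<^sub>R \<Phi> (0 + (1 / R) *\<^sub>R x))"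
        by (subst (asm) integrable_density) (auto simp: integrable_distr_eq)
      then show ?thesis using R by simp
    qed
    have int: "integrable lborel (\<lambda>x. norm (?K x) powr r)"
    proof (rule Bochner_Integration.integrable_bound)
      show "integrable lborel (\<lambda>x. R powr (- (d * r)) * \<Phi> ((1 / R) *\<^sub>R x))" by (intro integrable_mult_right \<Phi>R)
      show "AE x in lborel. norm (norm (?K x) powr r) \<le> norm (R powr (- (d * r)) * \<Phi> ((1 / R) *\<^sub>R x))"
        using bound by eventually_elim (simp add: \<Phi>0)
      show "(\<lambda>x. norm (?K x) powr r) \<in> borel_measurable lborel" using Km by measurable
    qed
    have "(LINT x|lborel. norm (?K x) powr r) \<le> (LINT x|lborel. R powr (- (d * r)) * \<Phi> ((1 / R) *\<^sub>R x))"
      by (intro integral_mono_AE int integrable_mult_right \<Phi>R bound)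
    also have "\<dots> = R powr (- (d * r)) * (R powr d * (LINT x|lborel. \<Phi> x))"
    proof -
      have "(LINT x|lborel. \<Phi> x) = \<bar>1 / R\<bar> ^ DIM('a) *\<^sub>R (LINT x|lborel. \<Phi> (0 + (1 / R) *\<^sub>R x))"
        by (rule lborel_integral_affine) (use R in auto)
      moreover have "R powr d = R ^ DIM('a)" using R unfolding d_def by (simp add: powr_realpow)
      ultimately have "(LINT x|lborel. \<Phi> ((1 / R) *\<^sub>R x)) = R powr d * (LINT x|lborel. \<Phi> x)"
        using R by (simp add: power_divide)
      then show ?thesis by simp
    qed
    also have "\<dots> = R powr (d - d * r) * (LINT x|lborel. \<Phi> x)"
      by (simp add: mult.assoc[symmetric] powr_add[symmetric])
    also have "\<dots> \<le> R powr (d - d * r) * M" unfolding M_def by (intro mult_left_mono) auto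
    finally show ?thesis using int unfolding R_def by blast
  qed
  then show ?thesis using M by blast
qed

text \<open>The potential bounds |x|^(a - d) with a < d are unbounded at the origin, so here the
  Fourier integral is estimated by the integral of the symbol. As d < \<beta>, some \<sigma> < 1 has
  \<beta> \<sigma> > d, which gives integrability at infinity; scaling \<xi> by R reduces every time
  to t = 1.\<close>

lemma evolution_kernel_sup_bound:
  defines "d \<equiv> real DIM('a::euclidean_space)"
  assumes d: "d < \<beta>"
  shows "\<exists>M>0. \<forall>t>0. AE x in (lborel :: 'a measure). norm (evolution_kernel \<alpha> \<beta> \<mu> \<nu> t x) \<le> (t powr (\<alpha> / \<beta>)) powr (- d) * M"
proof -
  have d0: "0 < d" unfolding d_def by simp
  obtain \<theta> where \<theta>: "cis ((\<nu> - \<mu>) * pi) = - cis \<theta>" "\<bar>\<theta>\<bar> < pi - pi * \<alpha> / 2"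
    using cis_eq_minus_cis[OF \<alpha>(1) sep] by blast
  let ?m = "\<lambda>t. evolution_symbol \<alpha> \<beta> \<mu> \<nu> t :: 'a \<Rightarrow> complex"
  define S where "S = (\<lambda>\<sigma>. 1 / (2 * pi) * (LINT y|lborel. norm (symbol_density \<alpha> \<theta> \<sigma> 0 y)))"
  have bound: "norm (?m 1 \<xi>) \<le> S \<sigma> * norm \<xi> powr (- (\<beta> * \<sigma>))" if "\<xi> \<noteq> 0" "0 < \<sigma>" "\<sigma> < 1" for \<xi> \<sigma>
  proof -
    have "?m 1 \<xi> = mellin_symbol \<alpha> \<beta> \<theta> \<sigma> (\<alpha> * ln 1) \<xi>"
      using mellin_symbol_eq[OF \<alpha> \<theta>(2) that(2,3) \<beta> that(1), of 1] unfolding evolution_symbol_def \<theta>(1) by simp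
    then show ?thesis
      using norm_mellin_symbol_scaled[OF \<alpha> \<theta>(2) that(2,3) \<beta> that(1), of 1] unfolding S_def by simp
  qed
  \<comment> \<open>\<beta> s1 = d / 2 serves near the origin; \<beta> s2, the midpoint of d and
    \<beta>, serves at infinity.\<close>
  define s1 where "s1 = d / (2 * \<beta>)"
  define s2 where "s2 = (d / \<beta> + 1) / 2"
  have s1: "0 < s1" "s1 < 1" "\<beta> * s1 < d" using d d0 \<beta> unfolding s1_def by (auto simp: field_simps)
  have s2: "0 < s2" "s2 < 1" "d < \<beta> * s2" using d d0 \<beta> unfolding s2_def by (auto simp: field_simps)
  have m1: "integrable lborel (?m 1)"
  proof (rule integrable_norm_powr_bounds[where a = "\<beta> * s1" and b = "\<beta> * s2" and C = "max (S s1) (S s2)"])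
    show "?m 1 \<in> borel_measurable lborel" using evolution_symbol_measurable by simp
    fix \<xi> :: 'a assume "\<xi> \<noteq> 0"
    show "norm (?m 1 \<xi>) \<le> max (S s1) (S s2) * norm \<xi> powr (- (\<beta> * s1))"
      by (rule order_trans[OF bound[OF \<open>\<xi> \<noteq> 0\<close> s1(1,2)]]) (intro mult_right_mono, auto)
    show "norm (?m 1 \<xi>) \<le> max (S s1) (S s2) * norm \<xi> powr (- (\<beta> * s2))"
      by (rule order_trans[OF bound[OF \<open>\<xi> \<noteq> 0\<close> s2(1,2)]]) (intro mult_right_mono, auto)
  qed (use s1 s2 \<beta> in \<open>auto simp: d_def\<close>)
  define M where "M = (LINT \<xi>|lborel. norm (?m 1 \<xi>)) + 1"
  have M: "M > 0" unfolding M_def by (intro add_nonneg_pos integral_nonneg_AE) auto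
  have "AE x in (lborel :: 'a measure). norm (evolution_kernel \<alpha> \<beta> \<mu> \<nu> t x) \<le> (t powr (\<alpha> / \<beta>)) powr (- d) * M" if t: "t > 0" for t
  proof -
    define R where "R = t powr (\<alpha> / \<beta>)"
    have R: "R > 0" using t unfolding R_def by simp
    have scale: "?m t \<xi> = ?m 1 (0 + R *\<^sub>R \<xi>)" for \<xi>
    proof -
      have "t powr \<alpha> * norm \<xi> powr \<beta> = 1 powr \<alpha> * norm (0 + R *\<^sub>R \<xi>) powr \<beta>"
        using R t \<beta> unfolding R_def by (simp add: powr_mult powr_powr)
      then show ?thesis unfolding evolution_symbol_def by simp
    qed
    have mm: "?m 1 \<in> borel_measurable borel" by (rule evolution_symbol_measurable)
    have "integrable (density (distr lborel borel (\<lambda>x::'a. 0 + R *\<^sub>R x)) (\<lambda>_. ennreal (\<bar>R\<bar> ^ DIM('a)))) (?m 1)"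
      using m1 lborel_affine[of R "0::'a"] R by (simp add: ennreal_power)
    then have Rm: "integrable lborel (\<lambda>x. \<bar>R\<bar> ^ DIM('a) *\<^sub>R ?m 1 (0 + R *\<^sub>R x))"
      using mm by (subst (asm) integrable_density) (auto simp: integrable_distr_eq)
    have "integrable lborel (\<lambda>x. (1 / \<bar>R\<bar> ^ DIM('a)) *\<^sub>R (\<bar>R\<bar> ^ DIM('a) *\<^sub>R ?m 1 (0 + R *\<^sub>R x)))"
      by (rule integrable_scaleR_right[OF Rm])
    then have mt: "integrable lborel (?m t)"
      using R unfolding scale[symmetric] by simp
    have "(LINT \<xi>|lborel. norm (?m 1 \<xi>)) = \<bar>R\<bar> ^ DIM('a) *\<^sub>R (LINT \<xi>|lborel. norm (?m 1 (0 + R *\<^sub>R \<xi>)))"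
      using mm R by (intro lborel_integral_affine) auto
    then have tot: "(LINT \<xi>|lborel. norm (?m t \<xi>)) = R powr (- d) * (LINT \<xi>|lborel. norm (?m 1 \<xi>))"
      using R unfolding scale[symmetric] d_def by (simp add: powr_minus powr_realpow field_simps)
    have V: "is_inverse_fourier (?m t) (inverse_fourier_integral (?m t))"
      by (rule is_inverse_fourier_of_integrable[OF mt])
    then have K: "is_inverse_fourier (?m t) (evolution_kernel \<alpha> \<beta> \<mu> \<nu> t)"
      unfolding evolution_kernel_def by (rule is_inverse_fourier_inverse_fourier)
    show ?thesis using inverse_fourier_AE_unique[OF K V]
    proof eventually_elim
      case (elim x)
      have "norm (evolution_kernel \<alpha> \<beta> \<mu> \<nu> t x) \<le> (LINT \<xi>|lborel. norm (?m t \<xi>))"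
        unfolding elim by (rule norm_inverse_fourier_integral_le)
      also have "\<dots> \<le> R powr (- d) * M" unfolding tot M_def by (intro mult_left_mono) auto
      finally show ?case unfolding R_def .
    qed
  qed
  then show ?thesis using M by blast
qed

end

section \<open>Lebesgue norms of the solution\<close>

lemma in_Lp_infinity_bound:
  fixes g :: "'a::euclidean_space \<Rightarrow> complex"
  assumes "g \<in> borel_measurable lborel" "\<And>x. norm (g x) \<le> B"
  shows "in_Lp \<infinity> g" and "Lp_norm \<infinity> g \<le> B"
proof -
  have B: "0 \<le> B" using order_trans[OF norm_ge_zero assms(2)] .
  have "esssup lborel (\<lambda>x. ennreal (norm (g x))) \<le> ennreal B"
    using assms by (intro esssup_I AE_I2 ennreal_leI) auto
  then show "in_Lp \<infinity> g" "Lp_norm \<infinity> g \<le> B"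
    using assms(1) B unfolding in_Lp_def Lp_norm_def by (auto intro: le_less_trans enn2real_leI)
qed

lemma convolve_measurable:
  fixes K f :: "'a::euclidean_space \<Rightarrow> complex"
  assumes [measurable]: "K \<in> borel_measurable borel" "f \<in> borel_measurable borel"
  shows "convolve K f \<in> borel_measurable lborel"
  unfolding convolve_def[abs_def] by measurable

text \<open>The estimate holds at every x, not just almost everywhere: for each x, the reflected and
  translated null set where \<open>K\<close> exceeds \<open>B\<close> is still null in y.\<close>

lemma convolve_bounded_kernel:
  fixes K f :: "'a::euclidean_space \<Rightarrow> complex"
  assumes K: "K \<in> borel_measurable borel" "AE x in lborel. norm (K x) \<le> B" and f: "integrable lborel f"
  shows "integrable lborel (\<lambda>y. K (x - y) * f y)" and "norm (convolve K f x) \<le> B * (LINT y|lborel. norm (f y))"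
proof -
  have [measurable]: "K \<in> borel_measurable borel" "f \<in> borel_measurable borel"
    using K borel_measurable_integrable[OF f] by auto
  have AEK: "AE y in lborel. norm (K (x - y)) \<le> B"
    by (rule lborel_AE_reflect[OF K(2)]) measurable
  have AEB: "AE y in lborel. norm (K (x - y) * f y) \<le> B * norm (f y)"
    using AEK by eventually_elim (simp add: norm_mult mult_right_mono)
  have Bf: "integrable lborel (\<lambda>y. B * norm (f y))" using f by (intro integrable_mult_right integrable_norm)
  show i: "integrable lborel (\<lambda>y. K (x - y) * f y)"
  proof (rule Bochner_Integration.integrable_bound[OF Bf])
    show "AE y in lborel. norm (K (x - y) * f y) \<le> norm (B * norm (f y))"
      using AEB by eventually_elim (metis abs_ge_self order_trans real_norm_def)
  qed measurable
  have "norm (convolve K f x) \<le> (LINT y|lborel. norm (K (x - y) * f y))"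
    unfolding convolve_def by (rule integral_norm_bound)
  also have "\<dots> \<le> (LINT y|lborel. B * norm (f y))"
    by (intro integral_mono_AE integrable_norm i Bf AEB)
  finally show "norm (convolve K f x) \<le> B * (LINT y|lborel. norm (f y))" by simp
qed

text \<open>The first conjunct certifies that \<open>evolution_kernel\<close> is a true inverse
  Fourier transform and not an arbitrary value of the choice operator. The integrability clause does
  the same for the convolution, whose value would otherwise be the default 0.\<close>

theorem theorem4p1:
  fixes \<alpha> \<beta> \<mu> \<nu> :: real and p q :: ereal
  assumes "\<beta> > 0"
    and "-1 < \<mu>" "\<mu> \<le> 1" and "-1 < \<nu>" "\<nu> \<le> 1"
    and "0 < \<alpha>" "\<alpha> < 2"
    and "\<bar>\<mu> - \<nu>\<bar> > \<alpha> / 2"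
    (* the next line excludes wrap-around of the argument of exp((nu - mu) pi i) past 2 pi:
       together with the previous one it says that the principal argument exceeds alpha pi / 2
       in absolute value; without it the claim is false, e.g. alpha = 1, beta = 2, d = 1,
       nu = - mu = 3/4 (unitary Schroedinger group), p = 1, q = 2 *)
    and "\<bar>\<mu> - \<nu>\<bar> < 2 - \<alpha> / 2"
    and "1 \<le> p" "p < q"
    and "1 / p - 1 / q < ereal (\<beta> / real CARD('d::finite))"
  shows
    "(\<forall>t>0. is_inverse_fourier (evolution_symbol \<alpha> \<beta> \<mu> \<nu> t :: real^'d \<Rightarrow> complex)
              (evolution_kernel \<alpha> \<beta> \<mu> \<nu> t)) \<and>
     (\<exists>C>0. \<forall>t>0. \<forall>f :: real^'d \<Rightarrow> complex. in_Lp p f \<longrightarrow>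
        (AE x in lborel. integrable lborel (\<lambda>y. evolution_kernel \<alpha> \<beta> \<mu> \<nu> t (x - y) * f y)) \<and>
        in_Lp q (evolution_solution \<alpha> \<beta> \<mu> \<nu> f t) \<and>
        Lp_norm q (evolution_solution \<alpha> \<beta> \<mu> \<nu> f t)
          \<le> C * t powr (- (\<alpha> / \<beta>) * real CARD('d) * real_of_ereal (1 / p - 1 / q)) * Lp_norm p f)"
proof
  define d where "d = real CARD('d)"
  have d: "0 < d" unfolding d_def by simp
  have DIM: "real DIM(real^'d) = d" unfolding d_def by simp
  let ?K = "\<lambda>t. evolution_kernel \<alpha> \<beta> \<mu> \<nu> t :: real^'d \<Rightarrow> complex"
  note ctx = assms(1) assms(6,7) assms(8,9)
  \<comment> \<open>Any positive exponent below both \<beta> and d yields existence of the inverse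
    Fourier transform.\<close>
  define a0 where "a0 = min \<beta> d / 2"
  have a0: "0 < a0" "a0 < \<beta>" "a0 < real DIM(real^'d)" using assms(1) d unfolding a0_def DIM by (auto simp: min_def)
  show part1: "\<forall>t>0. is_inverse_fourier (evolution_symbol \<alpha> \<beta> \<mu> \<nu> t :: real^'d \<Rightarrow> complex) (?K t)"
    using evolution_kernel_potential_bound[OF ctx a0] by blast
  then have Km: "?K t \<in> borel_measurable borel" if "t > 0" for t
    using that unfolding is_inverse_fourier_def by simp
  obtain P where P: "p = ereal P" using assms(10,11) by (cases p) auto
  have P1: "1 \<le> P" using assms(10) unfolding P by (simp add: one_ereal_def)
  have in_p: "f \<in> borel_measurable borel \<and> integrable lborel (\<lambda>x. norm (f x) powr P)" if "in_Lp p f" for f :: "real^'d \<Rightarrow> complex"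
    using that unfolding in_Lp_def P by simp
  have norm_p: "Lp_norm p f = (LINT x|lborel. norm (f x) powr P) powr (1 / P)" for f :: "real^'d \<Rightarrow> complex"
    unfolding Lp_norm_def P by simp
  define e where "e = real_of_ereal (1 / p - 1 / q)"
  let ?goal = "\<lambda>C t f. (AE x in lborel. integrable lborel (\<lambda>y. ?K t (x - y) * f y)) \<and>
        in_Lp q (evolution_solution \<alpha> \<beta> \<mu> \<nu> f t) \<and>
        Lp_norm q (evolution_solution \<alpha> \<beta> \<mu> \<nu> f t) \<le> C * t powr (- (\<alpha> / \<beta>) * d * e) * Lp_norm p f"
  have "\<exists>C>0. \<forall>t>0. \<forall>f. in_Lp p f \<longrightarrow> ?goal C t f"
  \<comment> \<open>Young's exponent satisfies 1 / r = 1 - e, so e = 1 is r = \<infinity>, which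
    occurs only for p = 1 and q = \<infinity>.\<close>
  proof (cases "e = 1")
    case True
    have "P = 1 \<and> q = \<infinity>"
    proof (cases q)
      case (real Q)
      then have "P < Q" using assms(11) P by simp
      then have "e = 1 / P - 1 / Q" "0 < 1 / Q" "1 / P \<le> 1"
        using P1 unfolding e_def P real by (auto simp: one_ereal_def)
      then show ?thesis using True by linarith
    next
      case PInf
      then have "e = 1 / P" unfolding e_def P using P1 by (simp add: one_ereal_def)
      then show ?thesis using True PInf by simp
    qed (use assms(11) in auto)
    then have P_1: "P = 1" and q: "q = \<infinity>" by auto
    have "ereal 1 < ereal (\<beta> / d)" using assms(12) unfolding P q P_1 d_def by (simp add: one_ereal_def)
    then have "d < \<beta>" using d by (simp add: field_simps)
    then obtain M where M: "M > 0" "\<And>t. t > 0 \<Longrightarrow> AE x in lborel. norm (?K t x) \<le> (t powr (\<alpha> / \<beta>)) powr (- d) * M"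
      using evolution_kernel_sup_bound[OF ctx, where 'a = "real^'d"] unfolding DIM by blast
    have "?goal M t f" if t: "t > 0" and f: "in_Lp p f" for t f
    proof -
      have fm: "f \<in> borel_measurable borel" using in_p[OF f] by simp
      have "integrable lborel (\<lambda>x. norm (f x))" using in_p[OF f] unfolding P_1 by simp
      then have fi: "integrable lborel f" using fm by (subst (asm) integrable_norm_iff) auto
      note cb = convolve_bounded_kernel[OF Km[OF t] M(2)[OF t] fi]
      have nf: "Lp_norm p f = (LINT y|lborel. norm (f y))" unfolding norm_p P_1 by (simp add: integral_nonneg_AE)
      note inf = in_Lp_infinity_bound[OF convolve_measurable[OF Km[OF t] fm] cb(2)]
      have eqn: "(t powr (\<alpha> / \<beta>)) powr (- d) * M * (LINT y|lborel. norm (f y)) = M * t powr (- (\<alpha> / \<beta>) * d * e) * Lp_norm p f"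
        unfolding nf True by (simp add: powr_powr mult_ac)
      show ?thesis unfolding evolution_solution_def q
        by (intro conjI AE_I2 cb(1) inf(1) order_trans[OF inf(2) eq_refl[OF eqn]])
    qed
    then show ?thesis using M(1) by blast
  next
    case False
    have e: "0 < e" "e < 1" "e < \<beta> / d" and eq: "q = \<infinity> \<and> e = 1 / P \<or> (\<exists>Q. q = ereal Q \<and> P < Q \<and> e = 1 / P - 1 / Q)"
    proof -
      have "(0 < e \<and> e \<le> 1 \<and> e < \<beta> / d) \<and> (q = \<infinity> \<and> e = 1 / P \<or> (\<exists>Q. q = ereal Q \<and> P < Q \<and> e = 1 / P - 1 / Q))"
      proof (cases q)
        case (real Q)
        then have PQ: "P < Q" using assms(11) P by simp
        then have eQ: "e = 1 / P - 1 / Q" "1 / p - 1 / q = ereal (1 / P - 1 / Q)"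
          using P1 unfolding e_def P real by (auto simp: one_ereal_def)
        moreover have "1 / Q < 1 / P" "0 < 1 / Q" "1 / P \<le> 1" using PQ P1 by (auto simp: frac_less2)
        then have "0 < e \<and> e \<le> 1" unfolding eQ(1) by linarith
        moreover have "e < \<beta> / d" using assms(12) eQ unfolding d_def by simp
        ultimately show ?thesis using real PQ by auto
      next
        case PInf
        then have eP: "e = 1 / P" "1 / p - 1 / q = ereal (1 / P)" unfolding e_def P using P1 by (auto simp: one_ereal_def)
        moreover have "e < \<beta> / d" using assms(12) eP unfolding d_def by simp
        ultimately show ?thesis using PInf P1 by auto
      qed (use assms(11) in auto)
      then show "0 < e" "e < 1" "e < \<beta> / d" "q = \<infinity> \<and> e = 1 / P \<or> (\<exists>Q. q = ereal Q \<and> P < Q \<and> e = 1 / P - 1 / Q)"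
        using False by auto
    qed
    define r where "r = 1 / (1 - e)"
    have r: "1 < r" "1 / r = 1 - e" using e unfolding r_def by (auto simp: field_simps)
    have "d * e < \<beta>" using e d by (simp add: field_simps)
    moreover have "1 - 1 / r = e" using r(2) by simp
    ultimately have "d * (1 - 1 / r) < \<beta>" by simp
    then obtain M where M: "M > 0" "\<And>t. t > 0 \<Longrightarrow> integrable lborel (\<lambda>x. norm (?K t x) powr r)"
      "\<And>t. t > 0 \<Longrightarrow> (LINT x|lborel. norm (?K t x) powr r) \<le> (t powr (\<alpha> / \<beta>)) powr (d - d * r) * M"
      using evolution_kernel_Lr_bound[OF ctx r(1), where 'a = "real^'d"] unfolding DIM by blast
    have "?goal (M powr (1 / r)) t f" if t: "t > 0" and f: "in_Lp p f" for t f
    proof -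
      define N where "N = (t powr (\<alpha> / \<beta>)) powr (d - d * r) * M"
      have N: "N > 0" using M(1) t unfolding N_def by simp
      \<comment> \<open>The power of t in the theorem arises here, from (d - d r) / r = - d
        e.\<close>
      have Nr: "N powr (1 / r) = M powr (1 / r) * t powr (- (\<alpha> / \<beta>) * d * e)"
      proof -
        have "(d - d * r) * (1 / r) = d * (1 / r) - d" using r(1) by (simp add: field_simps)
        also have "\<dots> = - d * e" unfolding r(2) by algebra
        finally have "(d - d * r) * (1 / r) = - d * e" .
        then have "\<alpha> / \<beta> * (d - d * r) * (1 / r) = - (\<alpha> / \<beta>) * d * e" by (metis mult.assoc mult_minus_left mult_minus_right)
        then show ?thesis unfolding N_def using M(1) by (simp add: powr_mult powr_powr mult.commute)
      qed
      have fm: "f \<in> borel_measurable borel" and fi: "integrable lborel (\<lambda>x. norm (f x) powr P)" using in_p[OF f] by auto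
      have pos: "0 < P" "0 < r" using P1 r by auto
      note young = Km[OF t] fm pos N M(2)[OF t] M(3)[OF t, folded N_def] fi
      have cm: "convolve (?K t) f \<in> borel_measurable lborel" by (rule convolve_measurable[OF Km[OF t] fm])
      from eq show ?thesis
      proof (elim disjE exE conjE)
        assume q: "q = \<infinity>" and eP: "e = 1 / P"
        have "1 / P + 1 / r = 1" using eP r by simp
        note ys = Young_convolution_sup[OF young this]
        note inf = in_Lp_infinity_bound[OF cm ys(2)]
        show ?thesis unfolding evolution_solution_def q norm_p
          by (intro conjI AE_I2 ys(1) inf(1) inf(2)[unfolded Nr])
      next
        fix Q assume q: "q = ereal Q" and PQ: "P < Q" and eQ: "e = 1 / P - 1 / Q"
        have Q: "0 < Q" using PQ P1 by simp
        have conj: "1 / P + 1 / r = 1 + 1 / Q" using eQ r by simp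
        \<comment> \<open>Given 1 / P + 1 / r = 1 + 1 / Q, this is the same as 1 / P \<le>
          1.\<close>
        have "1 / Q \<le> 1 / r" using conj P1 by (smt (verit) divide_le_eq_1_pos)
        then have "r \<le> Q" using Q pos by (simp add: field_simps)
        note y = Young_convolution[OF young Q conj less_imp_le[OF PQ] this]
        show ?thesis using y cm unfolding evolution_solution_def q P Nr in_Lp_def Lp_norm_def by simp
      qed
    qed
    moreover have "M powr (1 / r) > 0" using M(1) by simp
    ultimately show ?thesis by blast
  qed
  then show "\<exists>C>0. \<forall>t>0. \<forall>f :: real^'d \<Rightarrow> complex. in_Lp p f \<longrightarrow>
        (AE x in lborel. integrable lborel (\<lambda>y. evolution_kernel \<alpha> \<beta> \<mu> \<nu> t (x - y) * f y)) \<and>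
        in_Lp q (evolution_solution \<alpha> \<beta> \<mu> \<nu> f t) \<and>
        Lp_norm q (evolution_solution \<alpha> \<beta> \<mu> \<nu> f t)
          \<le> C * t powr (- (\<alpha> / \<beta>) * real CARD('d) * real_of_ereal (1 / p - 1 / q)) * Lp_norm p f"
    unfolding d_def e_def .
qed

end
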